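(* Let $\chi$ be a character of the hyperoctahedral group $B_n$ and let $\mathcal{B}$ be a finite set endowed with a map $\mathrm{sDes}:\mathcal{B}\to\Sigma^B(n)$. Then $\mathcal{B}$ is a fine set for $\chi$ if and only if $$\mathrm{ch}(\chi)=\sum_{b\in\mathcal{B}}F_{\mathrm{sDes}(b)}(x,y).$$ In particular, the distribution of the signed descent set over $\mathcal{B}$ (i.e. the numbers $|\{b\in\mathcal{B}:\mathrm{sDes}(b)=\sigma\}|$, $\sigma\in\Sigma^B(n)$) is uniquely determined by $\chi$.
   Context: $[n]=\{1,\dots,n\}$. $B_n$ is the group of signed permutations. A signed set is a pair $\sigma=(S,\varepsilon)$ with $n\in S\subseteq[n]$ and $\varepsilon:S\to\{-,+\}$; $\Sigma^B(n)$ denotes the set of signed sets. Writing $S=\{s_1<\dots<s_k=n\}$ and $s_0=0$, the sign vector $\tilde\varepsilon:[n]\to\{-,+\}$ is $\tilde\varepsilon(j)=\varepsilon(s_i)$ for $s_{i-1}<j\le s_i$. Signed sets correspond bijectively to signed compositions of $n$ (compositions $(\gamma_1,\dots,\gamma_k)$ of $n$ some of whose parts are barred): $S(\gamma)$ is the set of partial sums $r_i=\gamma_1+\dots+\gamma_i$ and the sign of $r_i$ is $-$ iff the $i$-th part is barred. Let ${\rm wDes}(\sigma)$ be the set of $s_i\in S$, $i<k$, such that either $\varepsilon(s_i)=\varepsilon(s_{i+1})$, or $\varepsilon(s_i)=+$ and $\varepsilon(s_{i+1})=-$. With commuting variables $x=(x_1,x_2,\dots)$, $y=(y_1,y_2,\dots)$,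 define $$F_\sigma(x,y)=\sum_{\substack{i_1\le\dots\le i_n\\ j\in{\rm wDes}(\sigma)\Rightarrow i_j<i_{j+1}}} z_{i_1}\cdots z_{i_n},$$ where the $j$-th factor $z_{i_j}$ is $x_{i_j}$ if $\tilde\varepsilon(j)=+$ and $y_{i_j}$ if $\tilde\varepsilon(j)=-$. Weights: let $\gamma$ be a signed composition with partial sums $r_0=0<r_1<\dots<r_k=n$ and blocks $I_i=\{r_{i-1}+1,\dots,r_i\}$. Then $\sigma=(S,\varepsilon)$ is $\gamma$-unimodal if for each $i$, $S\cap\{r_{i-1}+1,\dots,r_i-1\}$ is an initial segment (possibly empty) of $\{r_{i-1}+1,\dots,r_i-1\}$. Set $\mathrm{wt}_\gamma(\sigma)=0$ if $\sigma$ is not $\gamma$-unimodal or if $\tilde\varepsilon$ is not constant on some block $I_i$; otherwise $\mathrm{wt}_\gamma(\sigma)=(-1)^{|S\setminus S(\gamma)|+n_\gamma(\sigma)}$, where $n_\gamma(\sigma)$ is the number of $i$ such that $\tilde\varepsilon$ is $-$ on $I_i$ and the $i$-th part of $\gamma$ is barred. Signed cycle type: viewing $w\in B_n$ as a permutation of $\Omega_n=\{1,\dots,n,\bar1,\dots,\bar n\}$, its cycles come either in pairs $c\ne\bar c$ (a positive cycle of length $|c|$) or as single cycles $c=\bar c$ (a negative cycle of length $|c|/2$); the signed cycle type is the bipartition $(\alpha,\beta)$ of lengths of positive and negative cycles. For a class function $\chi$ on $B_n$ and signed composition $\gamma$, $\chi(\gamma)$ is the value of $\chi$ at elements of signed cycle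 type $(\alpha,\beta)$ where $\alpha$ (resp. $\beta$) is the decreasing rearrangement of the unbarred (resp. barred) parts of $\gamma$. A set $\mathcal{B}$ with a map $\mathrm{sDes}:\mathcal{B}\to\Sigma^B(n)$ is a fine set for $\chi$ if $\chi(\gamma)=\sum_{b\in\mathcal{B}}\mathrm{wt}_\gamma(\mathrm{sDes}(b))$ for every signed composition $\gamma$ of $n$. Frobenius characteristic: $p^{\pm}_k=\sum_i(x_i^k\pm y_i^k)$, $p^\pm_\lambda=\prod_j p^\pm_{\lambda_j}$, and $\mathrm{ch}(\chi)=\frac{1}{2^nn!}\sum_{w\in B_n}\chi(w)\,p^+_\alpha(x,y)p^-_\beta(x,y)$, where $(\alpha,\beta)$ is the signed cycle type of $w$. A character means a non-virtual character. *)

theory Defs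
  imports
    "HOL-Library.Multiset"
    "HOL-Library.FuncSet"
    "HOL-Combinatorics.Orbits"
    "Jordan_Normal_Form.Matrix"
begin

section \<open>Formal power series in arbitrarily many commuting variables\<close>

text \<open>A monomial is the multiset of its variables; a series is its coefficient function.\<close>

typedef ('v, 'a) mps = "UNIV :: ('v multiset \<Rightarrow> 'a) set"
  morphisms mps_coeff Abs_mps ..

setup_lifting type_definition_mps

lemma mps_eqI: "(\<And>M. mps_coeff f M = mps_coeff g M) \<Longrightarrow> f = g"
  by (metis ext mps_coeff_inject)

lemma finite_submultisets: "finite {A. A \<subseteq># M}"
proof (induction M)
  case empty
  then show ?case by simp
next
  case (add x M)
  have "{A. A \<subseteq># add_mset x M} \<subseteq> {A. A \<subseteq># M} \<union> add_mset x ` {A. A \<subseteq># M}"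
  proof
    fix A assume "A \<in> {A. A \<subseteq># add_mset x M}"
    then have A: "A \<subseteq># add_mset x M" by simp
    show "A \<in> {A. A \<subseteq># M} \<union> add_mset x ` {A. A \<subseteq># M}"
    proof (cases "x \<in># A")
      case True
      then obtain A' where "A = add_mset x A'" by (meson multi_member_split)
      with A show ?thesis by auto
    next
      case False
      have "A \<subseteq># M"
      proof (rule mset_subset_eqI)
        fix a
        show "count A a \<le> count M a"
          using False mset_subset_eq_count[OF A, of a] by (cases "a = x") (auto simp: not_in_iff)
      qed
      then show ?thesis by simp
    qed
  qed
  with add show ?case using finite_subset by blast
qed

instantiation mps :: (type, comm_ring_1) comm_ring_1
begin

lift_definition zero_mps :: "('a, 'b) mps" is "\<lambda>_. 0" .

lift_definition one_mps :: "('a, 'b) mps" is "\<lambda>M. if M = {#} then 1 else 0" .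

lift_definition plus_mps :: "('a, 'b) mps \<Rightarrow> ('a, 'b) mps \<Rightarrow> ('a, 'b) mps"
  is "\<lambda>f g M. f M + g M" .

lift_definition minus_mps :: "('a, 'b) mps \<Rightarrow> ('a, 'b) mps \<Rightarrow> ('a, 'b) mps"
  is "\<lambda>f g M. f M - g M" .

lift_definition uminus_mps :: "('a, 'b) mps \<Rightarrow> ('a, 'b) mps"
  is "\<lambda>f M. - f M" .

lift_definition times_mps :: "('a, 'b) mps \<Rightarrow> ('a, 'b) mps \<Rightarrow> ('a, 'b) mps"
  is "\<lambda>f g M. \<Sum>A | A \<subseteq># M. f A * g (M - A)" .

instance
proof
  fix a b c :: "('a, 'b) mps"
  show "a * b * c = a * (b * c)"
  proof (rule mps_eqI)
    fix M
    let ?a = "mps_coeff a" and ?b = "mps_coeff b" and ?c = "mps_coeff c"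
    have "mps_coeff (a * b * c) M =
        (\<Sum>A | A \<subseteq># M. \<Sum>C | C \<subseteq># A. ?a C * ?b (A - C) * ?c (M - A))"
      by (simp add: times_mps.rep_eq sum_distrib_right)
    also have "\<dots> = (\<Sum>(A, C) \<in> (SIGMA A : {A. A \<subseteq># M}. {C. C \<subseteq># A}).
        ?a C * ?b (A - C) * ?c (M - A))"
      by (rule sum.Sigma) (auto simp: finite_submultisets)
    also have "\<dots> = (\<Sum>(C, D) \<in> (SIGMA C : {C. C \<subseteq># M}. {D. D \<subseteq># M - C}).
        ?a C * (?b D * ?c (M - C - D)))"
      by (rule sum.reindex_bij_witness[where i = "\<lambda>(C, D). (C + D, C)" and j = "\<lambda>(A, C). (C, A - C)"])
        (auto simp: mult.assoc subset_mset.le_iff_add add.assoc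
          simp flip: diff_diff_add_mset)
    also have "\<dots> = (\<Sum>C | C \<subseteq># M. \<Sum>D | D \<subseteq># M - C. ?a C * (?b D * ?c (M - C - D)))"
      by (rule sum.Sigma[symmetric]) (auto simp: finite_submultisets)
    also have "\<dots> = mps_coeff (a * (b * c)) M"
      by (simp add: times_mps.rep_eq sum_distrib_left)
    finally show "mps_coeff (a * b * c) M = mps_coeff (a * (b * c)) M" .
  qed
  show "a * b = b * a"
  proof (rule mps_eqI)
    fix M
    show "mps_coeff (a * b) M = mps_coeff (b * a) M"
      unfolding times_mps.rep_eq
      by (rule sum.reindex_bij_witness[where i = "\<lambda>A. M - A" and j = "\<lambda>A. M - A"])
        (auto simp: mult.commute subset_mset.le_iff_add)
  qed
  show "1 * a = a"
  proof (rule mps_eqI)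
    fix M
    have "mps_coeff (1 * a) M = (\<Sum>A | A \<subseteq># M. if A = {#} then mps_coeff a M else 0)"
      unfolding times_mps.rep_eq one_mps.rep_eq by (rule sum.cong) auto
    also have "\<dots> = mps_coeff a M"
      by (simp add: finite_submultisets)
    finally show "mps_coeff (1 * a) M = mps_coeff a M" .
  qed
  show "(a + b) * c = a * c + b * c"
    by (rule mps_eqI)
      (simp add: times_mps.rep_eq plus_mps.rep_eq distrib_right sum.distrib)
  show "(0 :: ('a, 'b) mps) \<noteq> 1"
  proof
    assume "(0 :: ('a, 'b) mps) = 1"
    then have "mps_coeff (0 :: ('a, 'b) mps) {#} = mps_coeff 1 {#}" by simp
    then show False by (simp add: zero_mps.rep_eq one_mps.rep_eq)
  qed
qed (auto intro!: mps_eqI simp: plus_mps.rep_eq minus_mps.rep_eq uminus_mps.rep_eq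
      zero_mps.rep_eq algebra_simps)

end

lift_definition mps_const :: "'a::comm_ring_1 \<Rightarrow> ('v, 'a) mps"
  is "\<lambda>c M. if M = {#} then c else 0" .

text \<open>
  The formal sum of the monomials \<open>m i\<close>, \<open>i \<in> I\<close>. The index set may be infinite; the sum is
  meaningful if every monomial occurs for finitely many \<open>i\<close> only.
\<close>

lift_definition monomial_sum :: "'i set \<Rightarrow> ('i \<Rightarrow> 'v multiset) \<Rightarrow> ('v, 'a::comm_ring_1) mps"
  is "\<lambda>I m M. of_nat (card {i \<in> I. m i = M})" .


section \<open>Signed sets and the series \<open>F\<close>\<close>

datatype sign = Plus | Minus

datatype var = X nat | Y nat

text \<open>The sign function is extensional, so that equal signed sets are equal pairs.\<close>

type_synonym signed_set = "nat set \<times> (nat \<Rightarrow> sign)"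

definition signed_sets :: "nat \<Rightarrow> signed_set set" where
  "signed_sets n = {(S, \<epsilon>). n \<in> S \<and> S \<subseteq> {1..n} \<and> \<epsilon> \<in> S \<rightarrow>\<^sub>E UNIV}"

definition sign_vector :: "signed_set \<Rightarrow> nat \<Rightarrow> sign" where
  "sign_vector \<sigma> j = (case \<sigma> of (S, \<epsilon>) \<Rightarrow> \<epsilon> (Min {s \<in> S. j \<le> s}))"

definition wDes :: "signed_set \<Rightarrow> nat set" where
  "wDes \<sigma> = (case \<sigma> of (S, \<epsilon>) \<Rightarrow>
     {s \<in> S. s \<noteq> Max S \<and>
        (let t = Min {t \<in> S. s < t} in \<epsilon> s = \<epsilon> t \<or> (\<epsilon> s = Plus \<and> \<epsilon> t = Minus))})"

definition signed_var :: "sign \<Rightarrow> nat \<Rightarrow> var" where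
  "signed_var e i = (case e of Plus \<Rightarrow> X i | Minus \<Rightarrow> Y i)"

definition F :: "nat \<Rightarrow> signed_set \<Rightarrow> (var, complex) mps" where
  "F n \<sigma> = monomial_sum
     {i \<in> {1..n} \<rightarrow>\<^sub>E {1..}.
        (\<forall>j\<in>{1..<n}. i j \<le> i (j + 1)) \<and> (\<forall>j\<in>wDes \<sigma>. i j < i (j + 1))}
     (\<lambda>i. image_mset (\<lambda>j. signed_var (sign_vector \<sigma> j) (i j)) (mset_set {1..n}))"


section \<open>Signed compositions and weights\<close>

text \<open>A part paired with \<open>Minus\<close> is a barred part. Parts are numbered from 0.\<close>

type_synonym signed_composition = "(nat \<times> sign) list"

definition signed_compositions :: "nat \<Rightarrow> signed_composition set" where
  "signed_compositions n = {\<gamma>. (\<forall>p\<in>set \<gamma>. 0 < fst p) \<and> sum_list (map fst \<gamma>) = n}"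

definition partial_sum :: "signed_composition \<Rightarrow> nat \<Rightarrow> nat" where
  "partial_sum \<gamma> i = sum_list (map fst (take i \<gamma>))"

definition partial_sums :: "signed_composition \<Rightarrow> nat set" where
  "partial_sums \<gamma> = partial_sum \<gamma> ` {1..length \<gamma>}"

definition block :: "signed_composition \<Rightarrow> nat \<Rightarrow> nat set" where
  "block \<gamma> i = {partial_sum \<gamma> i + 1..partial_sum \<gamma> (i + 1)}"

definition initial_segment :: "nat set \<Rightarrow> nat set \<Rightarrow> bool" where
  "initial_segment A P \<longleftrightarrow> A \<subseteq> P \<and> (\<forall>a\<in>A. \<forall>b\<in>P. b \<le> a \<longrightarrow> b \<in> A)"

definition unimodal :: "signed_composition \<Rightarrow> signed_set \<Rightarrow> bool" where
  "unimodal \<gamma> \<sigma> \<longleftrightarrow> (\<forall>i<length \<gamma>.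
     let P = {partial_sum \<gamma> i + 1..<partial_sum \<gamma> (i + 1)} in initial_segment (fst \<sigma> \<inter> P) P)"

definition wt :: "signed_composition \<Rightarrow> signed_set \<Rightarrow> int" where
  "wt \<gamma> \<sigma> =
     (if unimodal \<gamma> \<sigma> \<and> (\<forall>i<length \<gamma>. \<exists>e. \<forall>j\<in>block \<gamma> i. sign_vector \<sigma> j = e)
      then (- 1) ^ (card (fst \<sigma> - partial_sums \<gamma>) +
         card {i. i < length \<gamma> \<and> (\<forall>j\<in>block \<gamma> i. sign_vector \<sigma> j = Minus) \<and> snd (\<gamma> ! i) = Minus})
      else 0)"


section \<open>The hyperoctahedral group and its characters\<close>

text \<open>The barred letters are encoded as negative integers.\<close>

definition Omega :: "nat \<Rightarrow> int set" where
  "Omega n = {- int n..int n} - {0}"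

definition signed_perms :: "nat \<Rightarrow> (int \<Rightarrow> int) set" where
  "signed_perms n = {w. w permutes Omega n \<and> (\<forall>i\<in>Omega n. w (- i) = - w i)}"

text \<open>
  A cycle \<open>c\<close> is represented by its underlying orbit, and its conjugate by \<open>uminus ` c\<close>;
  this is faithful since signed permutations commute with negation. Partitions are multisets.
  Both members of a pair \<open>{c, uminus ` c}\<close> have the same cardinality.
\<close>

definition cycles :: "nat \<Rightarrow> (int \<Rightarrow> int) \<Rightarrow> int set set" where
  "cycles n w = orbit w ` Omega n"

definition positive_lengths :: "nat \<Rightarrow> (int \<Rightarrow> int) \<Rightarrow> nat multiset" where
  "positive_lengths n w = image_mset (\<lambda>P. the_elem (card ` P))
     (mset_set {{c, uminus ` c} | c. c \<in> cycles n w \<and> c \<noteq> uminus ` c})"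

definition negative_lengths :: "nat \<Rightarrow> (int \<Rightarrow> int) \<Rightarrow> nat multiset" where
  "negative_lengths n w = image_mset (\<lambda>c. card c div 2)
     (mset_set {c \<in> cycles n w. c = uminus ` c})"

definition signed_cycle_type :: "nat \<Rightarrow> (int \<Rightarrow> int) \<Rightarrow> nat multiset \<times> nat multiset" where
  "signed_cycle_type n w = (positive_lengths n w, negative_lengths n w)"

definition bipartition_of :: "signed_composition \<Rightarrow> nat multiset \<times> nat multiset" where
  "bipartition_of \<gamma> =
     (mset (map fst (filter (\<lambda>p. snd p = Plus) \<gamma>)), mset (map fst (filter (\<lambda>p. snd p = Minus) \<gamma>)))"

definition trace_mat :: "complex mat \<Rightarrow> complex" where
  "trace_mat A = (\<Sum>i<dim_row A. A $$ (i, i))"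

definition is_representation :: "nat \<Rightarrow> nat \<Rightarrow> ((int \<Rightarrow> int) \<Rightarrow> complex mat) \<Rightarrow> bool" where
  "is_representation n d \<rho> \<longleftrightarrow>
     (\<forall>w\<in>signed_perms n. \<rho> w \<in> carrier_mat d d) \<and> \<rho> id = 1\<^sub>m d \<and>
     (\<forall>v\<in>signed_perms n. \<forall>w\<in>signed_perms n. \<rho> (v \<circ> w) = \<rho> v * \<rho> w)"

definition is_character :: "nat \<Rightarrow> ((int \<Rightarrow> int) \<Rightarrow> complex) \<Rightarrow> bool" where
  "is_character n \<chi> \<longleftrightarrow>
     (\<exists>d \<rho>. is_representation n d \<rho> \<and> (\<forall>w\<in>signed_perms n. \<chi> w = trace_mat (\<rho> w)))"

definition value_at :: "nat \<Rightarrow> ((int \<Rightarrow> int) \<Rightarrow> complex) \<Rightarrow> signed_composition \<Rightarrow> complex" where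
  "value_at n \<chi> \<gamma> =
     \<chi> (SOME w. w \<in> signed_perms n \<and> signed_cycle_type n w = bipartition_of \<gamma>)"

definition fine_set ::
    "nat \<Rightarrow> ((int \<Rightarrow> int) \<Rightarrow> complex) \<Rightarrow> 'b set \<Rightarrow> ('b \<Rightarrow> signed_set) \<Rightarrow> bool" where
  "fine_set n \<chi> B sDes \<longleftrightarrow>
     (\<forall>\<gamma>\<in>signed_compositions n. value_at n \<chi> \<gamma> = (\<Sum>b\<in>B. of_int (wt \<gamma> (sDes b))))"


section \<open>The Frobenius characteristic\<close>

definition power_sum :: "sign \<Rightarrow> nat \<Rightarrow> (var, complex) mps" where
  "power_sum e k =
     (let px = monomial_sum {1..} (\<lambda>i. replicate_mset k (X i));
          py = monomial_sum {1..} (\<lambda>i. replicate_mset k (Y i))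
      in case e of Plus \<Rightarrow> px + py | Minus \<Rightarrow> px - py)"

definition power_sum_part :: "sign \<Rightarrow> nat multiset \<Rightarrow> (var, complex) mps" where
  "power_sum_part e \<mu> = (\<Prod>k\<in>#\<mu>. power_sum e k)"

definition ch :: "nat \<Rightarrow> ((int \<Rightarrow> int) \<Rightarrow> complex) \<Rightarrow> (var, complex) mps" where
  "ch n \<chi> = mps_const (1 / (2 ^ n * fact n)) *
     (\<Sum>w\<in>signed_perms n. case signed_cycle_type n w of (\<alpha>, \<beta>) \<Rightarrow>
        mps_const (\<chi> w) * power_sum_part Plus \<alpha> * power_sum_part Minus \<beta>)"

end

theory Submission
  imports Defs
begin

text \<open>
  Order the variables as \<open>Y 1 < X 1 < Y 2 < X 2 < \<dots>\<close>. A monomial of degree \<open>n\<close> then has a sorted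
  word, and the multiplicities and signs of its variables form a signed composition \<open>\<tau>\<close>. The
  coefficients of \<open>F n \<sigma>\<close> and of products of power sums depend on \<open>\<tau>\<close> only, so an equation between
  such series is an equation between functions of \<open>\<tau>\<close>.

  Each signed composition \<open>\<gamma>\<close> gives a linear functional on functions of \<open>\<tau>\<close>: it is multiplicative over
  the blocks of \<open>\<gamma>\<close>, and on a block of size \<open>k\<close> it sums \<open>(- 1) ^ (length c - 1) * last c\<close> over the
  compositions \<open>c\<close> of \<open>k\<close>, the coefficients of the power sum in the complete homogeneous basis. These
  functionals separate points, they send \<open>F n \<sigma>\<close> to \<open>wt \<gamma> \<sigma>\<close>, and they send the product of power
  sums attached to \<open>w\<close> to the number of ways of writing \<open>w\<close> in cycle notation with cycles of types
  \<open>\<gamma>\<close>. The group acts simply transitively on the signed permutations so written, hence the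
  functional of \<open>\<gamma>\<close> sends \<open>ch n \<chi>\<close> to \<open>\<chi>(\<gamma>)\<close>. Uniqueness holds because the series \<open>F n \<sigma>\<close> are
  unitriangular in the monomial coefficients.
\<close>

section \<open>Functionals on signed compositions\<close>

text \<open>The recursion behind the functionals is Newton's identity, \<open>k h_k\<close> equals
  the sum of \<open>h_t p_(k-t)\<close> over \<open>t < k\<close>, solved for \<open>p_k\<close>.
  Taking the coefficient of a symmetric function at a monomial is pairing with a product of complete
  homogeneous functions, so on series symmetric in the x and in the y the functional of \<gamma> is
  the scalar product with the power sums of \<gamma>. The functionals therefore keep the order of
  the parts: they pair with products of noncommutative power sums and make sense for every function
  of \<tau>. The price is that they depend on the order of the parts of \<gamma>. The gain is that
  there are as many functionals as patterns \<tau>, so that they can separate points without any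
  assumption of symmetry; the quantifier over all signed compositions in \<open>fine_set\<close>
  supplies exactly these functionals.\<close>

definition sign_pairing :: "sign \<Rightarrow> sign \<Rightarrow> complex" where
  "sign_pairing e s = (if e = Minus \<and> s = Minus then - 1 else 1)"

lemma UNIV_sign: "(UNIV :: sign set) = {Plus, Minus}"
  using sign.exhaust by auto

lemma finite_UNIV_sign [simp]: "finite (UNIV :: sign set)"
  by (simp add: UNIV_sign)

lemma sum_UNIV_sign: "(\<Sum>s\<in>UNIV. f s) = f Plus + f Minus"
  by (simp add: UNIV_sign)

text \<open>\<open>sign_pairing\<close> is the character table of the group of order two: rows are
  the signs of power sums or of parts of \<gamma>, columns the signs of variables. Row orthogonality
  makes a part of \<gamma> see only the power sums of its own sign.\<close>

lemma sign_pairing_orthogonal: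
  "(\<Sum>s\<in>UNIV. sign_pairing e s * sign_pairing e' s) = (if e = e' then 2 else 0)"
  unfolding sum_UNIV_sign by (cases e; cases e') (simp_all add: sign_pairing_def)

lemma Cons_in_signed_compositions:
  "(k, e) # \<gamma> \<in> signed_compositions n \<longleftrightarrow>
     0 < k \<and> k \<le> n \<and> \<gamma> \<in> signed_compositions (n - k)"
  by (auto simp: signed_compositions_def)

lemma append_in_signed_compositions:
  "\<gamma> \<in> signed_compositions m \<Longrightarrow> \<delta> \<in> signed_compositions n \<Longrightarrow> \<gamma> @ \<delta> \<in> signed_compositions (m + n)"
  by (auto simp: signed_compositions_def)

lemma Nil_in_signed_compositions: "[] \<in> signed_compositions n \<longleftrightarrow> n = 0"
  by (auto simp: signed_compositions_def)

lemma signed_compositions_0: "signed_compositions 0 = {[]}"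
proof -
  have "\<gamma> = []" if "\<gamma> \<in> signed_compositions 0" for \<gamma>
    using that by (cases \<gamma>) (auto simp: signed_compositions_def)
  then show ?thesis
    by (auto simp: Nil_in_signed_compositions)
qed

text \<open>
  The sum of \<open>(- 1) ^ (length c - 1) * last c * g c\<close> over all compositions \<open>c\<close> of \<open>k\<close>, every part
  carrying the sign \<open>s\<close>.
\<close>

function block_functional :: "nat \<Rightarrow> sign \<Rightarrow> (signed_composition \<Rightarrow> complex) \<Rightarrow> complex" where
  "block_functional k s g =
     of_nat k * g [(k, s)] - (\<Sum>t\<in>{1..<k}. block_functional (k - t) s (\<lambda>c. g ((t, s) # c)))"
  by auto
termination
  by (relation "measure (\<lambda>(k, s, g). k)") auto

declare block_functional.simps [simp del]

lemma block_functional_sum: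
  "block_functional k s (\<lambda>c. \<Sum>i\<in>I. a i * g i c) = (\<Sum>i\<in>I. a i * block_functional k s (g i))"
proof (induction k arbitrary: g rule: less_induct)
  case (less k)
  have "(\<Sum>t\<in>{1..<k}. block_functional (k - t) s (\<lambda>c. \<Sum>i\<in>I. a i * g i ((t, s) # c))) =
      (\<Sum>t\<in>{1..<k}. \<Sum>i\<in>I. a i * block_functional (k - t) s (\<lambda>c. g i ((t, s) # c)))"
    by (rule sum.cong) (auto intro!: less)
  also have "\<dots> = (\<Sum>i\<in>I. a i * (\<Sum>t\<in>{1..<k}. block_functional (k - t) s (\<lambda>c. g i ((t, s) # c))))"
    by (subst sum.swap) (simp add: sum_distrib_left)
  finally show ?case
    by (simp add: block_functional.simps[of k] sum_distrib_left right_diff_distrib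
        sum_subtractf mult.left_commute)
qed

lemma block_functional_scale:
  "block_functional k s (\<lambda>c. a * g c) = a * block_functional k s g"
  using block_functional_sum[of k s "\<lambda>_::unit. a" "\<lambda>_. g" UNIV] by simp

lemma block_functional_cong:
  assumes "0 < k"
    and "\<And>c. c \<in> signed_compositions k \<Longrightarrow> g c = g' c"
  shows "block_functional k s g = block_functional k s g'"
  using assms
proof (induction k arbitrary: g g' rule: less_induct)
  case (less k)
  have "(\<Sum>t\<in>{1..<k}. block_functional (k - t) s (\<lambda>c. g ((t, s) # c))) =
      (\<Sum>t\<in>{1..<k}. block_functional (k - t) s (\<lambda>c. g' ((t, s) # c)))"
    by (rule sum.cong) (auto intro!: less simp: Cons_in_signed_compositions)
  moreover have "g [(k, s)] = g' [(k, s)]"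
    using less.prems by (simp add: Cons_in_signed_compositions Nil_in_signed_compositions)
  ultimately show ?case
    by (simp add: block_functional.simps[of k])
qed

lemma block_functional_eq_0:
  assumes "0 < k" and "\<And>c. c \<in> signed_compositions k \<Longrightarrow> g c = 0"
  shows "block_functional k s g = 0"
proof -
  have "block_functional k s g = block_functional k s (\<lambda>c. 0 * g c)"
    using assms by (intro block_functional_cong) auto
  also have "\<dots> = 0 * block_functional k s g"
    by (rule block_functional_scale)
  finally show ?thesis by simp
qed

fun weight_functional :: "signed_composition \<Rightarrow> (signed_composition \<Rightarrow> complex) \<Rightarrow> complex" where
  "weight_functional [] g = g []"
| "weight_functional ((k, e) # \<gamma>) g =
     (\<Sum>s\<in>UNIV. sign_pairing e s * block_functional k s (\<lambda>c. weight_functional \<gamma> (\<lambda>\<tau>. g (c @ \<tau>))))"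

lemma weight_functional_sum:
  "weight_functional \<gamma> (\<lambda>\<tau>. \<Sum>i\<in>I. a i * g i \<tau>) = (\<Sum>i\<in>I. a i * weight_functional \<gamma> (g i))"
proof (induction \<gamma> arbitrary: g)
  case Nil
  then show ?case by simp
next
  case (Cons p \<gamma>)
  obtain k e where p: "p = (k, e)" by force
  have "weight_functional (p # \<gamma>) (\<lambda>\<tau>. \<Sum>i\<in>I. a i * g i \<tau>) =
      (\<Sum>s\<in>UNIV. \<Sum>i\<in>I. sign_pairing e s *
         (a i * block_functional k s (\<lambda>c. weight_functional \<gamma> (\<lambda>\<tau>. g i (c @ \<tau>)))))"
    by (simp add: p Cons.IH block_functional_sum sum_distrib_left)
  also have "\<dots> = (\<Sum>i\<in>I. a i * weight_functional (p # \<gamma>) (g i))"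
    by (subst sum.swap) (simp add: p sum_distrib_left mult.left_commute)
  finally show ?case .
qed

lemma weight_functional_scale:
  "weight_functional \<gamma> (\<lambda>\<tau>. a * g \<tau>) = a * weight_functional \<gamma> g"
  using weight_functional_sum[of \<gamma> "\<lambda>_::unit. a" "\<lambda>_. g" UNIV] by simp

lemma weight_functional_sum1:
  "weight_functional \<gamma> (\<lambda>\<tau>. \<Sum>i\<in>I. g i \<tau>) = (\<Sum>i\<in>I. weight_functional \<gamma> (g i))"
  using weight_functional_sum[of \<gamma> "\<lambda>_. 1" g I] by simp

lemma weight_functional_diff:
  "weight_functional \<gamma> (\<lambda>\<tau>. f \<tau> - g \<tau>) = weight_functional \<gamma> f - weight_functional \<gamma> g"
  using weight_functional_sum[of \<gamma> "\<lambda>b. if b then 1 else - 1" "\<lambda>b. if b then f else g" UNIV]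
  by (simp add: UNIV_bool)

lemma weight_functional_cong:
  assumes "\<gamma> \<in> signed_compositions n"
    and "\<And>\<tau>. \<tau> \<in> signed_compositions n \<Longrightarrow> g \<tau> = g' \<tau>"
  shows "weight_functional \<gamma> g = weight_functional \<gamma> g'"
  using assms
proof (induction \<gamma> arbitrary: n g g')
  case Nil
  then show ?case by (simp add: Nil_in_signed_compositions signed_compositions_0)
next
  case (Cons p \<gamma>)
  obtain k e where p: "p = (k, e)" by force
  with Cons.prems have k: "0 < k" "k \<le> n" and \<gamma>: "\<gamma> \<in> signed_compositions (n - k)"
    by (auto simp: Cons_in_signed_compositions)
  have "weight_functional \<gamma> (\<lambda>\<tau>. g (c @ \<tau>)) = weight_functional \<gamma> (\<lambda>\<tau>. g' (c @ \<tau>))"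
    if "c \<in> signed_compositions k" for c
  proof (rule Cons.IH[OF \<gamma>])
    fix \<tau> assume "\<tau> \<in> signed_compositions (n - k)"
    from append_in_signed_compositions[OF that this] k
    show "g (c @ \<tau>) = g' (c @ \<tau>)" by (intro Cons.prems(2)) simp
  qed
  then have "block_functional k s (\<lambda>c. weight_functional \<gamma> (\<lambda>\<tau>. g (c @ \<tau>))) =
      block_functional k s (\<lambda>c. weight_functional \<gamma> (\<lambda>\<tau>. g' (c @ \<tau>)))" for s
    using k(1) by (intro block_functional_cong) auto
  then show ?case by (simp add: p)
qed

text \<open>Fubini for two finite signed sums. It moves the functional of the first block inside
  that of the other blocks, so that a vanishing result for smaller size applies to the inner
  function.\<close>

lemma block_functional_weight_functional_swap:
  "block_functional k s (\<lambda>c. weight_functional \<gamma> (\<lambda>\<tau>. f c \<tau>)) =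
   weight_functional \<gamma> (\<lambda>\<tau>. block_functional k s (\<lambda>c. f c \<tau>))"
proof (induction k arbitrary: f rule: less_induct)
  case (less k)
  have "(\<Sum>t\<in>{1..<k}. block_functional (k - t) s (\<lambda>c. weight_functional \<gamma> (f ((t, s) # c)))) =
      weight_functional \<gamma> (\<lambda>\<tau>. \<Sum>t\<in>{1..<k}. block_functional (k - t) s (\<lambda>c. f ((t, s) # c) \<tau>))"
    unfolding weight_functional_sum1 by (rule sum.cong) (auto intro!: less)
  then show ?case
    by (simp add: block_functional.simps[of k] weight_functional_diff weight_functional_scale)
qed

text \<open>
  Each block pairs its two signs by an invertible matrix, after which the functionals are triangular
  with respect to refinement.
\<close>

lemma weight_functional_separates:
  assumes "\<And>\<gamma>. \<gamma> \<in> signed_compositions n \<Longrightarrow> weight_functional \<gamma> g = 0"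
    and "\<tau> \<in> signed_compositions n"
  shows "g \<tau> = 0"
  using assms
proof (induction n arbitrary: g \<tau> rule: less_induct)
  case (less n)
  have block: "block_functional k s (\<lambda>c. g (c @ \<tau>)) = 0"
    if k: "0 < k" "k \<le> n" and \<tau>: "\<tau> \<in> signed_compositions (n - k)" for k s \<tau>
  proof -
    \<comment> \<open>As a function of the tail \<tau> alone, this sum is annihilated by all
      functionals of size \<open>n - k\<close>, so the induction hypothesis applies to it.\<close>
    have sum0: "(\<Sum>s\<in>UNIV. sign_pairing e s * block_functional k s (\<lambda>c. g (c @ \<tau>))) = 0" for e
    proof (rule less.IH[OF _ _ \<tau>])
      fix \<gamma> assume "\<gamma> \<in> signed_compositions (n - k)"
      then have "weight_functional ((k, e) # \<gamma>) g = 0"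
        using k by (intro less.prems) (simp add: Cons_in_signed_compositions)
      then show "weight_functional \<gamma>
          (\<lambda>\<tau>. \<Sum>s\<in>UNIV. sign_pairing e s * block_functional k s (\<lambda>c. g (c @ \<tau>))) = 0"
        by (simp add: weight_functional_sum block_functional_weight_functional_swap)
    qed (use k in auto)
    show ?thesis
      using sum0[of Plus] sum0[of Minus]
      by (cases s) (simp_all add: sum_UNIV_sign sign_pairing_def)
  qed
  \<comment> \<open>Triangularity: apart from \<open>t * g ((t, s) # \<tau>)\<close>, every term of
    the block functional of size \<open>t\<close> has a first part \<open>u < t\<close> and vanishes
    by induction on \<open>t\<close>.\<close>
  have first: "g ((t, s) # \<tau>) = 0" if "0 < t" "t \<le> n" "\<tau> \<in> signed_compositions (n - t)" for t s \<tau>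
    using that
  proof (induction t arbitrary: \<tau> rule: less_induct)
    case (less t)
    have "block_functional (t - u) s (\<lambda>c. g ((u, s) # c @ \<tau>)) = 0" if u: "u \<in> {1..<t}" for u
    proof (rule block_functional_eq_0)
      fix c assume "c \<in> signed_compositions (t - u)"
      from append_in_signed_compositions[OF this less.prems(3)]
      show "g ((u, s) # c @ \<tau>) = 0"
        using u less.prems by (intro less.IH) auto
    qed (use u in auto)
    with block[OF less.prems, of s] have "of_nat t * g ((t, s) # \<tau>) = 0"
      by (simp add: block_functional.simps[of t])
    then show ?case using less.prems by simp
  qed
  show ?case
  proof (cases \<tau>)
    case Nil
    with less.prems(2) have "n = 0" by (simp add: Nil_in_signed_compositions)
    with less.prems(1)[of "[]"] Nil show ?thesis by (simp add: Nil_in_signed_compositions)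
  next
    case (Cons p \<tau>')
    with less.prems(2) first[of "fst p" \<tau>' "snd p"] show ?thesis
      by (cases p) (auto simp: Cons_in_signed_compositions)
  qed
qed

section \<open>Weights of signed sets\<close>

text \<open>This is the coefficient of the series of the signed set at a monomial whose sorted word
  has runs \<tau>: each run must carry the right sign, and no element of \<open>S\<close> may lie
  strictly inside a run, since the word must rise there. The first \<open>a\<close> positions have
  been read already; the end \<open>a + t\<close> of a run is exempt.\<close>

fun word_indicator ::
    "nat set \<Rightarrow> (nat \<Rightarrow> sign) \<Rightarrow> nat \<Rightarrow> signed_composition \<Rightarrow> complex" where
  "word_indicator S \<epsilon> a [] = 1"
| "word_indicator S \<epsilon> a ((t, s) # \<tau>) =
     (if (\<forall>j\<in>{a + 1..a + t}. \<epsilon> j = s) \<and> S \<inter> {a + 1..<a + t} = {}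
      then word_indicator S \<epsilon> (a + t) \<tau> else 0)"

lemma word_indicator_append:
  "word_indicator S \<epsilon> a (c @ \<tau>) =
     word_indicator S \<epsilon> a c * word_indicator S \<epsilon> (a + sum_list (map fst c)) \<tau>"
  by (induction c arbitrary: a) (auto simp: add.assoc)

text \<open>The factor of \<open>wt\<close> that belongs to the block of size \<open>k\<close> after
  position \<open>a\<close>, for the constant sign \<open>s\<close>; the signs due to barred parts
  are left to \<open>sign_pairing\<close>.\<close>

definition block_weight :: "nat set \<Rightarrow> (nat \<Rightarrow> sign) \<Rightarrow> nat \<Rightarrow> nat \<Rightarrow> sign \<Rightarrow> complex" where
  "block_weight S \<epsilon> a k s =
     (if (\<forall>j\<in>{a + 1..a + k}. \<epsilon> j = s) \<and> initial_segment (S \<inter> {a + 1..<a + k}) {a + 1..<a + k}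
      then (- 1) ^ card (S \<inter> {a + 1..<a + k}) else 0)"

text \<open>Induction on \<open>k\<close> through the first position \<open>a + 1\<close> of the
  block. If it lies in \<open>S\<close>, only the first part \<open>t = 1\<close> survives and the
  shorter block enters with a minus sign: the initial segment has grown by one element. If it does
  not lie in \<open>S\<close>, an initial segment must be empty, and everything else
  cancels.\<close>

lemma block_functional_word_indicator:
  assumes "0 < k"
  shows "block_functional k s (word_indicator S \<epsilon> a) = block_weight S \<epsilon> a k s"
  using assms
proof (induction k arbitrary: a rule: less_induct)
  case (less k)
  define N :: "nat \<Rightarrow> nat \<Rightarrow> complex" where
    "N = (\<lambda>a t. if (\<forall>j\<in>{a + 1..a + t}. \<epsilon> j = s) \<and> S \<inter> {a + 1..<a + t} = {} then 1 else 0)"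
  define R where "R = (\<lambda>k a. block_functional k s (word_indicator S \<epsilon> a))"
  have cons: "word_indicator S \<epsilon> a ((t, s) # c) = N a t * word_indicator S \<epsilon> (a + t) c" for a t c
    by (auto simp: N_def)
  have R: "R k a = of_nat k * N a k - (\<Sum>t\<in>{1..<k}. N a t * R (k - t) (a + t))" for k a
    unfolding R_def block_functional.simps[of k]
    by (simp only: cons block_functional_scale word_indicator.simps(1) mult_1_right)
  consider (one) "k = 1" | (more) k' where "k = Suc k'" "0 < k'"
    using less.prems by (cases k) auto
  then show ?case
  proof cases
    case one
    then show ?thesis
      using R[of 1 a] by (auto simp: R_def N_def block_weight_def initial_segment_def)
  next
    case more
    have IH: "R k' (a + 1) = block_weight S \<epsilon> (a + 1) k' s"
      using more unfolding R_def by (intro less) auto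
    have interval: "{a + 1..a + k} = insert (a + 1) {a + 1 + 1..a + 1 + k'}"
      "{a + 1..<a + k} = insert (a + 1) {a + 1 + 1..<a + 1 + k'}"
      using more by auto
    have split: "(\<Sum>t\<in>{1..<k}. N a t * R (k - t) (a + t)) =
        N a 1 * R k' (a + 1) + (\<Sum>t\<in>{1..<k'}. N a (Suc t) * R (k' - t) (a + Suc t))"
    proof -
      have "{1..<k} = insert 1 (Suc ` {1..<k'})"
        using more by (auto simp: image_Suc_atLeastLessThan)
      then have "(\<Sum>t\<in>{1..<k}. N a t * R (k - t) (a + t)) =
          N a 1 * R (k - 1) (a + 1) + (\<Sum>t\<in>Suc ` {1..<k'}. N a t * R (k - t) (a + t))"
        by (simp only: sum.insert finite_imageI finite_atLeastLessThan) simp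
      then show ?thesis using more by (subst (asm) sum.reindex) auto
    qed
    show ?thesis
    proof (cases "\<epsilon> (a + 1) = s")
      case False
      then have "N a t = 0" if "1 \<le> t" for t using that by (auto simp: N_def)
      then have "R k a = 0" using more by (subst R) auto
      moreover have "block_weight S \<epsilon> a k s = 0"
        using False more by (auto simp: block_weight_def)
      ultimately show ?thesis by (simp add: R_def)
    next
      case sgn: True
      have N1: "N a 1 = 1" using sgn by (auto simp: N_def)
      show ?thesis
      proof (cases "a + 1 \<in> S")
        case True
        have N0: "N a (Suc t) = 0" if "0 < t" for t
          using that True by (auto simp: N_def)
        have "R k a = - R k' (a + 1)"
          using more N0 N1 by (subst R, subst split) simp
        moreover have "block_weight S \<epsilon> a k s = - block_weight S \<epsilon> (a + 1) k' s"
        proof -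
          have eq: "S \<inter> {a + 1..<a + k} = insert (a + 1) (S \<inter> {a + 1 + 1..<a + 1 + k'})"
            unfolding interval using True by auto
          have "initial_segment (S \<inter> {a + 1..<a + k}) {a + 1..<a + k} \<longleftrightarrow>
              initial_segment (S \<inter> {a + 1 + 1..<a + 1 + k'}) {a + 1 + 1..<a + 1 + k'}"
            using True unfolding initial_segment_def interval(2) by auto
          moreover have "card (S \<inter> {a + 1..<a + k}) = Suc (card (S \<inter> {a + 1 + 1..<a + 1 + k'}))"
            unfolding eq by (subst card_insert_disjoint) auto
          moreover have "(\<forall>j\<in>{a + 1..a + k}. \<epsilon> j = s) \<longleftrightarrow> (\<forall>j\<in>{a + 1 + 1..a + 1 + k'}. \<epsilon> j = s)"
            unfolding interval(1) using sgn by simp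
          ultimately show ?thesis unfolding block_weight_def by simp
        qed
        ultimately show ?thesis using IH by (simp add: R_def)
      next
        case False
        have Ns: "N a (Suc t) = N (a + 1) t" if "0 < t" for t
        proof -
          have "{a + 1..a + Suc t} = insert (a + 1) {a + 1 + 1..a + 1 + t}"
            "{a + 1..<a + Suc t} = insert (a + 1) {a + 1 + 1..<a + 1 + t}"
            using that by auto
          then show ?thesis using False sgn by (simp add: N_def)
        qed
        have "R k a = of_nat k * N (a + 1) k' -
            (R k' (a + 1) + (\<Sum>t\<in>{1..<k'}. N (a + 1) t * R (k' - t) (a + 1 + t)))"
          using more Ns N1 by (subst R, subst split) simp
        \<comment> \<open>Unfolding \<open>R k' (a + 1)\<close> by its own recursion cancels the sum
          and \<open>k'\<close> of the \<open>k\<close> copies of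
          \<open>N (a + 1) k'\<close>.\<close>
        also have "\<dots> = N (a + 1) k'"
          using R[of k' "a + 1"] more by (simp add: algebra_simps)
        also have "\<dots> = block_weight S \<epsilon> a k s"
        proof -
          have "initial_segment (S \<inter> {a + 1..<a + k}) {a + 1..<a + k} \<longleftrightarrow>
              S \<inter> {a + 1 + 1..<a + 1 + k'} = {}"
            using False unfolding initial_segment_def interval(2) by auto
          moreover have "S \<inter> {a + 1..<a + k} = S \<inter> {a + 1 + 1..<a + 1 + k'}"
            unfolding interval using False by simp
          ultimately show ?thesis
            unfolding block_weight_def N_def interval(1) using sgn by auto
        qed
        finally show ?thesis by (simp add: R_def)
      qed
    qed
  qed
qed

text \<open>The indicator is multiplicative under concatenation, and the offset of the tail is
  \<open>a + k\<close> for every composition of \<open>k\<close>; hence the functional factors over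
  the blocks.\<close>

lemma weight_functional_word_indicator:
  assumes "\<forall>p\<in>set \<gamma>. 0 < fst p"
  shows "weight_functional \<gamma> (word_indicator S \<epsilon> a) =
    (\<Prod>i<length \<gamma>. \<Sum>s\<in>UNIV. sign_pairing (snd (\<gamma> ! i)) s *
       block_weight S \<epsilon> (a + partial_sum \<gamma> i) (fst (\<gamma> ! i)) s)"
  using assms
proof (induction \<gamma> arbitrary: a)
  case Nil
  then show ?case by simp
next
  case (Cons p \<gamma>)
  obtain k e where p: "p = (k, e)" by force
  with Cons.prems have k: "0 < k" and pos: "\<forall>p\<in>set \<gamma>. 0 < fst p" by auto
  have "block_functional k s (\<lambda>c. weight_functional \<gamma> (\<lambda>\<tau>. word_indicator S \<epsilon> a (c @ \<tau>))) =
      block_functional k s (\<lambda>c. weight_functional \<gamma> (word_indicator S \<epsilon> (a + k)) * word_indicator S \<epsilon> a c)" for s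
    using k
    by (intro block_functional_cong)
      (auto simp: word_indicator_append signed_compositions_def weight_functional_scale)
  then have *: "block_functional k s (\<lambda>c. weight_functional \<gamma> (\<lambda>\<tau>. word_indicator S \<epsilon> a (c @ \<tau>))) =
      weight_functional \<gamma> (word_indicator S \<epsilon> (a + k)) * block_weight S \<epsilon> a k s" for s
    by (simp only: block_functional_scale block_functional_word_indicator[OF k])
  show ?case
    unfolding p weight_functional.simps *
    by (simp add: Cons.IH[OF pos] prod.lessThan_Suc_shift partial_sum_def add.assoc
        sum_distrib_right mult_ac del: prod.lessThan_Suc)
qed

lemma partial_sum_Suc:
  "i < length \<gamma> \<Longrightarrow> partial_sum \<gamma> (Suc i) = partial_sum \<gamma> i + fst (\<gamma> ! i)"
  by (simp add: partial_sum_def take_Suc_conv_app_nth)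

lemma partial_sum_mono: "i \<le> j \<Longrightarrow> partial_sum \<gamma> i \<le> partial_sum \<gamma> j"
proof (rule lift_Suc_mono_le[of "partial_sum \<gamma>"])
  fix i show "partial_sum \<gamma> i \<le> partial_sum \<gamma> (Suc i)"
  proof (cases "i < length \<gamma>")
    case True
    then show ?thesis by (simp add: partial_sum_Suc)
  next
    case False
    then show ?thesis by (simp add: partial_sum_def)
  qed
qed

text \<open>An element that is not a partial sum is interior to exactly one block. This distributes
  the exponent \<open>card (S - partial_sums \<gamma>)\<close> of \<open>wt\<close> over the blocks,
  as the product formula requires.\<close>

lemma diff_partial_sums_eq_UN:
  assumes "\<gamma> \<in> signed_compositions n" and "S \<subseteq> {1..n}"
  shows "S - partial_sums \<gamma> =
    (\<Union>i<length \<gamma>. S \<inter> {partial_sum \<gamma> i + 1..<partial_sum \<gamma> (Suc i)})"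
proof (intro equalityI subsetI)
  fix x assume x: "x \<in> S - partial_sums \<gamma>"
  have find: "1 \<le> x \<Longrightarrow> x \<le> partial_sum \<gamma> m \<Longrightarrow>
      \<exists>i<m. x \<in> {partial_sum \<gamma> i + 1..partial_sum \<gamma> (Suc i)}" for m
  proof (induction m)
    case 0
    then show ?case by (simp add: partial_sum_def)
  next
    case (Suc m)
    then show ?case
      by (cases "x \<le> partial_sum \<gamma> m") (auto intro: less_SucI)
  qed
  have "partial_sum \<gamma> (length \<gamma>) = n"
    using assms(1) by (simp add: partial_sum_def signed_compositions_def)
  then have "1 \<le> x" "x \<le> partial_sum \<gamma> (length \<gamma>)"
    using x assms(2) by auto
  from find[OF this]
  obtain i where i: "i < length \<gamma>" "x \<in> {partial_sum \<gamma> i + 1..partial_sum \<gamma> (Suc i)}"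
    by blast
  moreover have "x \<noteq> partial_sum \<gamma> (Suc i)"
    using x i(1) by (auto simp: partial_sums_def)
  ultimately show "x \<in> (\<Union>i<length \<gamma>. S \<inter> {partial_sum \<gamma> i + 1..<partial_sum \<gamma> (Suc i)})"
    using x by auto
next
  fix x assume "x \<in> (\<Union>i<length \<gamma>. S \<inter> {partial_sum \<gamma> i + 1..<partial_sum \<gamma> (Suc i)})"
  then obtain i where i: "x \<in> S" "partial_sum \<gamma> i < x" "x < partial_sum \<gamma> (Suc i)"
    by (auto simp: Suc_le_eq)
  have "x \<noteq> partial_sum \<gamma> m" for m
    using partial_sum_mono[of m i \<gamma>] partial_sum_mono[of "Suc i" m \<gamma>] i
    by (cases "m \<le> i") auto
  with i show "x \<in> S - partial_sums \<gamma>"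
    by (auto simp: partial_sums_def)
qed

lemma card_diff_partial_sums:
  assumes "\<gamma> \<in> signed_compositions n" and "S \<subseteq> {1..n}"
  shows "card (S - partial_sums \<gamma>) =
    (\<Sum>i<length \<gamma>. card (S \<inter> {partial_sum \<gamma> i + 1..<partial_sum \<gamma> (Suc i)}))"
  unfolding diff_partial_sums_eq_UN[OF assms]
proof (rule card_UN_disjoint)
  show "\<forall>i\<in>{..<length \<gamma>}. \<forall>j\<in>{..<length \<gamma>}. i \<noteq> j \<longrightarrow>
      S \<inter> {partial_sum \<gamma> i + 1..<partial_sum \<gamma> (Suc i)} \<inter>
      (S \<inter> {partial_sum \<gamma> j + 1..<partial_sum \<gamma> (Suc j)}) = {}"
  proof (intro ballI impI)
    fix i j :: nat assume "i \<noteq> j"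
    then have "Suc i \<le> j \<or> Suc j \<le> i" by auto
    then have "partial_sum \<gamma> (Suc i) \<le> partial_sum \<gamma> j \<or> partial_sum \<gamma> (Suc j) \<le> partial_sum \<gamma> i"
      using partial_sum_mono by blast
    then show "S \<inter> {partial_sum \<gamma> i + 1..<partial_sum \<gamma> (Suc i)} \<inter>
      (S \<inter> {partial_sum \<gamma> j + 1..<partial_sum \<gamma> (Suc j)}) = {}" by auto
  qed
qed auto

lemma weight_functional_eq_wt:
  assumes \<gamma>: "\<gamma> \<in> signed_compositions n" and \<sigma>: "\<sigma> \<in> signed_sets n"
  shows "weight_functional \<gamma> (word_indicator (fst \<sigma>) (sign_vector \<sigma>) 0) = of_int (wt \<gamma> \<sigma>)"
proof -
  define S where "S = fst \<sigma>"
  define P where "P = (\<lambda>i. {partial_sum \<gamma> i + 1..<partial_sum \<gamma> (Suc i)})"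
  define U where "U = (\<lambda>i. initial_segment (S \<inter> P i) (P i))"
  define C where "C = (\<lambda>i e. \<forall>j\<in>block \<gamma> i. sign_vector \<sigma> j = e)"
  define Q where "Q = (\<lambda>i. C i Minus \<and> snd (\<gamma> ! i) = Minus)"
  have factor: "(\<Sum>s\<in>UNIV. sign_pairing (snd (\<gamma> ! i)) s *
        block_weight S (sign_vector \<sigma>) (0 + partial_sum \<gamma> i) (fst (\<gamma> ! i)) s) =
      (if U i \<and> (\<exists>e. C i e) then (- 1) ^ card (S \<inter> P i) * (if Q i then - 1 else 1) else 0)"
    if i: "i < length \<gamma>" for i
  proof -
    have pos: "0 < fst (\<gamma> ! i)"
      using \<gamma> i by (auto simp: signed_compositions_def)
    have ps: "partial_sum \<gamma> (Suc i) = partial_sum \<gamma> i + fst (\<gamma> ! i)"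
      using i by (rule partial_sum_Suc)
    have bw: "block_weight S (sign_vector \<sigma>) (0 + partial_sum \<gamma> i) (fst (\<gamma> ! i)) s =
        (if C i s \<and> U i then (- 1) ^ card (S \<inter> P i) else 0)" for s
      by (simp add: block_weight_def C_def U_def P_def ps block_def)
    \<comment> \<open>Parts are positive, so the block contains a position and at most one sign can
      be constant on it: at most one term of the sum over signs survives.\<close>
    have mem: "partial_sum \<gamma> i + 1 \<in> block \<gamma> i"
      using pos by (simp add: block_def ps)
    have excl: "\<not> (C i Plus \<and> C i Minus)"
      using mem by (auto simp: C_def)
    have ex: "(\<exists>e. C i e) \<longleftrightarrow> C i Plus \<or> C i Minus"
      by (metis (full_types) sign.exhaust)
    show ?thesis
      unfolding bw sum_UNIV_sign Q_def ex using excl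
      by (cases "C i Plus"; cases "C i Minus"; cases "U i"; cases "snd (\<gamma> ! i)")
        (simp_all add: sign_pairing_def)
  qed
  have cond: "(unimodal \<gamma> \<sigma> \<and> (\<forall>i<length \<gamma>. \<exists>e. \<forall>j\<in>block \<gamma> i. sign_vector \<sigma> j = e)) \<longleftrightarrow>
      (\<forall>i<length \<gamma>. U i \<and> (\<exists>e. C i e))"
    by (auto simp: unimodal_def U_def P_def C_def S_def Let_def)
  have "weight_functional \<gamma> (word_indicator S (sign_vector \<sigma>) 0) =
      (\<Prod>i<length \<gamma>. if U i \<and> (\<exists>e. C i e)
         then (- 1) ^ card (S \<inter> P i) * (if Q i then - 1 else 1) else 0)"
    using \<gamma> by (subst weight_functional_word_indicator)
      (auto simp: signed_compositions_def factor[unfolded add_0] intro!: prod.cong)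
  also have "\<dots> = (if \<forall>i<length \<gamma>. U i \<and> (\<exists>e. C i e)
      then (- 1) ^ (card (S - partial_sums \<gamma>) + card {i. i < length \<gamma> \<and> Q i}) else 0)"
  proof (cases "\<forall>i<length \<gamma>. U i \<and> (\<exists>e. C i e)")
    case True
    have "S \<subseteq> {1..n}" using \<sigma> by (auto simp: S_def signed_sets_def)
    then have "(- 1) ^ card (S - partial_sums \<gamma>) = (\<Prod>i<length \<gamma>. (- 1 :: complex) ^ card (S \<inter> P i))"
      by (simp add: card_diff_partial_sums[OF \<gamma>] P_def power_sum)
    moreover have "(- 1) ^ card {i. i < length \<gamma> \<and> Q i} = (\<Prod>i<length \<gamma>. if Q i then - 1 else (1 :: complex))"
    proof -
      have "{..<length \<gamma>} \<inter> {i. Q i} = {i. i < length \<gamma> \<and> Q i}" by auto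
      then show ?thesis by (simp add: prod.If_cases)
    qed
    ultimately show ?thesis
      using True by (simp add: power_add prod.distrib)
  next
    case False
    then have "(\<Prod>i<length \<gamma>. if U i \<and> (\<exists>e. C i e)
         then (- 1) ^ card (S \<inter> P i) * (if Q i then - 1 else 1) else (0 :: complex)) = 0"
      by (intro prod_zero) auto
    then show ?thesis unfolding if_not_P[OF False] .
  qed
  also have "\<dots> = of_int (wt \<gamma> \<sigma>)"
  proof -
    have "wt \<gamma> \<sigma> = (if \<forall>i<length \<gamma>. U i \<and> (\<exists>e. C i e)
        then (- 1) ^ (card (S - partial_sums \<gamma>) + card {i. i < length \<gamma> \<and> Q i}) else 0)"
      unfolding wt_def cond unfolding S_def Q_def C_def by (rule refl)
    then show ?thesis by (simp only: if_distrib[of of_int] of_int_power of_int_minus of_int_1 of_int_0)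
  qed
  finally show ?thesis by (simp add: S_def)
qed

section \<open>Products of power sums\<close>

text \<open>The coefficient of a product of power sums, one of length \<open>fst (ty d)\<close> and
  sign \<open>snd (ty d)\<close> for each \<open>d\<close> in \<open>D\<close>, at a monomial of
  pattern \<tau>. \<open>A\<close> is the set of factors that contribute a power of the first
  variable, so their lengths add up to its exponent.\<close>

fun coloring_sum ::
    "('d \<Rightarrow> nat \<times> sign) \<Rightarrow> signed_composition \<Rightarrow> 'd set \<Rightarrow> complex" where
  "coloring_sum ty [] D = (if D = {} then 1 else 0)"
| "coloring_sum ty ((t, s) # \<tau>) D =
     (\<Sum>A | A \<subseteq> D \<and> (\<Sum>d\<in>A. fst (ty d)) = t.
        (\<Prod>d\<in>A. sign_pairing (snd (ty d)) s) * coloring_sum ty \<tau> (D - A))"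

text \<open>Colorings by \<open>c @ \<tau>\<close> are sorted by the set of elements colored by
  parts of \<open>c\<close>. In the induction step \<open>A\<close> is the first color class and
  \<open>B\<close> the rest of that set.\<close>

lemma coloring_sum_append:
  assumes "finite D"
  shows "coloring_sum ty (c @ \<tau>) D =
    (\<Sum>A\<in>Pow D. coloring_sum ty c A * coloring_sum ty \<tau> (D - A))"
  using assms
proof (induction c arbitrary: D)
  case Nil
  have "(\<Sum>A\<in>Pow D. coloring_sum ty [] A * coloring_sum ty \<tau> (D - A)) =
      (\<Sum>A\<in>Pow D. if A = {} then coloring_sum ty \<tau> D else 0)"
    by (rule sum.cong) auto
  also have "\<dots> = coloring_sum ty \<tau> D"
    using Nil by simp
  finally show ?case by simp
next
  case (Cons p c)
  obtain t s where p: "p = (t, s)" by force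
  define \<eta> where "\<eta> = (\<lambda>A. \<Prod>d\<in>A. sign_pairing (snd (ty d)) s)"
  define T where "T = (\<lambda>A. (\<Sum>d\<in>A. fst (ty d)) = t)"
  have fin: "finite A" if "A \<subseteq> D" for A using that Cons.prems finite_subset by auto
  have "coloring_sum ty ((p # c) @ \<tau>) D =
      (\<Sum>A | A \<subseteq> D \<and> T A. \<Sum>B\<in>Pow (D - A).
         \<eta> A * (coloring_sum ty c B * coloring_sum ty \<tau> (D - A - B)))"
    using Cons.prems by (simp add: p \<eta>_def T_def Cons.IH sum_distrib_left)
  also have "\<dots> = (\<Sum>(A, B)\<in>(SIGMA A:{A. A \<subseteq> D \<and> T A}. Pow (D - A)).
         \<eta> A * (coloring_sum ty c B * coloring_sum ty \<tau> (D - A - B)))"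
    using Cons.prems by (intro sum.Sigma) auto
  also have "\<dots> = (\<Sum>(C, A)\<in>(SIGMA C:Pow D. {A. A \<subseteq> C \<and> T A}).
         \<eta> A * (coloring_sum ty c (C - A) * coloring_sum ty \<tau> (D - C)))"
  proof (rule sum.reindex_bij_witness[where i = "\<lambda>(C, A). (A, C - A)" and j = "\<lambda>(A, B). (A \<union> B, A)"])
    fix q assume "q \<in> (SIGMA A:{A. A \<subseteq> D \<and> T A}. Pow (D - A))"
    then obtain A B where q: "q = (A, B)" "A \<subseteq> D" "T A" "B \<subseteq> D - A" by auto
    then have "A \<union> B - A = B" "D - (A \<union> B) = D - A - B" by auto
    with q show "(case case q of (A, B) \<Rightarrow> (A \<union> B, A) of (C, A) \<Rightarrow> (A, C - A)) = q"
      "(case q of (A, B) \<Rightarrow> (A \<union> B, A)) \<in> (SIGMA C:Pow D. {A. A \<subseteq> C \<and> T A})"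
      "(case case q of (A, B) \<Rightarrow> (A \<union> B, A) of (C, A) \<Rightarrow>
          \<eta> A * (coloring_sum ty c (C - A) * coloring_sum ty \<tau> (D - C))) =
        (case q of (A, B) \<Rightarrow> \<eta> A * (coloring_sum ty c B * coloring_sum ty \<tau> (D - A - B)))"
      by auto
  qed auto
  also have "\<dots> = (\<Sum>C\<in>Pow D. \<Sum>A | A \<subseteq> C \<and> T A.
         \<eta> A * (coloring_sum ty c (C - A) * coloring_sum ty \<tau> (D - C)))"
    using Cons.prems fin by (intro sum.Sigma[symmetric]) auto
  also have "\<dots> = (\<Sum>C\<in>Pow D. coloring_sum ty (p # c) C * coloring_sum ty \<tau> (D - C))"
    by (simp add: p \<eta>_def T_def sum_distrib_right mult.assoc)
  finally show ?case .
qed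

lemma coloring_sum_single:
  assumes "finite D"
  shows "coloring_sum ty [(t, s)] D =
    (if (\<Sum>d\<in>D. fst (ty d)) = t then \<Prod>d\<in>D. sign_pairing (snd (ty d)) s else 0)"
proof -
  let ?I = "{A. A \<subseteq> D \<and> (\<Sum>d\<in>A. fst (ty d)) = t}"
  have "coloring_sum ty [(t, s)] D =
      (\<Sum>A\<in>?I. if A = D then \<Prod>d\<in>D. sign_pairing (snd (ty d)) s else 0)"
    by (simp, rule sum.cong) auto
  also have "\<dots> = (if D \<in> ?I then \<Prod>d\<in>D. sign_pairing (snd (ty d)) s else 0)"
    using assms by (subst sum.delta) auto
  finally show ?thesis by simp
qed

text \<open>
  A product of at least two power sums is annihilated: \<open>\<Sum>d\<in>D. len d\<close> from the composition with one
  part cancels against the compositions whose remaining parts form a single power sum.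
\<close>

lemma block_functional_coloring_sum:
  assumes "0 < k" and "finite D" and "\<forall>d\<in>D. 0 < fst (ty d)"
  shows "block_functional k s (\<lambda>c. coloring_sum ty c D) =
    (if \<exists>d. D = {d} \<and> fst (ty d) = k
     then of_nat k * (\<Prod>d\<in>D. sign_pairing (snd (ty d)) s) else 0)"
  using assms
proof (induction k arbitrary: D rule: less_induct)
  case (less k)
  define \<eta> where "\<eta> = (\<lambda>A. \<Prod>d\<in>A. sign_pairing (snd (ty d)) s)"
  define len where "len = (\<lambda>A. \<Sum>d\<in>A. fst (ty d))"
  have fin: "finite A" if "A \<subseteq> D" for A using that less.prems finite_subset by auto
  have split: "\<eta> A * \<eta> (D - A) = \<eta> D" "len A + len (D - A) = len D" if "A \<subseteq> D" for A
    using that less.prems(2)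
    by (auto simp: \<eta>_def len_def prod.subset_diff[of A D] sum.subset_diff[of A D] mult.commute add.commute)
  \<comment> \<open>The factors in \<open>A\<close> use up the first part \<open>t\<close>. By
    induction the remaining size \<open>k - t\<close> accepts only a single factor, so exactly one
    element of \<open>D\<close> lies outside \<open>A\<close>.\<close>
  have inner: "block_functional (k - t) s (\<lambda>c. coloring_sum ty ((t, s) # c) D) =
      (\<Sum>A | A \<subseteq> D \<and> len A = t.
        if card (D - A) = 1 \<and> len D = k then of_nat (len (D - A)) * \<eta> D else 0)"
    if t: "t \<in> {1..<k}" for t
  proof -
    have "block_functional (k - t) s (\<lambda>c. coloring_sum ty ((t, s) # c) D) =
        (\<Sum>A | A \<subseteq> D \<and> len A = t. \<eta> A * block_functional (k - t) s (\<lambda>c. coloring_sum ty c (D - A)))"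
      by (simp add: block_functional_sum \<eta>_def len_def)
    also have "\<dots> = (\<Sum>A | A \<subseteq> D \<and> len A = t.
        if card (D - A) = 1 \<and> len D = k then of_nat (len (D - A)) * \<eta> D else 0)"
    proof (rule sum.cong)
      fix A assume A: "A \<in> {A. A \<subseteq> D \<and> len A = t}"
      have "block_functional (k - t) s (\<lambda>c. coloring_sum ty c (D - A)) =
          (if \<exists>d. D - A = {d} \<and> fst (ty d) = k - t then of_nat (k - t) * \<eta> (D - A) else 0)"
        unfolding \<eta>_def using t less.prems by (intro less.IH) auto
      moreover have "(\<exists>d. D - A = {d} \<and> fst (ty d) = k - t) \<longleftrightarrow> card (D - A) = 1 \<and> len (D - A) = k - t"
        by (auto simp: len_def card_1_singleton_iff)
      moreover have "len (D - A) = k - t \<longleftrightarrow> len D = k"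
        using A split(2)[of A] t by auto
      ultimately show "\<eta> A * block_functional (k - t) s (\<lambda>c. coloring_sum ty c (D - A)) =
        (if card (D - A) = 1 \<and> len D = k then of_nat (len (D - A)) * \<eta> D else 0)"
        using A split(1)[of A] by (auto simp: mult.left_commute)
    qed simp
    finally show ?thesis .
  qed
  have "block_functional k s (\<lambda>c. coloring_sum ty c D) =
      of_nat k * coloring_sum ty [(k, s)] D -
      (\<Sum>t\<in>{1..<k}. \<Sum>A | A \<subseteq> D \<and> len A = t.
        if card (D - A) = 1 \<and> len D = k then of_nat (len (D - A)) * \<eta> D else 0)"
    unfolding block_functional.simps[of k] using inner by simp
  also have "coloring_sum ty [(k, s)] D = (if len D = k then \<eta> D else 0)"
    by (simp only: coloring_sum_single[OF less.prems(2)] len_def \<eta>_def)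
  also have "of_nat k * (if len D = k then \<eta> D else 0) - (\<Sum>t\<in>{1..<k}. \<Sum>A | A \<subseteq> D \<and> len A = t.
        if card (D - A) = 1 \<and> len D = k then of_nat (len (D - A)) * \<eta> D else 0) =
      (if \<exists>d. D = {d} \<and> fst (ty d) = k then of_nat k * \<eta> D else 0)"
  proof (cases "len D = k")
    case False
    then have no: "\<not> (\<exists>d. D = {d} \<and> fst (ty d) = k)" by (auto simp: len_def)
    show ?thesis unfolding if_not_P[OF no] using False by simp
  next
    case True
    have "(\<Sum>t\<in>{1..<k}. \<Sum>A | A \<subseteq> D \<and> len A = t.
          if card (D - A) = 1 \<and> len D = k then of_nat (len (D - A)) * \<eta> D else 0) =
        (\<Sum>t\<in>{1..<k}. \<Sum>A | A \<in> {A. A \<subseteq> D \<and> len A \<in> {1..<k}} \<and> len A = t.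
          if card (D - A) = 1 then of_nat (len (D - A)) * \<eta> D else 0)"
      using True by (intro sum.cong) auto
    also have "\<dots> = (\<Sum>A | A \<subseteq> D \<and> len A \<in> {1..<k}.
        if card (D - A) = 1 then of_nat (len (D - A)) * \<eta> D else 0)"
      using less.prems(2) by (intro sum.group) auto
    also have "\<dots> = (\<Sum>A | A \<subseteq> D \<and> len A \<in> {1..<k} \<and> card (D - A) = 1. of_nat (len (D - A)) * \<eta> D)"
      using less.prems(2) by (intro sum.mono_neutral_cong_right) auto
    \<comment> \<open>The sets \<open>A\<close> are indexed by the element that they omit;
      \<open>D \<noteq> {d}\<close> holds because \<open>A\<close> has positive length.\<close>
    also have "\<dots> = (\<Sum>d | d \<in> D \<and> D \<noteq> {d}. of_nat (fst (ty d)) * \<eta> D)"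
    proof (rule sum.reindex_bij_witness[where i = "\<lambda>d. D - {d}" and j = "\<lambda>A. the_elem (D - A)"])
      fix A assume "A \<in> {A. A \<subseteq> D \<and> len A \<in> {1..<k} \<and> card (D - A) = 1}"
      then obtain d where d: "D - A = {d}" "A \<subseteq> D" "1 \<le> len A"
        by (auto simp: card_1_singleton_iff)
      then have "A \<noteq> {}" by (auto simp: len_def)
      with d show "D - {the_elem (D - A)} = A"
        "the_elem (D - A) \<in> {d \<in> D. D \<noteq> {d}}"
        "of_nat (fst (ty (the_elem (D - A)))) * \<eta> D = of_nat (len (D - A)) * \<eta> D"
        by (auto simp: len_def)
    next
      fix d assume d: "d \<in> {d \<in> D. D \<noteq> {d}}"
      then have eq: "D - (D - {d}) = {d}" by auto
      then show "the_elem (D - (D - {d})) = d" by simp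
      from d obtain d' where "d' \<in> D - {d}" by auto
      then have "fst (ty d') \<le> len (D - {d})"
        unfolding len_def using less.prems(2) by (intro member_le_sum) auto
      then have "1 \<le> len (D - {d})"
        using \<open>d' \<in> D - {d}\<close> less.prems(3) by fastforce
      moreover have "len (D - {d}) < k"
        using split(2)[of "{d}"] d less.prems(3) True by (auto simp: len_def)
      ultimately show "D - {d} \<in> {A. A \<subseteq> D \<and> len A \<in> {1..<k} \<and> card (D - A) = 1}"
        using eq by auto
    qed
    also have "of_nat k * (if len D = k then \<eta> D else 0) - \<dots> =
        (if \<exists>d. D = {d} \<and> fst (ty d) = k then of_nat k * \<eta> D else 0)"
    proof (cases "\<exists>d. D = {d}")
      case single: True
      then obtain d where d: "D = {d}" by blast
      have empty: "{d \<in> D. D \<noteq> {d}} = {}" unfolding d by blast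
      have ex: "\<exists>d. D = {d} \<and> fst (ty d) = k" using d True by (simp add: len_def)
      show ?thesis unfolding empty if_P[OF ex] if_P[OF True] by simp
    next
      case False
      then have all: "{d \<in> D. D \<noteq> {d}} = D" by blast
      from False have no: "\<not> (\<exists>d. D = {d} \<and> fst (ty d) = k)" by blast
      have "(\<Sum>d\<in>D. of_nat (fst (ty d)) * \<eta> D) = of_nat k * \<eta> D"
        unfolding True[symmetric] by (simp add: len_def sum_distrib_right)
      then show ?thesis unfolding all if_not_P[OF no] if_P[OF True] by simp
    qed
    finally show ?thesis .
  qed
  finally show ?case by (simp only: \<eta>_def)
qed

text \<open>The block functional leaves only singletons \<open>{d}\<close> of length
  \<open>k\<close>, and the sum over signs leaves those of sign \<open>e\<close>. The factor
  \<open>k\<close> comes from the former and 2 from the orthogonality of signs; \<open>2 * k\<close>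
  is also the number of points of a signed orbit of length \<open>k\<close>, which later turns the
  iterated sum into a count.\<close>

lemma weight_functional_coloring_sum_Cons:
  assumes "0 < k" and "finite D" and "\<forall>d\<in>D. 0 < fst (ty d)"
  shows "weight_functional ((k, e) # \<gamma>) (\<lambda>\<tau>. coloring_sum ty \<tau> D) =
    (\<Sum>d | d \<in> D \<and> ty d = (k, e). 2 * of_nat k * weight_functional \<gamma> (\<lambda>\<tau>. coloring_sum ty \<tau> (D - {d})))"
proof -
  define W where "W = (\<lambda>A. weight_functional \<gamma> (\<lambda>\<tau>. coloring_sum ty \<tau> A))"
  have pull: "block_functional k s (\<lambda>c. weight_functional \<gamma> (\<lambda>\<tau>. coloring_sum ty (c @ \<tau>) D)) =
      (\<Sum>A\<in>Pow D. W (D - A) * block_functional k s (\<lambda>c. coloring_sum ty c A))" for s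
  proof -
    have "(\<lambda>c. weight_functional \<gamma> (\<lambda>\<tau>. coloring_sum ty (c @ \<tau>) D)) =
        (\<lambda>c. \<Sum>A\<in>Pow D. W (D - A) * coloring_sum ty c A)"
      by (simp add: coloring_sum_append[OF assms(2)] weight_functional_sum W_def mult.commute)
    then show ?thesis by (simp add: block_functional_sum)
  qed
  have "weight_functional ((k, e) # \<gamma>) (\<lambda>\<tau>. coloring_sum ty \<tau> D) =
      (\<Sum>s\<in>UNIV. \<Sum>A\<in>Pow D. W (D - A) * (sign_pairing e s * block_functional k s (\<lambda>c. coloring_sum ty c A)))"
    by (simp add: pull sum_distrib_left mult.left_commute)
  also have "\<dots> = (\<Sum>A\<in>Pow D. W (D - A) *
      (\<Sum>s\<in>UNIV. sign_pairing e s * block_functional k s (\<lambda>c. coloring_sum ty c A)))"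
    by (subst sum.swap) (simp add: sum_distrib_left)
  also have "\<dots> = (\<Sum>A\<in>Pow D. if \<exists>d. A = {d} \<and> ty d = (k, e) then 2 * of_nat k * W (D - A) else 0)"
  proof (rule sum.cong)
    fix A assume A: "A \<in> Pow D"
    have bf: "block_functional k s (\<lambda>c. coloring_sum ty c A) = (if \<exists>d. A = {d} \<and> fst (ty d) = k
        then of_nat k * (\<Prod>d\<in>A. sign_pairing (snd (ty d)) s) else 0)" for s
      using A assms finite_subset[of A D] by (intro block_functional_coloring_sum) auto
    show "W (D - A) * (\<Sum>s\<in>UNIV. sign_pairing e s * block_functional k s (\<lambda>c. coloring_sum ty c A)) =
        (if \<exists>d. A = {d} \<and> ty d = (k, e) then 2 * of_nat k * W (D - A) else 0)"
    proof (cases "\<exists>d. A = {d} \<and> fst (ty d) = k")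
      case True
      then obtain d where d: "A = {d}" "fst (ty d) = k" by blast
      have "(\<Sum>s\<in>UNIV. sign_pairing e s * block_functional k s (\<lambda>c. coloring_sum ty c A)) =
          of_nat k * (\<Sum>s\<in>UNIV. sign_pairing e s * sign_pairing (snd (ty d)) s)"
        unfolding bf sum_distrib_left using d by (intro sum.cong) auto
      also have "\<dots> = (if ty d = (k, e) then 2 * of_nat k else 0)"
        unfolding sign_pairing_orthogonal using d by (cases "ty d") auto
      finally show ?thesis using d by simp
    next
      case False
      then have "\<not> (\<exists>d. A = {d} \<and> ty d = (k, e))" by auto
      then show ?thesis by (simp only: bf if_not_P[OF False] if_not_P) simp
    qed
  qed simp
  also have "\<dots> = (\<Sum>A | A \<in> Pow D \<and> (\<exists>d. A = {d} \<and> ty d = (k, e)). 2 * of_nat k * W (D - A))"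
    using assms(2) by (intro sum.mono_neutral_cong_right) auto
  also have "\<dots> = (\<Sum>d | d \<in> D \<and> ty d = (k, e). 2 * of_nat k * W (D - {d}))"
    by (rule sum.reindex_bij_witness[where i = "\<lambda>d. {d}" and j = the_elem]) auto
  finally show ?thesis by (simp add: W_def)
qed

section \<open>Coefficients of power sum products at monomials\<close>

fun var_sign :: "var \<Rightarrow> sign" where
  "var_sign (X i) = Plus"
| "var_sign (Y i) = Minus"

fun var_index :: "var \<Rightarrow> nat" where
  "var_index (X i) = i"
| "var_index (Y i) = i"

lemma signed_var_var_sign [simp]: "signed_var (var_sign v) (var_index v) = v"
  by (cases v) (simp_all add: signed_var_def)

lemma var_sign_signed_var [simp]: "var_sign (signed_var s i) = s"
  and var_index_signed_var [simp]: "var_index (signed_var s i) = i"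
  by (cases s; simp add: signed_var_def)+

lemma signed_var_eq_iff [simp]: "signed_var s i = signed_var s' i' \<longleftrightarrow> s = s' \<and> i = i'"
  by (metis var_index_signed_var var_sign_signed_var)

lemma replicate_mset_eq_iff_pos:
  "0 < k \<Longrightarrow> replicate_mset k v = replicate_mset k w \<longleftrightarrow> v = w"
  by (auto simp: replicate_mset_eq_iff)

lemma coeff_monomial_sum_replicate:
  assumes "0 < k" and "inj f"
  shows "mps_coeff (monomial_sum I (\<lambda>i. replicate_mset k (f i)) :: ('v, 'a::comm_ring_1) mps)
      (replicate_mset k (f i)) = (if i \<in> I then 1 else 0)"
proof -
  have "{j \<in> I. replicate_mset k (f j) = replicate_mset k (f i)} = (if i \<in> I then {i} else {})"
    using assms by (auto simp: replicate_mset_eq_iff_pos dest: injD)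
  then show ?thesis by (simp add: monomial_sum.rep_eq)
qed

lemma coeff_monomial_sum_eq_0:
  assumes "\<And>i. i \<in> I \<Longrightarrow> m i \<noteq> M"
  shows "mps_coeff (monomial_sum I m :: ('v, 'a::comm_ring_1) mps) M = 0"
proof -
  have empty: "{i \<in> I. m i = M} = {}" using assms by auto
  show ?thesis unfolding monomial_sum.rep_eq empty by simp
qed

text \<open>The type \<open>var\<close> also contains \<open>X 0\<close> and \<open>Y 0\<close>,
  which occur in none of the series; this is the source of the conditions on
  \<open>var_index\<close> here and below.\<close>

lemma coeff_power_sum_replicate:
  assumes "0 < k"
  shows "mps_coeff (power_sum e k) (replicate_mset k v) =
    (if 1 \<le> var_index v then sign_pairing e (var_sign v) else 0)"
proof -
  have inj: "inj X" "inj Y" by (auto intro: injI)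
  show ?thesis
  proof (cases v)
    case (X i)
    have "mps_coeff (monomial_sum {1..} (\<lambda>i. replicate_mset k (Y i)) :: (var, complex) mps) (replicate_mset k v) = 0"
      using assms X by (intro coeff_monomial_sum_eq_0) (simp add: replicate_mset_eq_iff_pos)
    with coeff_monomial_sum_replicate[OF assms inj(1), of "{1..}" i, where 'a = complex] X show ?thesis
      by (cases e) (auto simp: power_sum_def Let_def plus_mps.rep_eq minus_mps.rep_eq sign_pairing_def)
  next
    case (Y i)
    have "mps_coeff (monomial_sum {1..} (\<lambda>i. replicate_mset k (X i)) :: (var, complex) mps) (replicate_mset k v) = 0"
      using assms Y by (intro coeff_monomial_sum_eq_0) (simp add: replicate_mset_eq_iff_pos)
    with coeff_monomial_sum_replicate[OF assms inj(2), of "{1..}" i, where 'a = complex] Y show ?thesis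
      by (cases e) (auto simp: power_sum_def Let_def plus_mps.rep_eq minus_mps.rep_eq sign_pairing_def)
  qed
qed

lemma coeff_power_sum_eq_0:
  assumes "\<And>v. M \<noteq> replicate_mset k v"
  shows "mps_coeff (power_sum e k) M = 0"
proof -
  have "mps_coeff (monomial_sum {1..} (\<lambda>i. replicate_mset k (X i)) :: (var, complex) mps) M = 0"
    "mps_coeff (monomial_sum {1..} (\<lambda>i. replicate_mset k (Y i)) :: (var, complex) mps) M = 0"
    by (rule coeff_monomial_sum_eq_0, metis assms)+
  then show ?thesis
    by (cases e) (auto simp: power_sum_def Let_def plus_mps.rep_eq minus_mps.rep_eq)
qed

text \<open>A power sum contains only pure \<open>k\<close>-th powers, so the convolution reduces to
  the variables that divide the monomial at least \<open>k\<close> times.\<close>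

lemma coeff_power_sum_times:
  assumes "0 < k"
  shows "mps_coeff (power_sum e k * f) M =
    (\<Sum>v | v \<in># M \<and> 1 \<le> var_index v \<and> k \<le> count M v.
       sign_pairing e (var_sign v) * mps_coeff f (M - replicate_mset k v))"
proof -
  let ?V = "{v. v \<in># M \<and> 1 \<le> var_index v \<and> k \<le> count M v}"
  have inj: "inj_on (replicate_mset k) ?V"
    using assms by (auto intro: inj_onI simp: replicate_mset_eq_iff_pos)
  have "mps_coeff (power_sum e k * f) M =
      (\<Sum>A | A \<subseteq># M. mps_coeff (power_sum e k) A * mps_coeff f (M - A))"
    by (simp add: times_mps.rep_eq)
  also have "\<dots> = (\<Sum>A\<in>replicate_mset k ` ?V. mps_coeff (power_sum e k) A * mps_coeff f (M - A))"
  proof (rule sum.mono_neutral_right)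
    show "replicate_mset k ` ?V \<subseteq> {A. A \<subseteq># M}"
      by (auto simp: count_le_replicate_mset_subset_eq)
    show "\<forall>A\<in>{A. A \<subseteq># M} - replicate_mset k ` ?V. mps_coeff (power_sum e k) A * mps_coeff f (M - A) = 0"
    proof
      fix A assume A: "A \<in> {A. A \<subseteq># M} - replicate_mset k ` ?V"
      have "mps_coeff (power_sum e k) A = 0"
      proof (cases "\<exists>v. A = replicate_mset k v")
        case True
        then obtain v where v: "A = replicate_mset k v" by blast
        from A have "replicate_mset k v \<subseteq># M" unfolding v by blast
        then have "k \<le> count M v" by (simp only: count_le_replicate_mset_subset_eq)
        moreover from this assms have "0 < count M v" by linarith
        then have "v \<in># M" by (simp only: count_greater_zero_iff)
        ultimately have "\<not> 1 \<le> var_index v" using A v by auto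
        then show ?thesis using coeff_power_sum_replicate[OF assms] v by simp
      next
        case False
        then show ?thesis by (intro coeff_power_sum_eq_0) auto
      qed
      then show "mps_coeff (power_sum e k) A * mps_coeff f (M - A) = 0" by simp
    qed
  qed (rule finite_submultisets)
  also have "\<dots> = (\<Sum>v\<in>?V. sign_pairing e (var_sign v) * mps_coeff f (M - replicate_mset k v))"
    unfolding sum.reindex[OF inj] o_def
    by (rule sum.cong) (auto simp: coeff_power_sum_replicate[OF assms])
  finally show ?thesis .
qed

definition power_sum_prod :: "('d \<Rightarrow> nat \<times> sign) \<Rightarrow> 'd set \<Rightarrow> (var, complex) mps" where
  "power_sum_prod ty D = (\<Prod>d\<in>D. power_sum (snd (ty d)) (fst (ty d)))"

lemma coeff_power_sum_prod_index_0:
  assumes "finite D" and "\<forall>d\<in>D. 0 < fst (ty d)" and "v \<in># M" and "var_index v = 0"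
  shows "mps_coeff (power_sum_prod ty D) M = 0"
  using assms(1-3)
proof (induction D arbitrary: M rule: finite_induct)
  case empty
  then show ?case by (auto simp: power_sum_prod_def one_mps.rep_eq)
next
  case (insert d D)
  have "v \<in># M - replicate_mset k u" if "1 \<le> var_index u" for k u
  proof -
    have "u \<noteq> v" using that assms(4) by auto
    with insert.prems(2) show ?thesis
      by (simp flip: count_greater_zero_iff)
  qed
  then have "mps_coeff (power_sum_prod ty D) (M - replicate_mset (fst (ty d)) u) = 0" if "1 \<le> var_index u" for u
    using that insert.prems(1) by (intro insert.IH) auto
  then show ?case
    using insert by (simp add: power_sum_prod_def coeff_power_sum_times)
qed

lemma coeff_power_sum_prod_size:
  assumes "finite D" and "\<forall>d\<in>D. 0 < fst (ty d)" and "size M \<noteq> (\<Sum>d\<in>D. fst (ty d))"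
  shows "mps_coeff (power_sum_prod ty D) M = 0"
  using assms
proof (induction D arbitrary: M rule: finite_induct)
  case empty
  then show ?case by (auto simp: power_sum_prod_def one_mps.rep_eq)
next
  case (insert d D)
  have "mps_coeff (power_sum_prod ty D) (M - replicate_mset (fst (ty d)) u) = 0"
    if "fst (ty d) \<le> count M u" for u
  proof (rule insert.IH)
    have "replicate_mset (fst (ty d)) u \<subseteq># M"
      using that by (simp add: count_le_replicate_mset_subset_eq)
    then have "size (M - replicate_mset (fst (ty d)) u) + fst (ty d) = size M"
      by (metis size_Un_disjoint size_replicate_mset size_union subset_mset.diff_add)
    then show "size (M - replicate_mset (fst (ty d)) u) \<noteq> (\<Sum>d\<in>D. fst (ty d))"
      using insert by auto
  qed (use insert in auto)
  then show ?case
    using insert by (simp add: power_sum_prod_def coeff_power_sum_times)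
qed

text \<open>Every factor contributes a pure power of a single variable. As \<open>v\<close> does not
  occur in \<open>N\<close>, the factors contributing \<open>v\<close> form a set \<open>A\<close>
  whose lengths add up to exactly \<open>t\<close>, and the others produce \<open>N\<close>.\<close>

lemma coeff_power_sum_prod_replicate_add:
  assumes "finite D" and "\<forall>d\<in>D. 0 < fst (ty d)" and "v \<notin># N" and "1 \<le> var_index v"
  shows "mps_coeff (power_sum_prod ty D) (replicate_mset t v + N) =
    (\<Sum>A | A \<subseteq> D \<and> (\<Sum>d\<in>A. fst (ty d)) = t.
       (\<Prod>d\<in>A. sign_pairing (snd (ty d)) (var_sign v)) * mps_coeff (power_sum_prod ty (D - A)) N)"
  using assms(1-3)
proof (induction D arbitrary: N t rule: finite_induct)
  case empty
  have "{A. A \<subseteq> {} \<and> (\<Sum>d\<in>A. fst (ty d)) = t} = (if t = 0 then {{}} else {})"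
    by auto
  then show ?case
    by (auto simp: power_sum_prod_def one_mps.rep_eq)
next
  case (insert d D)
  define k where "k = fst (ty d)"
  define e where "e = snd (ty d)"
  define \<eta> where "\<eta> = (\<lambda>A. \<Prod>d\<in>A. sign_pairing (snd (ty d)) (var_sign v))"
  define len where "len = (\<lambda>A. \<Sum>d\<in>A. fst (ty d))"
  define P where "P = power_sum_prod ty"
  have k: "0 < k" using insert.prems by (simp add: k_def)
  have fin: "finite A" if "A \<subseteq> D" for A using that insert.hyps finite_subset by auto
  have notin: "d \<notin> A" if "A \<subseteq> D" for A using that insert.hyps by auto
  have P_insert: "P (insert d A) = power_sum e k * P A" if "A \<subseteq> D" for A
    unfolding P_def power_sum_prod_def k_def e_def
    by (rule prod.insert[OF fin[OF that] notin[OF that]])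
  have IH: "mps_coeff (P D) (replicate_mset t v + N) =
      (\<Sum>A | A \<subseteq> D \<and> len A = t. \<eta> A * mps_coeff (P (D - A)) N)" if "v \<notin># N" for t N
    using insert that by (simp add: P_def \<eta>_def len_def)
  let ?M = "replicate_mset t v + N"
  let ?g = "\<lambda>u. sign_pairing e (var_sign u) * mps_coeff (P D) (?M - replicate_mset k u)"
  define V where "V = {u. u \<in># N \<and> 1 \<le> var_index u \<and> k \<le> count N u}"
  have vN: "count N v = 0" using insert.prems(2) by (simp add: not_in_iff)
  have V: "{u. u \<in># ?M \<and> 1 \<le> var_index u \<and> k \<le> count ?M u} = (if k \<le> t then {v} else {}) \<union> V"
    using k vN assms(4) by (auto simp: V_def split: if_splits)
  have finV: "finite V" by (rule finite_subset[of _ "set_mset N"]) (auto simp: V_def)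
  have "v \<notin> V" using insert.prems by (auto simp: V_def)
  \<comment> \<open>The new factor \<open>d\<close> contributes a power of \<open>v\<close>.\<close>
  have first: "(if k \<le> t then ?g v else 0) =
      (\<Sum>A | A \<subseteq> D \<and> len (insert d A) = t. \<eta> (insert d A) * mps_coeff (P (D - A)) N)"
  proof (cases "k \<le> t")
    case True
    have "?M - replicate_mset k v = replicate_mset (t - k) v + N"
      using True vN by (intro multiset_eqI) auto
    then have "?g v = sign_pairing e (var_sign v) * (\<Sum>A | A \<subseteq> D \<and> len A = t - k. \<eta> A * mps_coeff (P (D - A)) N)"
      using IH[OF insert.prems(2), of "t - k"] by simp
    also have "\<dots> = (\<Sum>A | A \<subseteq> D \<and> len (insert d A) = t. \<eta> (insert d A) * mps_coeff (P (D - A)) N)"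
      unfolding sum_distrib_left
    proof (rule sum.cong)
      have "len (insert d A) = len A + k" if "A \<subseteq> D" for A
        unfolding k_def len_def by (simp add: sum.insert[OF fin[OF that] notin[OF that]])
      then show "{A. A \<subseteq> D \<and> len A = t - k} = {A. A \<subseteq> D \<and> len (insert d A) = t}"
        using True by auto
      fix A assume "A \<in> {A. A \<subseteq> D \<and> len (insert d A) = t}"
      then have "\<eta> (insert d A) = sign_pairing e (var_sign v) * \<eta> A"
        unfolding e_def \<eta>_def by (simp add: prod.insert[OF fin notin])
      then show "sign_pairing e (var_sign v) * (\<eta> A * mps_coeff (P (D - A)) N) =
          \<eta> (insert d A) * mps_coeff (P (D - A)) N"
        by simp
    qed
    finally show ?thesis using True by simp
  next
    case False
    have "k \<le> len (insert d A)" if "A \<subseteq> D" for A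
      unfolding k_def len_def using fin[OF that] by (intro member_le_sum) auto
    then have empty: "{A. A \<subseteq> D \<and> len (insert d A) = t} = {}" using False by auto
    show ?thesis unfolding empty using False by simp
  qed
  \<comment> \<open>The new factor \<open>d\<close> contributes a power of a variable of
    \<open>N\<close>.\<close>
  have second: "(\<Sum>u\<in>V. ?g u) = (\<Sum>A | A \<subseteq> D \<and> len A = t. \<eta> A * mps_coeff (P (insert d D - A)) N)"
  proof -
    have "(\<Sum>u\<in>V. ?g u) = (\<Sum>u\<in>V. \<Sum>A | A \<subseteq> D \<and> len A = t.
        \<eta> A * (sign_pairing e (var_sign u) * mps_coeff (P (D - A)) (N - replicate_mset k u)))"
    proof (rule sum.cong)
      fix u assume u: "u \<in> V"
      with \<open>v \<notin> V\<close> have "u \<noteq> v" by auto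
      then have "?M - replicate_mset k u = replicate_mset t v + (N - replicate_mset k u)"
        by (intro multiset_eqI) auto
      moreover have "v \<notin># N - replicate_mset k u"
        using insert.prems(2) by (meson in_diffD)
      ultimately show "?g u = (\<Sum>A | A \<subseteq> D \<and> len A = t.
          \<eta> A * (sign_pairing e (var_sign u) * mps_coeff (P (D - A)) (N - replicate_mset k u)))"
        by (simp add: IH sum_distrib_left mult.left_commute)
    qed simp
    also have "\<dots> = (\<Sum>A | A \<subseteq> D \<and> len A = t. \<eta> A * mps_coeff (power_sum e k * P (D - A)) N)"
      unfolding coeff_power_sum_times[OF k] V_def[symmetric]
      by (subst sum.swap) (simp add: sum_distrib_left)
    also have "\<dots> = (\<Sum>A | A \<subseteq> D \<and> len A = t. \<eta> A * mps_coeff (P (insert d D - A)) N)"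
    proof (rule sum.cong)
      fix A assume "A \<in> {A. A \<subseteq> D \<and> len A = t}"
      then have "insert d D - A = insert d (D - A)" using insert.hyps by auto
      then show "\<eta> A * mps_coeff (power_sum e k * P (D - A)) N = \<eta> A * mps_coeff (P (insert d D - A)) N"
        by (simp add: P_insert)
    qed simp
    finally show ?thesis .
  qed
  have "mps_coeff (P (insert d D)) ?M =
      (\<Sum>u\<in>(if k \<le> t then {v} else {}) \<union> V. ?g u)"
    unfolding P_insert[OF order_refl] coeff_power_sum_times[OF k] V ..
  also have "\<dots> = (if k \<le> t then ?g v else 0) + (\<Sum>u\<in>V. ?g u)"
    using finV \<open>v \<notin> V\<close> by (subst sum.union_disjoint) auto
  also have "\<dots> = (\<Sum>A | A \<subseteq> D \<and> len A = t. \<eta> A * mps_coeff (P (insert d D - A)) N) +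
      (\<Sum>A\<in>insert d ` {A. A \<subseteq> D \<and> len (insert d A) = t}. \<eta> A * mps_coeff (P (insert d D - A)) N)"
  proof -
    have inj: "inj_on (insert d) {A. A \<subseteq> D \<and> len (insert d A) = t}"
    proof (rule inj_onI)
      fix A A' assume "A \<in> {A. A \<subseteq> D \<and> len (insert d A) = t}" "A' \<in> {A. A \<subseteq> D \<and> len (insert d A) = t}"
        and eq: "insert d A = insert d A'"
      then have "d \<notin> A" "d \<notin> A'" using notin by auto
      from insert_ident[OF this] eq show "A = A'" by blast
    qed
    have diff: "insert d D - insert d A = D - A" if "A \<subseteq> D" for A
      using that insert.hyps(2) by auto
    have "(\<Sum>A | A \<subseteq> D \<and> len (insert d A) = t. \<eta> (insert d A) * mps_coeff (P (D - A)) N) =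
        (\<Sum>A\<in>insert d ` {A. A \<subseteq> D \<and> len (insert d A) = t}. \<eta> A * mps_coeff (P (insert d D - A)) N)"
      unfolding sum.reindex[OF inj] o_def by (rule sum.cong) (auto simp only: diff mem_Collect_eq)
    then show ?thesis unfolding first second by (simp only: add.commute)
  qed
  also have "\<dots> = (\<Sum>A | A \<subseteq> insert d D \<and> len A = t. \<eta> A * mps_coeff (P (insert d D - A)) N)"
  proof -
    have "{A. A \<subseteq> insert d D \<and> len A = t} =
        {A. A \<subseteq> D \<and> len A = t} \<union> insert d ` {A. A \<subseteq> D \<and> len (insert d A) = t}"
    proof (intro equalityI subsetI)
      fix A assume A: "A \<in> {A. A \<subseteq> insert d D \<and> len A = t}"
      show "A \<in> {A. A \<subseteq> D \<and> len A = t} \<union> insert d ` {A. A \<subseteq> D \<and> len (insert d A) = t}"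
      proof (cases "d \<in> A")
        case True
        with A have "A = insert d (A - {d})" "A - {d} \<subseteq> D" by auto
        with A show ?thesis by (intro UnI2 image_eqI[where x = "A - {d}"]) auto
      qed (use A in auto)
    qed auto
    moreover have "{A. A \<subseteq> D \<and> len A = t} \<inter> insert d ` {A. A \<subseteq> D \<and> len (insert d A) = t} = {}"
      using insert.hyps(2) by auto
    moreover have "finite {A. A \<subseteq> D \<and> Q A}" for Q
      using insert.hyps(1) by simp
    ultimately show ?thesis
      by (simp only: sum.union_disjoint finite_imageI)
  qed
  finally show ?case by (simp only: P_def \<eta>_def len_def)
qed

fun monomial_of :: "(nat \<times> var) list \<Rightarrow> var multiset" where
  "monomial_of [] = {#}"
| "monomial_of ((t, v) # vs) = replicate_mset t v + monomial_of vs"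

abbreviation sign_pattern :: "(nat \<times> var) list \<Rightarrow> signed_composition" where
  "sign_pattern vs \<equiv> map (\<lambda>(t, v). (t, var_sign v)) vs"

lemma set_monomial_of: "set_mset (monomial_of vs) \<subseteq> snd ` set vs"
  by (induction vs rule: monomial_of.induct) (auto split: if_splits)

lemma coeff_power_sum_prod_monomial_of:
  assumes "finite D" and "\<forall>d\<in>D. 0 < fst (ty d)"
    and "distinct (map snd vs)" and "\<forall>p\<in>set vs. 1 \<le> var_index (snd p)"
  shows "mps_coeff (power_sum_prod ty D) (monomial_of vs) = coloring_sum ty (sign_pattern vs) D"
  using assms
proof (induction vs arbitrary: D rule: monomial_of.induct)
  case 1
  show ?case
  proof (cases "D = {}")
    case False
    then have "(\<Sum>d\<in>D. fst (ty d)) \<noteq> 0" using 1 by (auto simp: sum_eq_0_iff)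
    then have "mps_coeff (power_sum_prod ty D) {#} = 0"
      using 1 by (intro coeff_power_sum_prod_size) auto
    with False show ?thesis by simp
  qed (simp add: power_sum_prod_def one_mps.rep_eq)
next
  case (2 t v vs)
  have "v \<notin># monomial_of vs" using 2 set_monomial_of[of vs] by auto
  then have "mps_coeff (power_sum_prod ty D) (monomial_of ((t, v) # vs)) =
      (\<Sum>A | A \<subseteq> D \<and> (\<Sum>d\<in>A. fst (ty d)) = t.
       (\<Prod>d\<in>A. sign_pairing (snd (ty d)) (var_sign v)) * mps_coeff (power_sum_prod ty (D - A)) (monomial_of vs))"
    using 2 by (simp add: coeff_power_sum_prod_replicate_add)
  also have "\<dots> = coloring_sum ty (sign_pattern ((t, v) # vs)) D"
    using 2 by (auto intro!: sum.cong)
  finally show ?case .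
qed

section \<open>Coefficients of the series \<open>F\<close>\<close>

fun var_rank :: "var \<Rightarrow> nat" where
  "var_rank (Y i) = 2 * i"
| "var_rank (X i) = 2 * i + 1"

lemma var_rank_inj: "var_rank v = var_rank w \<Longrightarrow> v = w"
  by (cases v; cases w) (auto, presburger+)

lemma var_index_less_imp_rank_less: "var_index v < var_index w \<Longrightarrow> var_rank v < var_rank w"
  by (cases v; cases w) auto

text \<open>
  With the variables ordered as \<open>Y 1 < X 1 < Y 2 < X 2 < \<dots>\<close>, the weak descents become superfluous:
  the words of \<open>F\<close> are the weakly increasing words with the given sign vector that are strictly
  increasing at all elements of the signed set.
\<close>

lemma wDes_alt:
  assumes "\<sigma> \<in> signed_sets n"
  shows "wDes \<sigma> = {j \<in> fst \<sigma> \<inter> {1..<n}. sign_vector \<sigma> j = sign_vector \<sigma> (j + 1) \<or>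
    (sign_vector \<sigma> j = Plus \<and> sign_vector \<sigma> (j + 1) = Minus)}"
    and "j \<in> {1..<n} \<Longrightarrow> j \<notin> fst \<sigma> \<Longrightarrow> sign_vector \<sigma> j = sign_vector \<sigma> (j + 1)"
    and "s \<in> fst \<sigma> \<Longrightarrow> sign_vector \<sigma> s = snd \<sigma> s"
proof -
  obtain S \<epsilon> where \<sigma>: "\<sigma> = (S, \<epsilon>)" by force
  with assms have S: "n \<in> S" "S \<subseteq> {1..n}" by (auto simp: signed_sets_def)
  then have fin: "finite S" using finite_subset by auto
  have max: "Max S = n" using S fin by (intro Max_eqI) auto
  have at: "sign_vector \<sigma> s = \<epsilon> s" if "s \<in> S" for s
  proof -
    have "Min {t \<in> S. s \<le> t} = s" using that fin by (intro Min_eqI) auto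
    then show ?thesis by (simp add: sign_vector_def \<sigma>)
  qed
  have after: "sign_vector \<sigma> (s + 1) = \<epsilon> (Min {t \<in> S. s < t})" for s
    by (simp add: sign_vector_def \<sigma> Suc_le_eq)
  show "wDes \<sigma> = {j \<in> fst \<sigma> \<inter> {1..<n}. sign_vector \<sigma> j = sign_vector \<sigma> (j + 1) \<or>
      (sign_vector \<sigma> j = Plus \<and> sign_vector \<sigma> (j + 1) = Minus)}"
    unfolding wDes_def after using S at by (auto simp: \<sigma> max Let_def)
  show "sign_vector \<sigma> j = sign_vector \<sigma> (j + 1)" if "j \<in> {1..<n}" "j \<notin> fst \<sigma>"
  proof -
    have "{t \<in> S. j \<le> t} = {t \<in> S. j + 1 \<le> t}"
      using that(2) by (auto simp: \<sigma> Suc_le_eq order_le_less)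
    then show ?thesis by (simp only: sign_vector_def \<sigma> prod.case)
  qed
  show "s \<in> fst \<sigma> \<Longrightarrow> sign_vector \<sigma> s = snd \<sigma> s"
    using at by (simp add: \<sigma>)
qed

text \<open>Below \<open>n\<close>, the only elements of the signed set outside \<open>wDes\<close>
  are steps from \<open>Minus\<close> to \<open>Plus\<close>. There \<open>Y i\<close> may be
  followed by \<open>X i\<close>, which already is a proper rise in rank. In a step from
  \<open>Plus\<close> to \<open>Minus\<close> a weak rise in rank already forces a strict rise of
  the index.\<close>

lemma F_words:
  fixes i :: "nat \<Rightarrow> nat"
  assumes \<sigma>: "\<sigma> \<in> signed_sets n"
  defines "w \<equiv> \<lambda>j. signed_var (sign_vector \<sigma> j) (i j)"
  shows "(\<forall>j\<in>{1..<n}. i j \<le> i (j + 1)) \<and> (\<forall>j\<in>wDes \<sigma>. i j < i (j + 1)) \<longleftrightarrow>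
    (\<forall>j\<in>{1..<n}. var_rank (w j) \<le> var_rank (w (j + 1))) \<and>
    (\<forall>j\<in>fst \<sigma> \<inter> {1..<n}. w j \<noteq> w (j + 1))"
proof -
  have step: "i j \<le> i (j + 1) \<and> (j \<in> wDes \<sigma> \<longrightarrow> i j < i (j + 1)) \<longleftrightarrow>
      var_rank (w j) \<le> var_rank (w (j + 1)) \<and> (j \<in> fst \<sigma> \<longrightarrow> w j \<noteq> w (j + 1))"
    if j: "j \<in> {1..<n}" for j
  proof (cases "j \<in> fst \<sigma>")
    case True
    with j have D: "j \<in> wDes \<sigma> \<longleftrightarrow> sign_vector \<sigma> j = sign_vector \<sigma> (j + 1) \<or>
      (sign_vector \<sigma> j = Plus \<and> sign_vector \<sigma> (j + 1) = Minus)"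
      unfolding wDes_alt(1)[OF \<sigma>] by auto
    show ?thesis
      unfolding D w_def using True
      by (cases "sign_vector \<sigma> j"; cases "sign_vector \<sigma> (j + 1)") (auto simp: signed_var_def)
  next
    case False
    then have "j \<notin> wDes \<sigma>" unfolding wDes_alt(1)[OF \<sigma>] by blast
    with False wDes_alt(2)[OF \<sigma> j False] show ?thesis
      by (cases "sign_vector \<sigma> j") (auto simp: w_def signed_var_def)
  qed
  have "wDes \<sigma> \<subseteq> {1..<n}" unfolding wDes_alt(1)[OF \<sigma>] by blast
  then have "(\<forall>j\<in>{1..<n}. i j \<le> i (j + 1)) \<and> (\<forall>j\<in>wDes \<sigma>. i j < i (j + 1)) \<longleftrightarrow>
      (\<forall>j\<in>{1..<n}. i j \<le> i (j + 1) \<and> (j \<in> wDes \<sigma> \<longrightarrow> i j < i (j + 1)))"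
    by (auto simp only: subset_iff Ball_def)
  also have "\<dots> \<longleftrightarrow> (\<forall>j\<in>{1..<n}. var_rank (w j) \<le> var_rank (w (j + 1)) \<and>
      (j \<in> fst \<sigma> \<longrightarrow> w j \<noteq> w (j + 1)))"
    by (rule ball_cong[OF refl step])
  finally show ?thesis by (auto simp only: Ball_def Int_iff)
qed

text \<open>A sorted list is determined by its multiset, and \<open>var_rank\<close> is
  injective.\<close>

lemma increasing_words_eqI:
  fixes v w :: "nat \<Rightarrow> var"
  assumes "\<forall>j\<in>{1..<n}. var_rank (v j) \<le> var_rank (v (j + 1))"
    and "\<forall>j\<in>{1..<n}. var_rank (w j) \<le> var_rank (w (j + 1))"
    and "image_mset v (mset_set {1..n}) = image_mset w (mset_set {1..n})"
    and "j \<in> {1..n}"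
  shows "v j = w j"
proof -
  define L where "L = (\<lambda>v :: nat \<Rightarrow> var. map (\<lambda>j. var_rank (v j)) [1..<n + 1])"
  have sorted: "sorted (L v)" if "\<forall>j\<in>{1..<n}. var_rank (v j) \<le> var_rank (v (j + 1))" for v
    unfolding sorted_iff_nth_Suc L_def using that by (auto simp del: upt_Suc)
  have mset_L: "mset (L v) = image_mset var_rank (image_mset v (mset_set {1..n}))" for v
  proof -
    have "mset [1..<n + 1] = mset_set {1..n}"
      by (simp add: mset_upt atLeastLessThanSuc_atLeastAtMost del: upt_Suc)
    then show ?thesis by (simp add: L_def multiset.map_comp o_def del: upt_Suc)
  qed
  have "L v = L w"
    using properties_for_sort[of "L v" "L w"] properties_for_sort[of "L w" "L w"]
      sorted[OF assms(1)] sorted[OF assms(2)] assms(3) by (simp add: mset_L)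
  then have "var_rank (v j) = var_rank (w j)"
    using assms(4) unfolding L_def by (simp add: map_eq_conv del: upt_Suc)
  then show ?thesis by (rule var_rank_inj)
qed

text \<open>The multiset determines the sorted word and the word determines the indices, so at most
  one index function contributes to the coefficient.\<close>

lemma coeff_F_word:
  assumes \<sigma>: "\<sigma> \<in> signed_sets n"
    and index: "\<forall>j\<in>{1..n}. 1 \<le> var_index (v j)"
    and incr: "\<forall>j\<in>{1..<n}. var_rank (v j) \<le> var_rank (v (j + 1))"
  shows "mps_coeff (F n \<sigma>) (image_mset v (mset_set {1..n})) =
    (if (\<forall>j\<in>{1..n}. var_sign (v j) = sign_vector \<sigma> j) \<and> (\<forall>j\<in>fst \<sigma> \<inter> {1..<n}. v j \<noteq> v (j + 1))
     then 1 else 0)"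
    (is "_ = (if ?good then 1 else 0)")
proof -
  let ?w = "\<lambda>(i :: nat \<Rightarrow> nat) j. signed_var (sign_vector \<sigma> j) (i j)"
  define I where "I = {i \<in> {1..n} \<rightarrow>\<^sub>E {1..}.
    (\<forall>j\<in>{1..<n}. i j \<le> i (j + 1)) \<and> (\<forall>j\<in>wDes \<sigma>. i j < i (j + 1)) \<and>
    image_mset (?w i) (mset_set {1..n}) = image_mset v (mset_set {1..n})}"
  \<comment> \<open>The only candidate; it is restricted because the index functions in
    \<open>F\<close> are extensional.\<close>
  define i0 where "i0 = restrict (\<lambda>j. var_index (v j)) {1..n}"
  have I_word: "(\<forall>j\<in>{1..<n}. var_rank (?w i j) \<le> var_rank (?w i (j + 1))) \<and>
      (\<forall>j\<in>fst \<sigma> \<inter> {1..<n}. ?w i j \<noteq> ?w i (j + 1))" if "i \<in> I" for i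
    by (rule iffD1[OF F_words[OF \<sigma>]]) (use that in \<open>unfold I_def, blast\<close>)
  have I_mset: "image_mset (?w i) (mset_set {1..n}) = image_mset v (mset_set {1..n})" if "i \<in> I" for i
    using that unfolding I_def by blast
  have agree: "?w i j = v j" if "i \<in> I" "j \<in> {1..n}" for i j
    by (rule increasing_words_eqI[OF conjunct1[OF I_word[OF that(1)]] incr I_mset[OF that(1)] that(2)])
  have sub: "I \<subseteq> {i0}"
  proof
    fix i assume i: "i \<in> I"
    have "i j = i0 j" for j
    proof (cases "j \<in> {1..n}")
      case True
      from arg_cong[OF agree[OF i this], of var_index] True show ?thesis by (simp add: i0_def)
    next
      case False
      from i have "i \<in> {1..n} \<rightarrow>\<^sub>E {1..}" unfolding I_def by blast
      from PiE_arb[OF this False] show ?thesis unfolding i0_def restrict_def if_not_P[OF False] .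
    qed
    then show "i \<in> {i0}" by auto
  qed
  have "i0 \<in> I \<longleftrightarrow> ?good"
  proof
    assume i0: "i0 \<in> I"
    have "var_sign (v j) = sign_vector \<sigma> j" if "j \<in> {1..n}" for j
      using arg_cong[OF agree[OF i0 that], of var_sign] by simp
    moreover have "v j \<noteq> v (j + 1)" if "j \<in> fst \<sigma> \<inter> {1..<n}" for j
    proof -
      have "?w i0 j \<noteq> ?w i0 (j + 1)"
        using I_word[OF i0] that by blast
      moreover from that have j: "j \<in> {1..n}" "j + 1 \<in> {1..n}" by auto
      ultimately show ?thesis unfolding agree[OF i0 j(1)] agree[OF i0 j(2)] by blast
    qed
    ultimately show ?good by blast
  next
    assume good: ?good
    have eq: "?w i0 j = v j" if "j \<in> {1..n}" for j
      using good that signed_var_var_sign[of "v j"] by (auto simp: i0_def)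
    have "image_mset (?w i0) (mset_set {1..n}) = image_mset v (mset_set {1..n})"
      by (rule image_mset_cong) (simp add: eq)
    moreover have "(\<forall>j\<in>{1..<n}. var_rank (?w i0 j) \<le> var_rank (?w i0 (j + 1))) \<and>
        (\<forall>j\<in>fst \<sigma> \<inter> {1..<n}. ?w i0 j \<noteq> ?w i0 (j + 1))"
    proof (intro conjI ballI)
      fix j assume "j \<in> {1..<n}"
      with incr show "var_rank (?w i0 j) \<le> var_rank (?w i0 (j + 1))"
        by (subst (1 2) eq) auto
    next
      fix j assume "j \<in> fst \<sigma> \<inter> {1..<n}"
      with good show "?w i0 j \<noteq> ?w i0 (j + 1)"
        by (subst (1 2) eq) auto
    qed
    moreover have "i0 \<in> {1..n} \<rightarrow>\<^sub>E {1..}" using index by (auto simp: i0_def)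
    ultimately show "i0 \<in> I"
      unfolding I_def using iffD2[OF F_words[OF \<sigma>, of i0]] by blast
  qed
  then have "card I = (if ?good then 1 else 0)"
    using sub by (cases "i0 \<in> I") (auto simp: subset_singleton_iff)
  moreover have "mps_coeff (F n \<sigma>) (image_mset v (mset_set {1..n})) = of_nat (card I)"
    by (simp add: F_def monomial_sum.rep_eq I_def conj_ac)
  ultimately show ?thesis by simp
qed

lemma coeff_F_eq_0:
  assumes "size M \<noteq> n \<or> (\<exists>v\<in>#M. var_index v = 0)"
  shows "mps_coeff (F n \<sigma>) M = 0"
  unfolding F_def
proof (rule coeff_monomial_sum_eq_0)
  fix i :: "nat \<Rightarrow> nat" assume i: "i \<in> {i \<in> {1..n} \<rightarrow>\<^sub>E {1..}.
        (\<forall>j\<in>{1..<n}. i j \<le> i (j + 1)) \<and> (\<forall>j\<in>wDes \<sigma>. i j < i (j + 1))}"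
  show "image_mset (\<lambda>j. signed_var (sign_vector \<sigma> j) (i j)) (mset_set {1..n}) \<noteq> M"
  proof
    assume M: "image_mset (\<lambda>j. signed_var (sign_vector \<sigma> j) (i j)) (mset_set {1..n}) = M"
    then have "size M = n" by auto
    moreover have "1 \<le> var_index v" if "v \<in># M" for v
      using that i M by (auto simp: PiE_iff)
    ultimately show False using assms by fastforce
  qed
qed

section \<open>Runs of equal letters in sorted words\<close>

fun word_matches :: "nat set \<Rightarrow> (nat \<Rightarrow> sign) \<Rightarrow> nat \<Rightarrow> var list \<Rightarrow> bool" where
  "word_matches S \<epsilon> a [] \<longleftrightarrow> True"
| "word_matches S \<epsilon> a (x # xs) \<longleftrightarrow>
     var_sign x = \<epsilon> (a + 1) \<and> (xs \<noteq> [] \<and> a + 1 \<in> S \<longrightarrow> x \<noteq> hd xs) \<and> word_matches S \<epsilon> (a + 1) xs"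

lemma word_matches_nth:
  "word_matches S \<epsilon> a xs \<longleftrightarrow>
     (\<forall>i<length xs. var_sign (xs ! i) = \<epsilon> (a + i + 1)) \<and>
     (\<forall>i. Suc i < length xs \<and> a + i + 1 \<in> S \<longrightarrow> xs ! i \<noteq> xs ! Suc i)"
proof (induction xs arbitrary: a)
  case (Cons x xs)
  have "(\<forall>i<length (x # xs). var_sign ((x # xs) ! i) = \<epsilon> (a + i + 1)) \<longleftrightarrow>
      var_sign x = \<epsilon> (a + 1) \<and> (\<forall>i<length xs. var_sign (xs ! i) = \<epsilon> (a + 1 + i + 1))"
    by (auto simp: less_Suc_eq_0_disj)
  moreover have "(\<forall>i. Suc i < length (x # xs) \<and> a + i + 1 \<in> S \<longrightarrow> (x # xs) ! i \<noteq> (x # xs) ! Suc i) \<longleftrightarrow>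
      (xs \<noteq> [] \<and> a + 1 \<in> S \<longrightarrow> x \<noteq> hd xs) \<and>
      (\<forall>i. Suc i < length xs \<and> a + 1 + i + 1 \<in> S \<longrightarrow> xs ! i \<noteq> xs ! Suc i)"
  proof -
    have all: "(\<forall>i. P i) \<longleftrightarrow> P 0 \<and> (\<forall>i. P (Suc i))" for P
      by (metis not0_implies_Suc)
    show ?thesis by (subst all) (auto simp: hd_conv_nth)
  qed
  ultimately show ?case using Cons.IH[of "a + 1"] by auto
qed simp

text \<open>Adjacent letters inside the run are equal, so none of its positions but the last may lie
  in \<open>S\<close>; after the last position \<open>a + Suc t\<close> the letter changes by
  assumption, so that \<open>S\<close> imposes nothing there.\<close>

lemma word_matches_replicate_append:
  assumes "xs = [] \<or> hd xs \<noteq> v"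
  shows "word_matches S \<epsilon> a (replicate (Suc t) v @ xs) \<longleftrightarrow>
    (\<forall>j\<in>{a + 1..a + Suc t}. \<epsilon> j = var_sign v) \<and> S \<inter> {a + 1..<a + Suc t} = {} \<and>
    word_matches S \<epsilon> (a + Suc t) xs"
proof (induction t arbitrary: a)
  case 0
  have "{a + 1..a + Suc 0} = {a + 1}" "{a + 1..<a + Suc 0} = {}" by auto
  then show ?case using assms by auto
next
  case (Suc t)
  have "{a + 1..a + Suc (Suc t)} = insert (a + 1) {a + 1 + 1..a + 1 + Suc t}"
    "{a + 1..<a + Suc (Suc t)} = insert (a + 1) {a + 1 + 1..<a + 1 + Suc t}" by auto
  with Suc[of "a + 1"] show ?case by auto
qed

abbreviation word_of :: "(nat \<times> var) list \<Rightarrow> var list" where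
  "word_of vs \<equiv> concat (map (\<lambda>(t, v). replicate t v) vs)"

lemma mset_word_of: "mset (word_of vs) = monomial_of vs"
  by (induction vs rule: monomial_of.induct) auto

lemma length_word_of: "length (word_of vs) = sum_list (map fst vs)"
  by (induction vs) auto

lemma set_word_of: "set (word_of vs) \<subseteq> snd ` set vs"
  by (induction vs) auto

text \<open>Distinct variables with positive multiplicities make the entries of \<open>vs\<close>
  the maximal runs of the word. This connects the condition by positions in
  \<open>coeff_F_word\<close> with the condition by runs in \<open>word_indicator\<close>.\<close>

lemma word_matches_word_of:
  assumes "\<forall>p\<in>set vs. 0 < fst p" and "distinct (map snd vs)"
  shows "word_indicator S \<epsilon> a (sign_pattern vs) = (if word_matches S \<epsilon> a (word_of vs) then 1 else 0)"
  using assms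
proof (induction vs arbitrary: a)
  case (Cons p vs)
  obtain t v where p: "p = (Suc t, v)"
    using Cons.prems by (cases p) (auto simp: gr0_conv_Suc)
  have "v \<notin> snd ` set vs" using Cons.prems p by auto
  then have "v \<notin> set (word_of vs)" using set_word_of[of vs] by blast
  then have "word_of vs = [] \<or> hd (word_of vs) \<noteq> v" by (metis hd_in_set)
  then have "word_matches S \<epsilon> a (word_of (p # vs)) \<longleftrightarrow>
    (\<forall>j\<in>{a + 1..a + Suc t}. \<epsilon> j = var_sign v) \<and> S \<inter> {a + 1..<a + Suc t} = {} \<and>
    word_matches S \<epsilon> (a + Suc t) (word_of vs)"
    using word_matches_replicate_append[of "word_of vs" v] by (simp add: p del: replicate_Suc)
  moreover have "word_indicator S \<epsilon> (a + Suc t) (sign_pattern vs) =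
      (if word_matches S \<epsilon> (a + Suc t) (word_of vs) then 1 else 0)"
    using Cons by auto
  ultimately show ?case by (simp only: p list.map prod.case word_indicator.simps) auto
qed simp

lemma sorted_word_of:
  "sorted (map var_rank (map snd vs)) \<Longrightarrow> sorted (map var_rank (word_of vs))"
proof (induction vs)
  case (Cons p vs)
  then show ?case
    using set_word_of[of vs] by (cases p) (auto simp: sorted_append)
qed simp

lemma coeff_F_monomial_of:
  assumes \<sigma>: "\<sigma> \<in> signed_sets n"
    and pos: "\<forall>p\<in>set vs. 0 < fst p" and size: "sum_list (map fst vs) = n"
    and index: "\<forall>p\<in>set vs. 1 \<le> var_index (snd p)"
    and sorted: "sorted_wrt (<) (map var_rank (map snd vs))"
  shows "mps_coeff (F n \<sigma>) (monomial_of vs) =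
    word_indicator (fst \<sigma>) (sign_vector \<sigma>) 0 (sign_pattern vs)"
proof -
  define w where "w = word_of vs"
  define v where "v = (\<lambda>j. w ! (j - 1))"
  have len: "length w = n" using size by (simp add: w_def length_word_of)
  have "mset w = image_mset v (mset_set {1..n})"
  proof -
    have "w = map v [1..<n + 1]"
      by (rule nth_equalityI) (auto simp: len v_def simp del: upt_Suc)
    moreover have "mset [1..<n + 1] = mset_set {1..n}"
      by (simp add: mset_upt atLeastLessThanSuc_atLeastAtMost del: upt_Suc)
    ultimately show ?thesis by (metis mset_map)
  qed
  then have mono: "monomial_of vs = image_mset v (mset_set {1..n})"
    by (simp add: w_def mset_word_of)
  have "sorted (map var_rank w)"
    unfolding w_def using sorted unfolding strict_sorted_iff by (blast intro: sorted_word_of)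
  then have sorted_nth: "var_rank (w ! i) \<le> var_rank (w ! Suc i)" if "Suc i < n" for i
    using that len by (simp add: sorted_iff_nth_Suc)
  have incr: "\<forall>j\<in>{1..<n}. var_rank (v j) \<le> var_rank (v (j + 1))"
  proof
    fix j assume "j \<in> {1..<n}"
    then obtain i where "j = Suc i" "Suc i < n" by (cases j) auto
    with sorted_nth show "var_rank (v j) \<le> var_rank (v (j + 1))" by (simp add: v_def)
  qed
  have idx: "\<forall>j\<in>{1..n}. 1 \<le> var_index (v j)"
  proof
    fix j assume "j \<in> {1..n}"
    then have "v j \<in> set w" by (auto simp: v_def len)
    then show "1 \<le> var_index (v j)" using set_word_of[of vs] index by (auto simp: w_def)
  qed
  have dist: "distinct (map snd vs)"
    using sorted unfolding strict_sorted_iff distinct_map[of var_rank] by blast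
  have iff: "(\<forall>j\<in>{1..n}. var_sign (v j) = sign_vector \<sigma> j) \<and> (\<forall>j\<in>fst \<sigma> \<inter> {1..<n}. v j \<noteq> v (j + 1)) \<longleftrightarrow>
      word_matches (fst \<sigma>) (sign_vector \<sigma>) 0 w"
  proof -
    have "(\<forall>j\<in>{1..n}. var_sign (v j) = sign_vector \<sigma> j) \<longleftrightarrow>
        (\<forall>j\<in>Suc ` {..<n}. var_sign (v j) = sign_vector \<sigma> j)"
      by (simp only: image_Suc_lessThan)
    also have "\<dots> \<longleftrightarrow> (\<forall>i<n. var_sign (w ! i) = sign_vector \<sigma> (Suc i))"
      unfolding ball_simps(9) by (simp add: v_def Ball_def)
    finally have "(\<forall>j\<in>{1..n}. var_sign (v j) = sign_vector \<sigma> j) \<longleftrightarrow>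
        (\<forall>i<n. var_sign (w ! i) = sign_vector \<sigma> (Suc i))" .
    moreover have "(\<forall>j\<in>fst \<sigma> \<inter> {1..<n}. v j \<noteq> v (j + 1)) \<longleftrightarrow>
        (\<forall>i. Suc i < n \<and> Suc i \<in> fst \<sigma> \<longrightarrow> w ! i \<noteq> w ! Suc i)"
    proof (intro iffI allI impI ballI)
      fix i assume "\<forall>j\<in>fst \<sigma> \<inter> {1..<n}. v j \<noteq> v (j + 1)" and i: "Suc i < n \<and> Suc i \<in> fst \<sigma>"
      from bspec[OF this(1), of "Suc i"] i show "w ! i \<noteq> w ! Suc i" by (simp add: v_def)
    next
      fix j assume all: "\<forall>i. Suc i < n \<and> Suc i \<in> fst \<sigma> \<longrightarrow> w ! i \<noteq> w ! Suc i"
        and j: "j \<in> fst \<sigma> \<inter> {1..<n}"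
      then obtain i where "j = Suc i" by (cases j) auto
      with spec[OF all, of i] j show "v j \<noteq> v (j + 1)" by (simp add: v_def)
    qed
    ultimately show ?thesis by (simp add: word_matches_nth len)
  qed
  show ?thesis
    unfolding mono coeff_F_word[OF \<sigma> idx incr] iff
    unfolding w_def word_matches_word_of[OF pos dist] by (rule refl)
qed

lemma monomial_of_surj:
  assumes "\<forall>v\<in>#M. 1 \<le> var_index v"
  obtains vs where "monomial_of vs = M" "\<forall>p\<in>set vs. 0 < fst p"
    "\<forall>p\<in>set vs. 1 \<le> var_index (snd p)" "sorted_wrt (<) (map var_rank (map snd vs))"
proof -
  obtain ys where ys: "set ys = set_mset M" "distinct ys"
    using finite_distinct_list[OF finite_set_mset[of M]] by blast
  define xs where "xs = sort_key var_rank ys"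
  define vs where "vs = map (\<lambda>v. (count M v, v)) xs"
  have xs: "set xs = set_mset M" "distinct xs" "sorted (map var_rank xs)"
    using ys by (simp_all add: xs_def)
  have snd: "map snd vs = xs" by (simp add: vs_def o_def)
  have "monomial_of (map (\<lambda>v. (count M v, v)) zs) = filter_mset (\<lambda>v. v \<in> set zs) M" if "distinct zs" for zs
    using that
  proof (induction zs)
    case (Cons z zs)
    then show ?case by (intro multiset_eqI) auto
  qed simp
  from this[OF xs(2)] have "monomial_of vs = M"
    unfolding vs_def xs(1) by (simp add: filter_mset_cong[of M M "\<lambda>v. v \<in># M" "\<lambda>_. True"])
  moreover have "sorted_wrt (<) (map var_rank (map snd vs))"
    unfolding snd strict_sorted_iff using xs by (auto simp: distinct_map intro!: inj_onI var_rank_inj)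
  moreover have "\<forall>p\<in>set vs. 0 < fst p \<and> 1 \<le> var_index (snd p)"
    using assms xs(1) by (auto simp: vs_def)
  ultimately show ?thesis using that by blast
qed

lemma sign_pattern_surj:
  obtains vs where "sign_pattern vs = \<tau>" "\<forall>p\<in>set vs. 1 \<le> var_index (snd p)"
    "sorted_wrt (<) (map var_rank (map snd vs))"
proof
  \<comment> \<open>Strictly growing indices make the ranks grow whatever the signs are;
    \<open>i + 1\<close> keeps the indices positive.\<close>
  let ?vs = "map (\<lambda>i. (fst (\<tau> ! i), signed_var (snd (\<tau> ! i)) (i + 1))) [0..<length \<tau>]"
  show "sign_pattern ?vs = \<tau>" by (rule nth_equalityI) auto
  show "\<forall>p\<in>set ?vs. 1 \<le> var_index (snd p)" by auto
  show "sorted_wrt (<) (map var_rank (map snd ?vs))"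
    by (auto simp: sorted_wrt_iff_nth_less intro!: var_index_less_imp_rank_less)
qed

text \<open>Both sides are homogeneous of degree \<open>n\<close> in the variables of positive
  index. At such a monomial, written in sorted order, both coefficients depend on the sign pattern
  only, and every signed composition of \<open>n\<close> occurs as a pattern.\<close>

lemma power_sums_eq_sum_F_iff:
  assumes W: "finite W" "\<And>w. w \<in> W \<Longrightarrow> finite (D w)"
    "\<And>w d. w \<in> W \<Longrightarrow> d \<in> D w \<Longrightarrow> 0 < fst (ty w d)"
    "\<And>w. w \<in> W \<Longrightarrow> (\<Sum>d\<in>D w. fst (ty w d)) = n"
    and B: "sDes \<in> B \<rightarrow> signed_sets n"
  shows "(\<Sum>w\<in>W. mps_const (a w) * power_sum_prod (ty w) (D w)) = (\<Sum>b\<in>B. F n (sDes b)) \<longleftrightarrow>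
    (\<forall>\<tau>\<in>signed_compositions n. (\<Sum>w\<in>W. a w * coloring_sum (ty w) \<tau> (D w)) =
      (\<Sum>b\<in>B. word_indicator (fst (sDes b)) (sign_vector (sDes b)) 0 \<tau>))"
    (is "?f = ?F \<longleftrightarrow> (\<forall>\<tau>\<in>_. ?p \<tau> = ?q \<tau>)")
proof -
  have coeff_const: "mps_coeff (mps_const c * f) M = c * mps_coeff f M"
    for c and f :: "(var, complex) mps" and M
  proof -
    have "mps_coeff (mps_const c * f) M = (\<Sum>A | A \<subseteq># M. if A = {#} then c * mps_coeff f M else 0)"
      unfolding times_mps.rep_eq mps_const.rep_eq by (rule sum.cong) auto
    then show ?thesis by (simp add: finite_submultisets)
  qed
  have coeff_f: "mps_coeff ?f M = (\<Sum>w\<in>W. a w * mps_coeff (power_sum_prod (ty w) (D w)) M)" for M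
    by (induction W rule: infinite_finite_induct)
      (auto simp: zero_mps.rep_eq plus_mps.rep_eq coeff_const)
  have coeff_F: "mps_coeff ?F M = (\<Sum>b\<in>B. mps_coeff (F n (sDes b)) M)" for M
    by (induction B rule: infinite_finite_induct)
      (auto simp: zero_mps.rep_eq plus_mps.rep_eq)
  have at: "mps_coeff ?f (monomial_of vs) = ?p (sign_pattern vs) \<and>
      mps_coeff ?F (monomial_of vs) = ?q (sign_pattern vs)"
    if vs: "\<forall>p\<in>set vs. 0 < fst p" "sum_list (map fst vs) = n"
      "\<forall>p\<in>set vs. 1 \<le> var_index (snd p)" "sorted_wrt (<) (map var_rank (map snd vs))" for vs
  proof
    have "distinct (map snd vs)"
      using vs(4) unfolding strict_sorted_iff distinct_map[of var_rank] by blast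
    then show "mps_coeff ?f (monomial_of vs) = ?p (sign_pattern vs)"
      unfolding coeff_f using W vs(3)
      by (intro sum.cong) (auto simp: coeff_power_sum_prod_monomial_of)
    show "mps_coeff ?F (monomial_of vs) = ?q (sign_pattern vs)"
      unfolding coeff_F using B vs
      by (intro sum.cong refl coeff_F_monomial_of) auto
  qed
  show ?thesis
  proof
    assume eq: "?f = ?F"
    show "\<forall>\<tau>\<in>signed_compositions n. ?p \<tau> = ?q \<tau>"
    proof
      fix \<tau> assume \<tau>: "\<tau> \<in> signed_compositions n"
      obtain vs where vs: "sign_pattern vs = \<tau>" "\<forall>p\<in>set vs. 1 \<le> var_index (snd p)"
        "sorted_wrt (<) (map var_rank (map snd vs))"
        by (rule sign_pattern_surj)
      have "\<forall>p\<in>set vs. 0 < fst p" "sum_list (map fst vs) = n"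
        using \<tau> unfolding vs(1)[symmetric] by (auto simp: signed_compositions_def o_def case_prod_unfold)
      note at = at[OF this vs(2,3), unfolded vs(1)]
      have "?p \<tau> = mps_coeff ?f (monomial_of vs)" by (rule conjunct1[OF at, symmetric])
      also have "\<dots> = mps_coeff ?F (monomial_of vs)" by (simp only: eq)
      also have "\<dots> = ?q \<tau>" by (rule conjunct2[OF at])
      finally show "?p \<tau> = ?q \<tau>" .
    qed
  next
    assume eq: "\<forall>\<tau>\<in>signed_compositions n. ?p \<tau> = ?q \<tau>"
    show "?f = ?F"
    proof (rule mps_eqI)
      fix M
      show "mps_coeff ?f M = mps_coeff ?F M"
      proof (cases "size M = n \<and> (\<forall>v\<in>#M. 1 \<le> var_index v)")
        case True
        then obtain vs where vs: "monomial_of vs = M" "\<forall>p\<in>set vs. 0 < fst p"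
          "\<forall>p\<in>set vs. 1 \<le> var_index (snd p)" "sorted_wrt (<) (map var_rank (map snd vs))"
          using monomial_of_surj by blast
        have sum: "sum_list (map fst vs) = n"
          using True vs(1) mset_word_of[of vs] length_word_of[of vs] by (metis size_mset)
        have "sign_pattern vs \<in> signed_compositions n"
          using vs(2) sum by (auto simp: signed_compositions_def o_def case_prod_unfold)
        note pq = bspec[OF eq this] and at = at[OF vs(2) sum vs(3,4), unfolded vs(1)]
        have "mps_coeff ?f M = ?p (sign_pattern vs)" by (rule conjunct1[OF at])
        also note pq
        also have "?q (sign_pattern vs) = mps_coeff ?F M" by (rule conjunct2[OF at, symmetric])
        finally show ?thesis .
      next
        case False
        then have "size M \<noteq> n \<or> (\<exists>v\<in>#M. var_index v = 0)"
          by (metis One_nat_def Suc_leI gr0I)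
        moreover have "mps_coeff (power_sum_prod (ty w) (D w)) M = 0" if "w \<in> W" for w
          using calculation
        proof
          assume "size M \<noteq> n"
          with that W show ?thesis by (intro coeff_power_sum_prod_size) auto
        next
          assume "\<exists>v\<in>#M. var_index v = 0"
          with that W show ?thesis by (metis coeff_power_sum_prod_index_0)
        qed
        ultimately show ?thesis
          by (simp add: coeff_f coeff_F coeff_F_eq_0)
      qed
    qed
  qed
qed

section \<open>Signed orbits\<close>

lemma finite_Omega [simp]: "finite (Omega n)"
  by (simp add: Omega_def)

lemma mem_Omega_iff: "x \<in> Omega n \<longleftrightarrow> x \<noteq> 0 \<and> \<bar>x\<bar> \<le> int n"
  by (auto simp: Omega_def)

lemma uminus_mem_Omega_iff [simp]: "- x \<in> Omega n \<longleftrightarrow> x \<in> Omega n"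
  by (simp add: mem_Omega_iff)

lemma card_Omega: "card (Omega n) = 2 * n"
  by (simp add: Omega_def card_Diff_singleton_if)

lemma signed_perms_permutes: "w \<in> signed_perms n \<Longrightarrow> w permutes Omega n"
  by (simp add: signed_perms_def)

lemma signed_perms_uminus: "w \<in> signed_perms n \<Longrightarrow> w (- x) = - w x"
  by (cases "x \<in> Omega n") (auto simp: signed_perms_def permutes_not_in)

lemma signed_permsI: "w permutes Omega n \<Longrightarrow> (\<And>x. w (- x) = - w x) \<Longrightarrow> w \<in> signed_perms n"
  by (simp add: signed_perms_def)

lemma finite_signed_perms: "finite (signed_perms n)"
  unfolding signed_perms_def by (rule finite_subset[OF _ finite_permutations[OF finite_Omega[of n]]]) auto

lemma id_in_signed_perms: "id \<in> signed_perms n"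
  by (rule signed_permsI) (auto simp: permutes_id)

lemma comp_in_signed_perms: "v \<in> signed_perms n \<Longrightarrow> w \<in> signed_perms n \<Longrightarrow> v \<circ> w \<in> signed_perms n"
  by (rule signed_permsI) (auto intro: permutes_compose signed_perms_permutes simp: signed_perms_uminus)

lemma inv_in_signed_perms:
  assumes "w \<in> signed_perms n"
  shows "inv_into UNIV w \<in> signed_perms n"
proof (rule signed_permsI)
  note w = signed_perms_permutes[OF assms]
  show "inv_into UNIV w permutes Omega n" using w by (rule permutes_inv)
  show "inv_into UNIV w (- x) = - inv_into UNIV w x" for x
  proof -
    have "w (- inv_into UNIV w x) = - x"
      by (simp add: signed_perms_uminus[OF assms] permutes_inverses(1)[OF w])
    then show ?thesis by (metis permutes_inverses(2)[OF w])
  qed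
qed

lemma signed_perms_mono:
  assumes "w \<in> signed_perms m" and "m \<le> n"
  shows "w \<in> signed_perms n"
proof (rule signed_permsI)
  show "w permutes Omega n"
    using signed_perms_permutes[OF assms(1)] by (rule permutes_subset) (use assms(2) in \<open>auto simp: Omega_def\<close>)
qed (rule signed_perms_uminus[OF assms(1)])

lemma funpow_uminus: "w \<in> signed_perms n \<Longrightarrow> (w ^^ j) (- x) = - (w ^^ j) x"
  by (induction j) (auto simp: signed_perms_uminus)

lemma funpow_mem_Omega_iff: "w \<in> signed_perms n \<Longrightarrow> (w ^^ j) x \<in> Omega n \<longleftrightarrow> x \<in> Omega n"
  by (induction j) (auto simp: permutes_in_image[OF signed_perms_permutes])

lemma funpow_eq_iff: "w \<in> signed_perms n \<Longrightarrow> (w ^^ j) x = (w ^^ j) y \<longleftrightarrow> x = y"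
  using inj_fn[OF permutes_inj[OF signed_perms_permutes], of w n j] by (auto dest: injD)

text \<open>For a signed permutation this is the orbit under the group generated by \<open>w\<close>
  and negation. It merges a positive cycle with its conjugate and leaves a negative cycle as it is,
  so that both kinds have \<open>2 * k\<close> points when the cycle has length
  \<open>k\<close>.\<close>

definition signed_orbit :: "(int \<Rightarrow> int) \<Rightarrow> int \<Rightarrow> int set" where
  "signed_orbit w x = {y. \<exists>j. y = (w ^^ j) x \<or> y = - (w ^^ j) x}"

definition signed_orbits :: "nat \<Rightarrow> (int \<Rightarrow> int) \<Rightarrow> int set set" where
  "signed_orbits n w = signed_orbit w ` Omega n"

text \<open>Length and sign of the cycle through \<open>x\<close>, read off from the first return to
  \<open>{x, - x}\<close>. On a negative cycle this return happens halfway round, in agreement with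
  the length convention for negative cycles.\<close>

definition point_type :: "(int \<Rightarrow> int) \<Rightarrow> int \<Rightarrow> nat \<times> sign" where
  "point_type w x =
     (let k = LEAST k. 0 < k \<and> ((w ^^ k) x = x \<or> (w ^^ k) x = - x)
      in (k, if (w ^^ k) x = x then Plus else Minus))"

definition sign_int :: "sign \<Rightarrow> int" where
  "sign_int e = (case e of Plus \<Rightarrow> 1 | Minus \<Rightarrow> - 1)"

lemma self_in_signed_orbit: "x \<in> signed_orbit w x"
  unfolding signed_orbit_def by (rule CollectI, rule exI[of _ 0]) simp

lemma funpow_returns:
  assumes "w \<in> signed_perms n"
  obtains k where "0 < k" "(w ^^ k) x = x"
proof -
  have "permutation w"
    using signed_perms_permutes[OF assms] finite_Omega unfolding permutation_permutes by blast
  then have "x \<in> orbit w x" by (rule permutation_self_in_orbit)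
  then show ?thesis using that by (auto simp: orbit_altdef)
qed

lemma point_type_props:
  assumes "w \<in> signed_perms n" and "point_type w x = (k, e)"
  shows "0 < k" and "(w ^^ k) x = sign_int e * x"
    and "\<And>j. 0 < j \<Longrightarrow> j < k \<Longrightarrow> (w ^^ j) x \<noteq> x \<and> (w ^^ j) x \<noteq> - x"
proof -
  let ?P = "\<lambda>k. 0 < k \<and> ((w ^^ k) x = x \<or> (w ^^ k) x = - x)"
  have k: "k = (LEAST k. ?P k)" and e: "e = (if (w ^^ k) x = x then Plus else Minus)"
    using assms(2) by (auto simp: point_type_def Let_def)
  obtain m where "0 < m" "(w ^^ m) x = x" using funpow_returns[OF assms(1)] .
  then have "?P m" by simp
  then have P: "?P k" unfolding k by (rule LeastI)
  then show "0 < k" by simp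
  show "(w ^^ k) x = sign_int e * x" using P by (auto simp: e sign_int_def)
  show "(w ^^ j) x \<noteq> x \<and> (w ^^ j) x \<noteq> - x" if "0 < j" "j < k" for j
    using not_less_Least[of j ?P] that unfolding k by blast
qed

lemma point_type_eqI:
  assumes "x \<noteq> 0" and "0 < k" and "(w ^^ k) x = sign_int e * x"
    and "\<And>j. 0 < j \<Longrightarrow> j < k \<Longrightarrow> (w ^^ j) x \<noteq> x \<and> (w ^^ j) x \<noteq> - x"
  shows "point_type w x = (k, e)"
proof -
  have "(LEAST k. 0 < k \<and> ((w ^^ k) x = x \<or> (w ^^ k) x = - x)) = k"
  proof (rule Least_equality)
    show "0 < k \<and> ((w ^^ k) x = x \<or> (w ^^ k) x = - x)"
      using assms(2,3) by (cases e) (auto simp: sign_int_def)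
    show "k \<le> j" if "0 < j \<and> ((w ^^ j) x = x \<or> (w ^^ j) x = - x)" for j
      using that assms(4)[of j] by force
  qed
  then show ?thesis
    using assms(1,3) by (cases e) (auto simp: point_type_def Let_def sign_int_def)
qed

text \<open>Division of \<open>j\<close> by \<open>k\<close> with remainder \<open>r\<close>, each
  completed round contributing a factor \<open>sign_int e\<close>. The clause tying
  \<open>s = - 1\<close> to \<open>e = Minus\<close> is what later shows that a positive cycle
  consists of the first \<open>k\<close> iterates only.\<close>

lemma funpow_reduce:
  assumes "w \<in> signed_perms n" and "point_type w x = (k, e)"
  shows "\<exists>s r. (s = 1 \<or> s = - 1 \<and> e = Minus) \<and> r < k \<and> (w ^^ j) x = s * (w ^^ r) x"
proof (induction j)
  case 0
  then show ?case using point_type_props(1)[OF assms] by (intro exI[of _ 1] exI[of _ 0]) auto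
next
  case (Suc j)
  then obtain s r where s: "s = 1 \<or> s = - 1 \<and> e = Minus" and r: "r < k" and eq: "(w ^^ j) x = s * (w ^^ r) x"
    by blast
  have step: "(w ^^ Suc j) x = s * (w ^^ Suc r) x"
    using s by (auto simp: eq signed_perms_uminus[OF assms(1)])
  show ?case
  proof (cases "Suc r < k")
    case True
    with s step show ?thesis by blast
  next
    case False
    with r have "Suc r = k" by simp
    with step point_type_props(2)[OF assms] have "(w ^^ Suc j) x = (s * sign_int e) * (w ^^ 0) x"
      by (simp del: funpow.simps(2))
    moreover have "s * sign_int e = 1 \<or> s * sign_int e = - 1 \<and> e = Minus"
      using s by (cases e) (auto simp: sign_int_def)
    ultimately show ?thesis using point_type_props(1)[OF assms] by blast
  qed
qed

lemma signed_orbit_eq_image: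
  assumes "w \<in> signed_perms n" and "point_type w x = (k, e)"
  shows "signed_orbit w x = (\<lambda>(j, s). s * (w ^^ j) x) ` ({..<k} \<times> {1, - 1})"
proof (intro equalityI subsetI)
  fix y assume "y \<in> signed_orbit w x"
  then obtain j where j: "y = (w ^^ j) x \<or> y = - (w ^^ j) x" by (auto simp: signed_orbit_def)
  obtain s r where s: "s = 1 \<or> s = - 1" and r: "r < k" and eq: "(w ^^ j) x = s * (w ^^ r) x"
    using funpow_reduce[OF assms, of j] by blast
  have "y = s * (w ^^ r) x \<or> y = - s * (w ^^ r) x" using j eq by auto
  then obtain s' where "y = s' * (w ^^ r) x" "s' \<in> {1, - 1}" using s by fastforce
  with r show "y \<in> (\<lambda>(j, s). s * (w ^^ j) x) ` ({..<k} \<times> {1, - 1})"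
    by (intro image_eqI[of _ _ "(r, s')"]) auto
next
  fix y assume "y \<in> (\<lambda>(j, s). s * (w ^^ j) x) ` ({..<k} \<times> {1, - 1})"
  then obtain j s where "y = s * (w ^^ j) x" "s \<in> {1, - 1}" by auto
  then have "y = (w ^^ j) x \<or> y = - (w ^^ j) x" by auto
  then show "y \<in> signed_orbit w x" unfolding signed_orbit_def by blast
qed

text \<open>Cancelling \<open>w ^^ i\<close> turns a coincidence into a return to
  \<open>{x, - x}\<close> after \<open>j - i < k\<close> steps, which the minimality of
  \<open>k\<close> excludes unless \<open>i = j\<close>.\<close>

lemma signed_orbit_inj:
  assumes w: "w \<in> signed_perms n" and ty: "point_type w x = (k, e)" and x: "x \<noteq> 0"
    and "i < k" "j < k" "s \<in> {1, - 1}" "t \<in> {1, - 1}"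
    and "s * (w ^^ i) x = t * (w ^^ j) x"
  shows "i = j \<and> s = t"
proof -
  have main: "i = j \<and> s = t"
    if ij: "i \<le> j" "j < k" and st: "s \<in> {1, - 1}" "t \<in> {1, - 1 :: int}"
      and eq: "s * (w ^^ i) x = t * (w ^^ j) x" for i j s t
  proof -
    have sx: "(w ^^ i) (s * x) = s * (w ^^ i) x" for x
      using st(1) by (auto simp: funpow_uminus[OF w])
    have tx: "(w ^^ i) (t * x) = t * (w ^^ i) x" for x
      using st(2) by (auto simp: funpow_uminus[OF w])
    have "(w ^^ i) ((w ^^ (j - i)) x) = (w ^^ j) x"
      using ij(1) by (metis comp_apply funpow_add le_add_diff_inverse)
    then have "(w ^^ i) (s * x) = (w ^^ i) (t * (w ^^ (j - i)) x)"
      by (simp only: sx tx eq)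
    then have "s * x = t * (w ^^ (j - i)) x" by (simp only: funpow_eq_iff[OF w])
    then have "(w ^^ (j - i)) x = x \<or> (w ^^ (j - i)) x = - x" and st': "j = i \<Longrightarrow> s = t"
      using st x by auto
    moreover have "j - i < k" using ij by simp
    ultimately have "\<not> 0 < j - i" using point_type_props(3)[OF w ty, of "j - i"] by blast
    then show ?thesis using ij st' by simp
  qed
  show ?thesis
  proof (cases "i \<le> j")
    case True
    then show ?thesis using main[of i j s t] assms by simp
  next
    case False
    then show ?thesis using main[of j i t s] assms by simp
  qed
qed

lemma card_signed_orbit:
  assumes "w \<in> signed_perms n" and "point_type w x = (k, e)" and "x \<noteq> 0"
  shows "card (signed_orbit w x) = 2 * k"
proof -
  have "inj_on (\<lambda>(j, s). s * (w ^^ j) x) ({..<k} \<times> {1, - 1})"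
    using signed_orbit_inj[OF assms] by (fastforce intro!: inj_onI)
  then have "card (signed_orbit w x) = card ({..<k} \<times> {1, - 1 :: int})"
    unfolding signed_orbit_eq_image[OF assms(1,2)] by (rule card_image)
  then show ?thesis by (simp add: card_cartesian_product)
qed

lemma signed_orbit_subset_Omega:
  assumes "w \<in> signed_perms n" and "x \<in> Omega n"
  shows "signed_orbit w x \<subseteq> Omega n"
  using assms by (auto simp: signed_orbit_def funpow_mem_Omega_iff)

lemma point_type_signed_orbit:
  assumes w: "w \<in> signed_perms n" and y: "y \<in> signed_orbit w x"
  shows "point_type w y = point_type w x"
proof -
  obtain i where i: "y = (w ^^ i) x \<or> y = - (w ^^ i) x" using y by (auto simp: signed_orbit_def)
  have comm: "(w ^^ j) ((w ^^ i) x) = (w ^^ i) ((w ^^ j) x)" for j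
    by (metis add.commute comp_apply funpow_add)
  have eq: "(w ^^ j) ((w ^^ i) x) = (w ^^ i) x \<longleftrightarrow> (w ^^ j) x = x" for j
    by (simp only: comm funpow_eq_iff[OF w])
  have neg: "(w ^^ j) ((w ^^ i) x) = - (w ^^ i) x \<longleftrightarrow> (w ^^ j) x = - x" for j
    by (simp only: comm funpow_eq_iff[OF w] funpow_uminus[OF w, symmetric])
  from i have "(w ^^ j) y = y \<longleftrightarrow> (w ^^ j) x = x" "(w ^^ j) y = - y \<longleftrightarrow> (w ^^ j) x = - x" for j
    by (elim disjE; simp only: funpow_uminus[OF w] neg_equal_iff_equal eq neg)+
  then show ?thesis by (simp only: point_type_def)
qed

lemma signed_orbit_eqI:
  assumes w: "w \<in> signed_perms n" and x: "x \<in> Omega n" and y: "y \<in> signed_orbit w x"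
  shows "signed_orbit w y = signed_orbit w x"
proof -
  obtain i where i: "y = (w ^^ i) x \<or> y = - (w ^^ i) x" using y by (auto simp: signed_orbit_def)
  have comp: "(w ^^ j) ((w ^^ i) x) = (w ^^ (j + i)) x" for j
    by (simp add: funpow_add)
  have sub: "signed_orbit w y \<subseteq> signed_orbit w x"
  proof
    fix z assume "z \<in> signed_orbit w y"
    then obtain j where "z = (w ^^ j) y \<or> z = - (w ^^ j) y" by (auto simp: signed_orbit_def)
    then have "z = (w ^^ (j + i)) x \<or> z = - (w ^^ (j + i)) x"
      using i by (auto simp: comp funpow_uminus[OF w])
    then show "z \<in> signed_orbit w x" unfolding signed_orbit_def by blast
  qed
  \<comment> \<open>Points of one signed orbit have the same type, so both orbits have
    \<open>2 * k\<close> elements and the inclusion is an equality.\<close>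
  obtain k e where ty: "point_type w x = (k, e)" by force
  have "y \<in> Omega n" using signed_orbit_subset_Omega[OF w x] y by blast
  then have "card (signed_orbit w y) = 2 * k"
    using ty point_type_signed_orbit[OF w y] by (intro card_signed_orbit[OF w]) (auto simp: mem_Omega_iff)
  moreover have "card (signed_orbit w x) = 2 * k"
    using card_signed_orbit[OF w ty] x by (auto simp: mem_Omega_iff)
  moreover have "finite (signed_orbit w x)"
    using signed_orbit_subset_Omega[OF w x] finite_Omega finite_subset by blast
  ultimately show ?thesis using sub by (intro card_subset_eq) auto
qed

text \<open>On a signed orbit the choice does not matter, since \<open>point_type\<close> is
  constant there.\<close>

definition orbit_type :: "(int \<Rightarrow> int) \<Rightarrow> int set \<Rightarrow> nat \<times> sign" where
  "orbit_type w d = point_type w (SOME x. x \<in> d)"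

lemma signed_orbitsD:
  assumes w: "w \<in> signed_perms n" and d: "d \<in> signed_orbits n w" and x: "x \<in> d"
  shows "x \<in> Omega n" and "d = signed_orbit w x" and "point_type w x = orbit_type w d"
    and "card d = 2 * fst (orbit_type w d)" and "0 < fst (orbit_type w d)"
proof -
  from d obtain y where y: "y \<in> Omega n" "d = signed_orbit w y" by (auto simp: signed_orbits_def)
  have ty: "point_type w z = point_type w y" if "z \<in> d" for z
    using that point_type_signed_orbit[OF w] y by blast
  show "x \<in> Omega n" using x y signed_orbit_subset_Omega[OF w] by blast
  show "d = signed_orbit w x" using signed_orbit_eqI[OF w y(1)] x y(2) by blast
  have "(SOME x. x \<in> d) \<in> d" using x by (rule someI)
  then have oy: "orbit_type w d = point_type w y" unfolding orbit_type_def by (rule ty)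
  then show "point_type w x = orbit_type w d" using ty[OF x] by simp
  show "card d = 2 * fst (orbit_type w d)"
    using card_signed_orbit[OF w, of y] y oy by (cases "point_type w y") (auto simp: mem_Omega_iff)
  show "0 < fst (orbit_type w d)"
    using point_type_props(1)[OF w, of y] oy by (cases "point_type w y") auto
qed

lemma signed_orbits_nonempty: "d \<in> signed_orbits n w \<Longrightarrow> \<exists>x. x \<in> d"
  unfolding signed_orbits_def using self_in_signed_orbit by blast

lemma finite_signed_orbits [simp]: "finite (signed_orbits n w)"
  by (simp add: signed_orbits_def)

lemma finite_signed_orbits_elem: "w \<in> signed_perms n \<Longrightarrow> d \<in> signed_orbits n w \<Longrightarrow> finite d"
  using signed_orbitsD(1) finite_Omega[of n] by (meson finite_subset subsetI)

lemma orbit_type_pos: "w \<in> signed_perms n \<Longrightarrow> d \<in> signed_orbits n w \<Longrightarrow> 0 < fst (orbit_type w d)"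
  using signed_orbits_nonempty signed_orbitsD(5) by blast

text \<open>Counting \<open>Omega n\<close> by signed orbits expresses \<open>2 * n\<close> as a sum
  of the numbers \<open>2 * k\<close>.\<close>

lemma sum_orbit_type:
  assumes w: "w \<in> signed_perms n"
  shows "(\<Sum>d\<in>signed_orbits n w. fst (orbit_type w d)) = n"
proof -
  have "\<Union> (signed_orbits n w) = Omega n"
  proof (intro equalityI subsetI)
    show "x \<in> Omega n" if "x \<in> \<Union> (signed_orbits n w)" for x
      using that signed_orbitsD(1)[OF w] by blast
    show "x \<in> \<Union> (signed_orbits n w)" if "x \<in> Omega n" for x
      using that self_in_signed_orbit unfolding signed_orbits_def by blast
  qed
  moreover have "card (\<Union> (signed_orbits n w)) = (\<Sum>d\<in>signed_orbits n w. card d)"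
  proof (rule card_Union_disjoint)
    show "pairwise disjnt (signed_orbits n w)"
    proof (rule pairwiseI)
      fix c d assume cd: "c \<in> signed_orbits n w" "d \<in> signed_orbits n w" "c \<noteq> d"
      show "disjnt c d"
        unfolding disjnt_iff using signed_orbitsD(2)[OF w cd(1)] signed_orbitsD(2)[OF w cd(2)] cd(3) by blast
    qed
  qed (rule finite_signed_orbits_elem[OF w])
  moreover have "(\<Sum>d\<in>signed_orbits n w. card d) = (\<Sum>d\<in>signed_orbits n w. 2 * fst (orbit_type w d))"
  proof (rule sum.cong)
    fix d assume d: "d \<in> signed_orbits n w"
    then obtain x where "x \<in> d" using signed_orbits_nonempty by blast
    from signed_orbitsD(4)[OF w d this] show "card d = 2 * fst (orbit_type w d)" .
  qed simp
  ultimately show ?thesis by (simp add: card_Omega flip: sum_distrib_left)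
qed

section \<open>Signed cycle types\<close>

text \<open>This map from multisets of signed parts to bipartitions is injective, so signed cycle
  types can be compared as multisets of orbit types.\<close>

definition split_by_sign :: "(nat \<times> sign) multiset \<Rightarrow> nat multiset \<times> nat multiset" where
  "split_by_sign \<mu> = (image_mset fst (filter_mset (\<lambda>p. snd p = Plus) \<mu>),
     image_mset fst (filter_mset (\<lambda>p. snd p = Minus) \<mu>))"

lemma bipartition_of_eq: "bipartition_of \<gamma> = split_by_sign (mset \<gamma>)"
  by (simp add: bipartition_of_def split_by_sign_def mset_filter)

lemma split_by_sign_inject: "split_by_sign \<mu> = split_by_sign \<nu> \<longleftrightarrow> \<mu> = \<nu>"
proof -
  define g where "g = (\<lambda>(\<alpha>, \<beta>). image_mset (\<lambda>k :: nat. (k, Plus)) \<alpha> + image_mset (\<lambda>k. (k, Minus)) \<beta>)"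
  have "g (split_by_sign \<mu>) = \<mu>" for \<mu>
  proof (induction \<mu>)
    case (add p \<mu>)
    then show ?case by (cases p, cases "snd p") (auto simp: g_def split_by_sign_def)
  qed (simp add: g_def split_by_sign_def)
  then show ?thesis by metis
qed

lemma power_sum_part_split_by_sign:
  "(case split_by_sign \<mu> of (\<alpha>, \<beta>) \<Rightarrow> power_sum_part Plus \<alpha> * power_sum_part Minus \<beta>) =
   (\<Prod>p\<in>#\<mu>. power_sum (snd p) (fst p))"
proof (induction \<mu>)
  case (add p \<mu>)
  then show ?case
    by (cases p, cases "snd p") (auto simp: split_by_sign_def power_sum_part_def mult_ac)
qed (simp add: split_by_sign_def power_sum_part_def)

lemma orbit_eq_funpow:
  assumes "w \<in> signed_perms n"
  shows "orbit w x = {(w ^^ j) x | j. True}"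
proof -
  obtain k where "0 < k" "(w ^^ k) x = x" using funpow_returns[OF assms] .
  then have "x \<in> orbit w x" unfolding orbit_altdef by (metis (mono_tags, lifting) mem_Collect_eq)
  then show ?thesis by (rule orbit_altdef_self_in)
qed

lemma orbit_funpow:
  assumes "w \<in> signed_perms n"
  shows "orbit w ((w ^^ j) x) = orbit w x"
proof -
  have "permutation w"
    using signed_perms_permutes[OF assms] finite_Omega unfolding permutation_permutes by blast
  then show ?thesis by (induction j) (auto simp: permutation_orbit_step)
qed

lemma orbit_uminus:
  assumes "w \<in> signed_perms n"
  shows "orbit w (- x) = uminus ` orbit w x"
  unfolding orbit_eq_funpow[OF assms] funpow_uminus[OF assms] by blast

lemma signed_orbit_eq_Un:
  assumes "w \<in> signed_perms n"
  shows "signed_orbit w x = orbit w x \<union> uminus ` orbit w x"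
  unfolding orbit_eq_funpow[OF assms] signed_orbit_def by blast

text \<open>A negative cycle reaches \<open>- x\<close> after \<open>k\<close> steps and hence
  equals its conjugate. A positive one consists of the \<open>k\<close> distinct points
  \<open>(w ^^ j) x\<close> with \<open>j < k\<close>, and \<open>- x\<close> is not among
  them.\<close>

lemma orbit_self_conjugate_iff:
  assumes w: "w \<in> signed_perms n" and x: "x \<in> Omega n" and ty: "point_type w x = (k, e)"
  shows "orbit w x = uminus ` orbit w x \<longleftrightarrow> e = Minus"
    and "e = Plus \<Longrightarrow> card (orbit w x) = k"
    and "e = Minus \<Longrightarrow> orbit w x = signed_orbit w x"
proof -
  have minus: "orbit w x = uminus ` orbit w x" if "e = Minus"
  proof -
    have "(w ^^ k) x = - x" using point_type_props(2)[OF w ty] that by (simp add: sign_int_def)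
    then show ?thesis using orbit_funpow[OF w, of k x] orbit_uminus[OF w, of x] by simp
  qed
  have plus: "orbit w x = (\<lambda>j. (w ^^ j) x) ` {..<k}" if "e = Plus"
  proof -
    have "(w ^^ j) x \<in> (\<lambda>j. (w ^^ j) x) ` {..<k}" for j
      using funpow_reduce[OF w ty, of j] that by auto
    then show ?thesis unfolding orbit_eq_funpow[OF w] by blast
  qed
  have x0: "x \<noteq> 0" using x by (simp add: mem_Omega_iff)
  show "card (orbit w x) = k" if "e = Plus"
  proof -
    have "inj_on (\<lambda>j. (w ^^ j) x) {..<k}"
      using signed_orbit_inj[OF w ty x0, where s = 1 and t = 1] by (intro inj_onI) auto
    then show ?thesis unfolding plus[OF that] by (simp add: card_image)
  qed
  show "orbit w x = uminus ` orbit w x \<longleftrightarrow> e = Minus"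
  proof
    assume eq: "orbit w x = uminus ` orbit w x"
    show "e = Minus"
    proof (rule ccontr)
      assume "e \<noteq> Minus"
      then have e: "e = Plus" by (cases e) auto
      have "- x \<in> orbit w x"
        using arg_cong[OF eq, of "\<lambda>A. - x \<in> A"] orbit_eq_funpow[OF w, of x]
        by (metis (mono_tags, lifting) funpow_0 imageI mem_Collect_eq)
      then obtain j where "j < k" "- x = (w ^^ j) x" unfolding plus[OF e] by auto
      with signed_orbit_inj[OF w ty x0, of 0 j "- 1" 1] show False by auto
    qed
  qed (rule minus)
  show "orbit w x = signed_orbit w x" if "e = Minus"
    unfolding signed_orbit_eq_Un[OF w] using minus[OF that] by blast
qed

text \<open>Negative cycles are the signed orbits of sign \<open>Minus\<close>, and the pairs of a
  positive cycle with its conjugate correspond to the signed orbits of sign \<open>Plus\<close> by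
  taking unions.\<close>

lemma signed_cycle_type_eq:
  assumes w: "w \<in> signed_perms n"
  shows "signed_cycle_type n w =
    split_by_sign (image_mset (orbit_type w) (mset_set (signed_orbits n w)))"
proof -
  let ?D = "\<lambda>e. {d \<in> signed_orbits n w. snd (orbit_type w d) = e}"
  have type: "point_type w x = orbit_type w (signed_orbit w x)" if "x \<in> Omega n" for x
    using that self_in_signed_orbit by (intro signed_orbitsD(3)[OF w]) (auto simp: signed_orbits_def)
  have types: "point_type w x = (fst (orbit_type w (signed_orbit w x)), snd (orbit_type w (signed_orbit w x)))"
    if "x \<in> Omega n" for x
    using type[OF that] by simp
  note self_conj = orbit_self_conjugate_iff[OF w _ types]
  have neg: "{c \<in> cycles n w. c = uminus ` c} = ?D Minus"
  proof (intro equalityI subsetI)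
    fix c assume "c \<in> {c \<in> cycles n w. c = uminus ` c}"
    then obtain x where x: "x \<in> Omega n" "c = orbit w x" "orbit w x = uminus ` orbit w x"
      unfolding cycles_def by blast
    from self_conj(1)[OF x(1) x(1)] x(3) have M: "snd (orbit_type w (signed_orbit w x)) = Minus" by blast
    from self_conj(3)[OF x(1) x(1) M] x(2) have "c = signed_orbit w x" by simp
    with x(1) M show "c \<in> ?D Minus" by (auto simp: signed_orbits_def)
  next
    fix c assume "c \<in> ?D Minus"
    then obtain x where x: "x \<in> Omega n" "c = signed_orbit w x" "snd (orbit_type w (signed_orbit w x)) = Minus"
      unfolding signed_orbits_def by blast
    from self_conj(1)[OF x(1) x(1)] self_conj(3)[OF x(1) x(1) x(3)] x
    show "c \<in> {c \<in> cycles n w. c = uminus ` c}"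
      unfolding cycles_def by blast
  qed
  have "negative_lengths n w = image_mset (\<lambda>d. fst (orbit_type w d)) (mset_set (?D Minus))"
    unfolding negative_lengths_def neg
  proof (rule image_mset_cong)
    fix d assume "d \<in># mset_set (?D Minus)"
    then have d: "d \<in> signed_orbits n w" by (simp add: signed_orbits_def)
    then obtain x where "x \<in> d" using signed_orbits_nonempty by blast
    from signed_orbitsD(4)[OF w d this] show "card d div 2 = fst (orbit_type w d)" by simp
  qed
  moreover have "positive_lengths n w = image_mset (\<lambda>d. fst (orbit_type w d)) (mset_set (?D Plus))"
  proof -
    let ?A = "{{c, uminus ` c} | c. c \<in> cycles n w \<and> c \<noteq> uminus ` c}"
    have A: "\<exists>x\<in>Omega n. P = {orbit w x, uminus ` orbit w x} \<and> \<Union> P = signed_orbit w x \<and>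
        snd (orbit_type w (signed_orbit w x)) = Plus" if "P \<in> ?A" for P
    proof -
      from that obtain x where x: "x \<in> Omega n" "P = {orbit w x, uminus ` orbit w x}"
        "orbit w x \<noteq> uminus ` orbit w x"
        unfolding cycles_def by blast
      moreover have "\<Union> P = signed_orbit w x" unfolding x(2) signed_orbit_eq_Un[OF w] by simp
      moreover have "snd (orbit_type w (signed_orbit w x)) = Plus"
        using self_conj(1)[OF x(1) x(1)] x(3) by (metis (full_types) sign.exhaust)
      ultimately show ?thesis by blast
    qed
    have bij: "bij_betw Union ?A (?D Plus)"
    proof (rule bij_betw_imageI)
      show "inj_on Union ?A"
      proof (rule inj_onI)
        fix P Q assume "P \<in> ?A" "Q \<in> ?A" and eq: "\<Union> P = \<Union> Q"
        then obtain x y where x: "P = {orbit w x, uminus ` orbit w x}" "\<Union> P = signed_orbit w x"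
          and y: "Q = {orbit w y, uminus ` orbit w y}" "\<Union> Q = signed_orbit w y"
          using A by meson
        \<comment> \<open>Equal unions put \<open>y\<close> on the cycle of \<open>x\<close> or on
          its conjugate, so both pairs consist of the same two cycles.\<close>
        have "y \<in> signed_orbit w x" using self_in_signed_orbit[of y w] eq x(2) y(2) by simp
        then obtain j where "y = (w ^^ j) x \<or> y = - (w ^^ j) x" by (auto simp: signed_orbit_def)
        then have "orbit w y = orbit w x \<or> orbit w y = uminus ` orbit w x"
          using orbit_funpow[OF w, of j x] orbit_uminus[OF w, of "(w ^^ j) x"] by auto
        moreover have "uminus ` uminus ` orbit w x = orbit w x" by (simp add: image_image)
        ultimately show "P = Q" unfolding x(1) y(1) by (metis insert_commute)
      qed
      show "Union ` ?A = ?D Plus"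
      proof (intro equalityI subsetI)
        fix d assume "d \<in> Union ` ?A"
        then obtain P where P: "P \<in> ?A" "d = \<Union> P" by (elim imageE)
        from A[OF P(1)] obtain x where "x \<in> Omega n" "\<Union> P = signed_orbit w x"
          "snd (orbit_type w (signed_orbit w x)) = Plus" by (elim bexE conjE)
        then show "d \<in> ?D Plus" by (simp add: P(2) signed_orbits_def)
      next
        fix d assume "d \<in> ?D Plus"
        then obtain x where x: "x \<in> Omega n" "d = signed_orbit w x" "snd (orbit_type w (signed_orbit w x)) = Plus"
          unfolding signed_orbits_def by blast
        from self_conj(1)[OF x(1) x(1)] x(3) have "orbit w x \<noteq> uminus ` orbit w x" by simp
        then have "{orbit w x, uminus ` orbit w x} \<in> ?A" using x(1) unfolding cycles_def by blast
        moreover have "d = \<Union> {orbit w x, uminus ` orbit w x}"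
          unfolding x(2) signed_orbit_eq_Un[OF w] by simp
        ultimately show "d \<in> Union ` ?A" by (rule rev_image_eqI)
      qed
    qed
    have "mset_set (?D Plus) = image_mset Union (mset_set ?A)"
      using image_mset_mset_set[OF bij_betw_imp_inj_on[OF bij]] bij_betw_imp_surj_on[OF bij] by simp
    then have "image_mset (\<lambda>d. fst (orbit_type w d)) (mset_set (?D Plus)) =
        image_mset (\<lambda>P. fst (orbit_type w (\<Union> P))) (mset_set ?A)"
      by (simp add: multiset.map_comp o_def)
    also have "\<dots> = positive_lengths n w"
      unfolding positive_lengths_def
    proof (rule image_mset_cong)
      fix P assume "P \<in># mset_set ?A"
      moreover have "finite ?A" using bij_betw_finite[OF bij] by simp
      ultimately have "P \<in> ?A" by (simp only: elem_mset_set)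
      from A[OF this] obtain x where x: "x \<in> Omega n" "P = {orbit w x, uminus ` orbit w x}"
        "\<Union> P = signed_orbit w x" "snd (orbit_type w (signed_orbit w x)) = Plus"
        by (elim bexE conjE)
      have "card (uminus ` orbit w x) = card (orbit w x)" by (intro card_image inj_onI) simp
      then have "the_elem (card ` P) = card (orbit w x)" unfolding x(2) by simp
      also have "\<dots> = fst (orbit_type w (signed_orbit w x))" by (rule self_conj(2)[OF x(1) x(1) x(4)])
      finally show "fst (orbit_type w (\<Union> P)) = the_elem (card ` P)" unfolding x(3) by simp
    qed
    finally show ?thesis by (rule sym)
  qed
  moreover have "image_mset fst (filter_mset (\<lambda>p. snd p = e) (image_mset (orbit_type w) (mset_set (signed_orbits n w)))) =
      image_mset (\<lambda>d. fst (orbit_type w d)) (mset_set (?D e))" for e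
    by (simp add: multiset.map_comp o_def flip: image_mset_filter_mset_swap)
  ultimately show ?thesis
    by (simp add: signed_cycle_type_def split_by_sign_def)
qed

lemma power_sum_parts_of_signed_cycle_type:
  assumes "w \<in> signed_perms n"
  shows "(case signed_cycle_type n w of (\<alpha>, \<beta>) \<Rightarrow> power_sum_part Plus \<alpha> * power_sum_part Minus \<beta>) =
    power_sum_prod (orbit_type w) (signed_orbits n w)"
  unfolding signed_cycle_type_eq[OF assms] power_sum_part_split_by_sign power_sum_prod_def
  by (simp add: prod_unfold_prod_mset multiset.map_comp o_def)

section \<open>Conjugacy in the hyperoctahedral group\<close>

text \<open>A cycle notation of \<open>w\<close> on \<open>D\<close>: the cycles appear in the order
  prescribed by \<gamma>, each written from its listed point. For a positive pair this point also
  decides which of the two conjugate cycles is written.\<close>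

definition base_lists ::
    "(int \<Rightarrow> int) \<Rightarrow> signed_composition \<Rightarrow> int set set \<Rightarrow> int list set" where
  "base_lists w \<gamma> D = {b. distinct (map (signed_orbit w) b) \<and> set (map (signed_orbit w) b) = D \<and>
     map (point_type w) b = \<gamma>}"

text \<open>Both sides satisfy the same recursion: the first entry of a list is one of the
  \<open>2 * k\<close> points of a signed orbit \<open>d\<close> of type \<open>(k, e)\<close>, and
  the rest is a base list for \<open>D - {d}\<close>.\<close>

lemma weight_functional_eq_card_base_lists:
  assumes w: "w \<in> signed_perms n" and "D \<subseteq> signed_orbits n w" and "\<forall>p\<in>set \<gamma>. 0 < fst p"
  shows "finite (base_lists w \<gamma> D) \<and>
    weight_functional \<gamma> (\<lambda>\<tau>. coloring_sum (orbit_type w) \<tau> D) = of_nat (card (base_lists w \<gamma> D))"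
  using assms(2,3)
proof (induction \<gamma> arbitrary: D)
  case Nil
  have "base_lists w [] D = (if D = {} then {[]} else {})"
    by (auto simp: base_lists_def)
  then show ?case by simp
next
  case (Cons p \<gamma>)
  obtain k e where p: "p = (k, e)" by force
  define T where "T = {d \<in> D. orbit_type w d = (k, e)}"
  have k: "0 < k" using Cons.prems p by simp
  have finD: "finite D" using Cons.prems(1) finite_signed_orbits finite_subset by blast
  have TD: "d \<in> D" "d \<in> signed_orbits n w" "orbit_type w d = (k, e)" if "d \<in> T" for d
    using that Cons.prems(1) by (auto simp: T_def)
  have orbit: "signed_orbit w x = d" if "d \<in> T" "x \<in> d" for d x
    using signed_orbitsD(2)[OF w TD(2)[OF that(1)] that(2)] by simp
  have IH: "finite (base_lists w \<gamma> (D - {d}))"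
    "weight_functional \<gamma> (\<lambda>\<tau>. coloring_sum (orbit_type w) \<tau> (D - {d})) = of_nat (card (base_lists w \<gamma> (D - {d})))"
    for d
    using Cons.IH[of "D - {d}"] Cons.prems by auto
  let ?\<Sigma> = "SIGMA x:\<Union> T. base_lists w \<gamma> (D - {signed_orbit w x})"
  have eq: "base_lists w (p # \<gamma>) D = (\<lambda>(x, b). x # b) ` ?\<Sigma>"
  proof (intro equalityI subsetI)
    fix c assume c: "c \<in> base_lists w (p # \<gamma>) D"
    then obtain x b where xb: "c = x # b" by (cases c) (auto simp: base_lists_def)
    with c have D: "D = insert (signed_orbit w x) (signed_orbit w ` set b)" "signed_orbit w x \<notin> signed_orbit w ` set b"
      and b: "distinct (map (signed_orbit w) b)" "map (point_type w) b = \<gamma>" "point_type w x = (k, e)"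
      by (auto simp: base_lists_def p)
    from D(1) have xD: "signed_orbit w x \<in> D" by blast
    have "D - {signed_orbit w x} = signed_orbit w ` set b" using D by blast
    with b have "b \<in> base_lists w \<gamma> (D - {signed_orbit w x})" by (simp add: base_lists_def)
    moreover have "orbit_type w (signed_orbit w x) = (k, e)"
      using signed_orbitsD(3)[OF w subsetD[OF Cons.prems(1) xD] self_in_signed_orbit] b(3) by simp
    then have "x \<in> \<Union> T" using xD self_in_signed_orbit unfolding T_def by blast
    ultimately show "c \<in> (\<lambda>(x, b). x # b) ` ?\<Sigma>" unfolding xb by (intro image_eqI[of _ _ "(x, b)"]) auto
  next
    fix c assume "c \<in> (\<lambda>(x, b). x # b) ` ?\<Sigma>"
    then obtain x b d where c: "c = x # b" "d \<in> T" "x \<in> d" and b: "b \<in> base_lists w \<gamma> (D - {signed_orbit w x})"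
      by auto
    have d: "signed_orbit w x = d" using orbit[OF c(2,3)] .
    have ty: "point_type w x = (k, e)"
      using signed_orbitsD(3)[OF w TD(2)[OF c(2)] c(3)] TD(3)[OF c(2)] by simp
    have "set (map (signed_orbit w) b) = D - {d}" "distinct (map (signed_orbit w) b)" "map (point_type w) b = \<gamma>"
      using b unfolding base_lists_def d by blast+
    moreover have "insert d (D - {d}) = D" using TD(1)[OF c(2)] by blast
    ultimately show "c \<in> base_lists w (p # \<gamma>) D"
      by (simp add: base_lists_def c(1) p ty d)
  qed
  have finT: "finite T" "\<forall>d\<in>T. finite d"
    using finD finite_signed_orbits_elem[OF w] TD(2) by (auto simp: T_def)
  have finS: "finite ?\<Sigma>"
    using finT IH(1) by (intro finite_SigmaI) auto
  have "card (base_lists w (p # \<gamma>) D) = card ?\<Sigma>"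
    unfolding eq by (rule card_image) (auto intro!: inj_onI)
  also have "\<dots> = (\<Sum>x\<in>\<Union> T. card (base_lists w \<gamma> (D - {signed_orbit w x})))"
    using finT IH(1) by (intro card_SigmaI) auto
  also have "\<dots> = (\<Sum>d\<in>T. \<Sum>x\<in>d. card (base_lists w \<gamma> (D - {signed_orbit w x})))"
  proof (rule sum.Union_disjoint[unfolded comp_def])
    show "\<forall>c\<in>T. \<forall>d\<in>T. c \<noteq> d \<longrightarrow> c \<inter> d = {}" using orbit by blast
  qed (use finT in blast)
  also have "\<dots> = (\<Sum>d\<in>T. 2 * k * card (base_lists w \<gamma> (D - {d})))"
  proof (rule sum.cong)
    fix d assume d: "d \<in> T"
    obtain x where "x \<in> d" using signed_orbits_nonempty[OF TD(2)[OF d]] by blast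
    from signed_orbitsD(4)[OF w TD(2)[OF d] this] have "card d = 2 * k" using TD(3)[OF d] by simp
    moreover have "(\<Sum>x\<in>d. card (base_lists w \<gamma> (D - {signed_orbit w x}))) = (\<Sum>x\<in>d. card (base_lists w \<gamma> (D - {d})))"
      by (rule sum.cong) (simp_all add: orbit[OF d])
    ultimately show "(\<Sum>x\<in>d. card (base_lists w \<gamma> (D - {signed_orbit w x}))) = 2 * k * card (base_lists w \<gamma> (D - {d}))"
      by simp
  qed simp
  finally have card: "card (base_lists w (p # \<gamma>) D) = (\<Sum>d\<in>T. 2 * k * card (base_lists w \<gamma> (D - {d})))" .
  have "weight_functional (p # \<gamma>) (\<lambda>\<tau>. coloring_sum (orbit_type w) \<tau> D) =
      (\<Sum>d\<in>T. 2 * of_nat k * weight_functional \<gamma> (\<lambda>\<tau>. coloring_sum (orbit_type w) \<tau> (D - {d})))"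
    unfolding p T_def using k finD Cons.prems(1) orbit_type_pos[OF w]
    by (intro weight_functional_coloring_sum_Cons) auto
  then have "weight_functional (p # \<gamma>) (\<lambda>\<tau>. coloring_sum (orbit_type w) \<tau> D) = of_nat (card (base_lists w (p # \<gamma>) D))"
    by (simp add: card IH(2))
  moreover have "finite (base_lists w (p # \<gamma>) D)" unfolding eq using finS by (rule finite_imageI)
  ultimately show ?case by blast
qed

lemma conjugate_funpow:
  assumes "u \<in> signed_perms n"
  shows "((u \<circ> w \<circ> inv_into UNIV u) ^^ j) (u x) = u ((w ^^ j) x)"
  by (induction j) (simp_all add: permutes_inverses(2)[OF signed_perms_permutes[OF assms]])

lemma signed_perms_eq_iff: "u \<in> signed_perms n \<Longrightarrow> u x = u y \<longleftrightarrow> x = y"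
  using permutes_inj[OF signed_perms_permutes] by (auto dest: injD)

lemma signed_orbit_conjugate:
  assumes "u \<in> signed_perms n"
  shows "signed_orbit (u \<circ> w \<circ> inv_into UNIV u) (u x) = u ` signed_orbit w x"
proof -
  have "signed_orbit (u \<circ> w \<circ> inv_into UNIV u) (u x) = {y. \<exists>j. y = u ((w ^^ j) x) \<or> y = u (- (w ^^ j) x)}"
    by (simp only: signed_orbit_def conjugate_funpow[OF assms] signed_perms_uminus[OF assms])
  also have "\<dots> = u ` signed_orbit w x" unfolding signed_orbit_def by blast
  finally show ?thesis .
qed

lemma point_type_conjugate:
  assumes "u \<in> signed_perms n"
  shows "point_type (u \<circ> w \<circ> inv_into UNIV u) (u x) = point_type w x"
proof -
  have "u y = - u x \<longleftrightarrow> y = - x" for y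
    using signed_perms_eq_iff[OF assms, of y "- x"] signed_perms_uminus[OF assms, of x] by simp
  then show ?thesis
    by (simp only: point_type_def conjugate_funpow[OF assms] signed_perms_eq_iff[OF assms])
qed

lemma base_lists_conjugate:
  assumes u: "u \<in> signed_perms n" and b: "b \<in> base_lists w \<gamma> (signed_orbits n w)"
  shows "map u b \<in> base_lists (u \<circ> w \<circ> inv_into UNIV u) \<gamma> (signed_orbits n (u \<circ> w \<circ> inv_into UNIV u))"
proof -
  let ?w = "u \<circ> w \<circ> inv_into UNIV u"
  have b': "distinct (map (signed_orbit w) b)" "signed_orbit w ` set b = signed_orbits n w"
    "map (point_type w) b = \<gamma>"
    using b by (auto simp: base_lists_def)
  have map: "map (signed_orbit ?w) (map u b) = map ((`) u) (map (signed_orbit w) b)"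
    unfolding map_map o_def[of "signed_orbit ?w"] signed_orbit_conjugate[OF u] by (simp add: o_def)
  have "inj u" using permutes_inj[OF signed_perms_permutes[OF u]] .
  then have "inj ((`) u)" by (simp add: inj_image_eq_iff inj_def)
  then have "distinct (map (signed_orbit ?w) (map u b))"
    unfolding map using b'(1) by (metis distinct_map inj_on_subset subset_UNIV)
  moreover have "signed_orbits n ?w = (`) u ` signed_orbits n w"
  proof -
    have "signed_orbits n ?w = signed_orbit ?w ` u ` Omega n"
      unfolding signed_orbits_def permutes_image[OF signed_perms_permutes[OF u]] ..
    then show ?thesis by (simp add: image_image signed_orbit_conjugate[OF u] signed_orbits_def del: comp_apply)
  qed
  then have "set (map (signed_orbit ?w) (map u b)) = signed_orbits n ?w"
    unfolding map using b'(2) by (simp del: map_map)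
  moreover have "map (point_type ?w) (map u b) = \<gamma>"
    unfolding map_map o_def[of "point_type ?w"] point_type_conjugate[OF u] using b'(3) by (simp add: o_def)
  ultimately show ?thesis unfolding base_lists_def by blast
qed

section \<open>Simply transitive action on cycle notations\<close>

definition frame_indices :: "signed_composition \<Rightarrow> (nat \<times> nat \<times> int) set" where
  "frame_indices \<gamma> = {(i, j, s). i < length \<gamma> \<and> j < fst (\<gamma> ! i) \<and> s \<in> {1, - 1}}"

text \<open>Coordinates on \<open>Omega n\<close> given by a cycle notation: number of the cycle,
  steps from its base point, sign. The index set depends on \<gamma> only, so the frames of
  different signed permutations can be matched.\<close>

definition frame :: "(int \<Rightarrow> int) \<Rightarrow> int list \<Rightarrow> nat \<times> nat \<times> int \<Rightarrow> int" where
  "frame w b = (\<lambda>(i, j, s). s * (w ^^ j) (b ! i))"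

lemma base_listsD:
  assumes w: "w \<in> signed_perms n" and b: "b \<in> base_lists w \<gamma> (signed_orbits n w)" and i: "i < length \<gamma>"
  shows "length b = length \<gamma>" and "point_type w (b ! i) = \<gamma> ! i" and "b ! i \<in> Omega n"
proof -
  from b have b': "map (point_type w) b = \<gamma>" "set (map (signed_orbit w) b) = signed_orbits n w"
    unfolding base_lists_def by blast+
  from b'(1) show len: "length b = length \<gamma>" by (metis length_map)
  from b'(1) i len show "point_type w (b ! i) = \<gamma> ! i" by (metis nth_map)
  have "signed_orbit w (b ! i) \<in> signed_orbits n w" using b'(2) i len by auto
  then show "b ! i \<in> Omega n" by (rule signed_orbitsD(1)[OF w _ self_in_signed_orbit])
qed

text \<open>The base points lie on different signed orbits, these orbits cover
  \<open>Omega n\<close>, and each is parametrized bijectively by steps and sign.\<close>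

lemma frame_bij_betw:
  assumes w: "w \<in> signed_perms n" and b: "b \<in> base_lists w \<gamma> (signed_orbits n w)"
  shows "bij_betw (frame w b) (frame_indices \<gamma>) (Omega n)"
proof -
  note bD = base_listsD[OF w b]
  have orbit: "signed_orbit w (b ! i) = (\<lambda>(j, s). s * (w ^^ j) (b ! i)) ` ({..<fst (\<gamma> ! i)} \<times> {1, - 1})"
    if "i < length \<gamma>" for i
    using bD(2)[OF that] by (intro signed_orbit_eq_image[OF w, of _ _ "snd (\<gamma> ! i)"]) simp
  show ?thesis
  proof (rule bij_betw_imageI)
    show "inj_on (frame w b) (frame_indices \<gamma>)"
    proof (rule inj_onI)
      fix p q assume "p \<in> frame_indices \<gamma>" "q \<in> frame_indices \<gamma>" and eq: "frame w b p = frame w b q"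
      then obtain i j s i' j' s' where p: "p = (i, j, s)" "i < length \<gamma>" "j < fst (\<gamma> ! i)" "s \<in> {1, - 1}"
        and q: "q = (i', j', s')" "i' < length \<gamma>" "j' < fst (\<gamma> ! i')" "s' \<in> {1, - 1}"
        unfolding frame_indices_def by blast
      have eq': "s * (w ^^ j) (b ! i) = s' * (w ^^ j') (b ! i')" using eq by (simp add: frame_def p(1) q(1))
      have "s * (w ^^ j) (b ! i) \<in> signed_orbit w (b ! i)"
        unfolding orbit[OF p(2)] using p by (intro image_eqI[of _ _ "(j, s)"]) auto
      moreover have "s * (w ^^ j) (b ! i) \<in> signed_orbit w (b ! i')"
        unfolding eq' orbit[OF q(2)] using q by (intro image_eqI[of _ _ "(j', s')"]) auto
      ultimately have "signed_orbit w (b ! i) = signed_orbit w (b ! i')"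
        using signed_orbit_eqI[OF w bD(3)[OF p(2)]] signed_orbit_eqI[OF w bD(3)[OF q(2)]] by blast
      moreover have "distinct (map (signed_orbit w) b)" using b unfolding base_lists_def by blast
      ultimately have i: "i = i'"
        using p(2) q(2) bD(1)[OF p(2)] by (simp add: distinct_conv_nth) metis
      have "j = j' \<and> s = s'"
      proof (rule signed_orbit_inj[OF w _ _ p(3) _ p(4) q(4)])
        show "point_type w (b ! i) = (fst (\<gamma> ! i), snd (\<gamma> ! i))" using bD(2)[OF p(2)] by simp
        show "b ! i \<noteq> 0" using bD(3)[OF p(2)] by (simp add: mem_Omega_iff)
      qed (use q i eq' in simp_all)
      with i show "p = q" by (simp add: p(1) q(1))
    qed
    show "frame w b ` frame_indices \<gamma> = Omega n"
    proof (intro equalityI subsetI)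
      fix x assume "x \<in> frame w b ` frame_indices \<gamma>"
      then obtain i j s where x: "x = s * (w ^^ j) (b ! i)" "i < length \<gamma>" "s \<in> {1, - 1}"
        unfolding frame_indices_def frame_def by auto
      have "(w ^^ j) (b ! i) \<in> Omega n" using bD(3)[OF x(2)] by (simp add: funpow_mem_Omega_iff[OF w])
      with x show "x \<in> Omega n" by auto
    next
      fix x assume "x \<in> Omega n"
      then have "signed_orbit w x \<in> set (map (signed_orbit w) b)"
        using b unfolding base_lists_def signed_orbits_def by blast
      then obtain y where y: "y \<in> set b" "signed_orbit w x = signed_orbit w y" by auto
      then obtain i where i: "i < length b" "y = b ! i" by (auto simp: in_set_conv_nth)
      have "map (point_type w) b = \<gamma>" using b unfolding base_lists_def by blast
      then have "length b = length \<gamma>" by (metis length_map)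
      with i have i': "i < length \<gamma>" by simp
      have "x \<in> signed_orbit w (b ! i)" using self_in_signed_orbit[of x w] y(2) i(2) by simp
      then obtain j s where "x = s * (w ^^ j) (b ! i)" "j < fst (\<gamma> ! i)" "s \<in> {1, - 1}"
        unfolding orbit[OF i'] by auto
      with i' show "x \<in> frame w b ` frame_indices \<gamma>"
        by (intro image_eqI[of _ _ "(i, j, s)"]) (auto simp: frame_def frame_indices_def)
    qed
  qed
qed

text \<open>Matching equal coordinates of the two frames defines \<open>u\<close>. In coordinates
  negation is \<open>s \<mapsto> - s\<close>, and the action of the signed permutation is determined
  by \<gamma>, so \<open>u\<close> is odd and intertwines \<open>w\<close> with
  \<open>v\<close>.\<close>

lemma base_lists_conjugator:
  assumes w: "w \<in> signed_perms n" "b \<in> base_lists w \<gamma> (signed_orbits n w)"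
    and v: "v \<in> signed_perms n" "c \<in> base_lists v \<gamma> (signed_orbits n v)"
  shows "\<exists>u\<in>signed_perms n. v = u \<circ> w \<circ> inv_into UNIV u \<and> c = map u b"
proof -
  let ?I = "frame_indices \<gamma>"
  note f = frame_bij_betw[OF w] and g = frame_bij_betw[OF v]
  define u where "u = (\<lambda>x. if x \<in> Omega n then frame v c (inv_into ?I (frame w b) x) else x)"
  have uf: "u (frame w b p) = frame v c p" if "p \<in> ?I" for p
    using that bij_betwE[OF f] bij_betw_inv_into_left[OF f] by (simp add: u_def)
  have obtain_frame: "\<exists>i j s. x = frame w b (i, j, s) \<and> i < length \<gamma> \<and> j < fst (\<gamma> ! i) \<and> s \<in> {1, - 1}"
    if "x \<in> Omega n" for x
  proof -
    have "x \<in> frame w b ` ?I" using that bij_betw_imp_surj_on[OF f] by simp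
    then obtain p where "p \<in> ?I" "x = frame w b p" by blast
    then show ?thesis by (cases p) (auto simp: frame_indices_def)
  qed
  have "bij_betw (frame v c \<circ> inv_into ?I (frame w b)) (Omega n) (Omega n)"
    by (rule bij_betw_trans[OF bij_betw_inv_into[OF f] g])
  then have "bij_betw u (Omega n) (Omega n)"
    by (rule bij_betw_cong[THEN iffD1, rotated]) (simp add: u_def)
  then have u_perm: "u permutes Omega n" by (rule bij_imp_permutes) (simp add: u_def)
  have u: "u \<in> signed_perms n"
  proof (rule signed_permsI[OF u_perm])
    fix x
    show "u (- x) = - u x"
    proof (cases "x \<in> Omega n")
      case True
      then obtain i j s where x: "x = frame w b (i, j, s)" "i < length \<gamma>" "j < fst (\<gamma> ! i)" "s \<in> {1, - 1}"
        using obtain_frame by blast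
      then have I: "(i, j, s) \<in> ?I" "(i, j, - s) \<in> ?I" by (auto simp: frame_indices_def)
      have "- x = frame w b (i, j, - s)" by (simp add: x(1) frame_def)
      then show ?thesis using uf[OF I(1)] uf[OF I(2)] x(1) by (simp add: frame_def)
    next
      case False
      then show ?thesis by (simp add: u_def)
    qed
  qed
  have scale: "y (s * x) = s * y x" if "y \<in> signed_perms n" "s \<in> {1, - 1}" for y x and s :: int
    using that by (auto simp: signed_perms_uminus)
  \<comment> \<open>In coordinates a signed permutation moves one step along its cycle, and from the
    last step it returns to the base point with the sign of the part. The rule is the same for
    \<open>w\<close> and \<open>v\<close>.\<close>
  have step: "y (frame y a (i, j, s)) =
      (if Suc j < fst (\<gamma> ! i) then frame y a (i, Suc j, s) else frame y a (i, 0, s * sign_int (snd (\<gamma> ! i))))"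
    if y: "y \<in> signed_perms n" "a \<in> base_lists y \<gamma> (signed_orbits n y)"
      and i: "i < length \<gamma>" "j < fst (\<gamma> ! i)" "s \<in> {1, - 1}" for y a i j s
  proof -
    have "y (frame y a (i, j, s)) = s * (y ^^ Suc j) (a ! i)"
      using scale[OF y(1) i(3)] by (simp add: frame_def)
    moreover have "(y ^^ fst (\<gamma> ! i)) (a ! i) = sign_int (snd (\<gamma> ! i)) * a ! i"
      using base_listsD(2)[OF y i(1)] by (intro point_type_props(2)[OF y(1)]) simp
    moreover have "Suc j = fst (\<gamma> ! i)" if "\<not> Suc j < fst (\<gamma> ! i)" using that i(2) by simp
    ultimately show ?thesis
      by (cases "Suc j < fst (\<gamma> ! i)") (simp_all add: frame_def del: funpow.simps(2))
  qed
  have comm: "u (w x) = v (u x)" for x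
  proof (cases "x \<in> Omega n")
    case True
    then obtain i j s where x: "x = frame w b (i, j, s)" and i: "i < length \<gamma>" "j < fst (\<gamma> ! i)" "s \<in> {1, - 1}"
      using obtain_frame by blast
    have "s * sign_int (snd (\<gamma> ! i)) \<in> {1, - 1}"
      using i(3) by (cases "snd (\<gamma> ! i)") (auto simp: sign_int_def)
    then have I: "(i, j, s) \<in> ?I" "Suc j < fst (\<gamma> ! i) \<Longrightarrow> (i, Suc j, s) \<in> ?I"
      "(i, 0, s * sign_int (snd (\<gamma> ! i))) \<in> ?I"
      using i by (auto simp: frame_indices_def)
    show ?thesis
      unfolding x uf[OF I(1)] step[OF w i] step[OF v i] using uf[OF I(2)] uf[OF I(3)] by simp
  next
    case False
    then show ?thesis
      using permutes_not_in[OF signed_perms_permutes[OF w(1)]] permutes_not_in[OF signed_perms_permutes[OF v(1)]]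
      by (simp add: u_def)
  qed
  have "v = u \<circ> w \<circ> inv_into UNIV u"
    by (rule ext) (simp add: comm permutes_inverses(1)[OF u_perm])
  moreover have "c = map u b"
  proof (rule nth_equalityI)
    have "map (point_type w) b = \<gamma>" "map (point_type v) c = \<gamma>"
      using w(2) v(2) unfolding base_lists_def by blast+
    then have len: "length b = length \<gamma>" "length c = length \<gamma>" by (metis length_map)+
    then show "length c = length (map u b)" by simp
    fix i assume "i < length c"
    then have i: "i < length \<gamma>" using len by simp
    have "0 < fst (\<gamma> ! i)"
      using base_listsD(2)[OF w i] point_type_props(1)[OF w(1), of "b ! i" "fst (\<gamma> ! i)" "snd (\<gamma> ! i)"] by simp
    with i have "(i, 0, 1) \<in> ?I" by (simp add: frame_indices_def)
    from uf[OF this] show "c ! i = map u b ! i" using i len by (simp add: frame_def)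
  qed
  ultimately show ?thesis using u by blast
qed

text \<open>Freeness of the action: the images of the base points determine the conjugator along
  each cycle through the powers of \<open>w\<close>, and on the negatives by oddness.\<close>

lemma base_lists_conjugator_unique:
  assumes w: "w \<in> signed_perms n" "b \<in> base_lists w \<gamma> (signed_orbits n w)"
    and u: "u \<in> signed_perms n" "u' \<in> signed_perms n"
    and eq: "u \<circ> w \<circ> inv_into UNIV u = u' \<circ> w \<circ> inv_into UNIV u'" "map u b = map u' b"
  shows "u = u'"
proof
  fix x
  show "u x = u' x"
  proof (cases "x \<in> Omega n")
    case True
    then have "x \<in> frame w b ` frame_indices \<gamma>" using bij_betw_imp_surj_on[OF frame_bij_betw[OF w]] by simp
    then obtain i j s where x: "x = s * (w ^^ j) (b ! i)" "i < length \<gamma>" "s = 1 \<or> s = - 1"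
      unfolding frame_indices_def frame_def by auto
    have "i < length b" using base_listsD(1)[OF w x(2)] x(2) by simp
    then have "u (b ! i) = u' (b ! i)" using eq(2) by (metis nth_map)
    then have "u ((w ^^ j) (b ! i)) = u' ((w ^^ j) (b ! i))"
      using conjugate_funpow[OF u(1), where w = w and j = j and x = "b ! i"]
        conjugate_funpow[OF u(2), where w = w and j = j and x = "b ! i"] eq(1) by simp
    then show ?thesis using x(1,3) signed_perms_uminus[OF u(1)] signed_perms_uminus[OF u(2)] by auto
  next
    case False
    then show ?thesis
      using permutes_not_in[OF signed_perms_permutes[OF u(1)]] permutes_not_in[OF signed_perms_permutes[OF u(2)]] by simp
  qed
qed

section \<open>Existence of every signed cycle type\<close>

definition block_cycle :: "nat \<Rightarrow> nat \<Rightarrow> sign \<Rightarrow> int \<Rightarrow> int" where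
  "block_cycle m n e x =
     (if int m < x \<and> x < int n then x + 1
      else if x = int n then sign_int e * (int m + 1)
      else if - int n < x \<and> x < - int m then x - 1
      else if x = - int n then - sign_int e * (int m + 1)
      else x)"

lemma block_cycle_in_signed_perms:
  assumes "m < n"
  shows "block_cycle m n e \<in> signed_perms n"
proof (rule signed_permsI)
  have maps: "block_cycle m n e x \<in> Omega n" if "x \<in> Omega n" for x
    using that assms by (cases e) (auto simp: block_cycle_def mem_Omega_iff sign_int_def)
  have "inj_on (block_cycle m n e) (Omega n)"
  proof (rule inj_onI)
    fix x y assume "x \<in> Omega n" "y \<in> Omega n" "block_cycle m n e x = block_cycle m n e y"
    then show "x = y"
      using assms by (cases e) (simp_all add: block_cycle_def mem_Omega_iff sign_int_def split: if_splits)
  qed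
  moreover have "block_cycle m n e ` Omega n \<subseteq> Omega n" using maps by blast
  ultimately have "bij_betw (block_cycle m n e) (Omega n) (Omega n)"
    by (simp add: bij_betw_def endo_inj_surj)
  then show "block_cycle m n e permutes Omega n"
    by (rule bij_imp_permutes) (use assms in \<open>auto simp: block_cycle_def mem_Omega_iff\<close>)
  show "block_cycle m n e (- x) = - block_cycle m n e x" for x
    using assms by (auto simp: block_cycle_def)
qed

text \<open>Induction on \<gamma>: the first part is realised by \<open>block_cycle\<close> on the
  top \<open>k\<close> letters and their negatives, the other parts by \<open>v\<close> on
  \<open>Omega m\<close> with \<open>m = n - k\<close>. The two move disjoint sets of letters, so
  the old orbits and their types are unchanged.\<close>

lemma base_list_exists:
  assumes "\<gamma> \<in> signed_compositions n"
  shows "\<exists>w\<in>signed_perms n. base_lists w \<gamma> (signed_orbits n w) \<noteq> {}"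
  using assms
proof (induction \<gamma> arbitrary: n)
  case Nil
  then have "n = 0" by (simp add: Nil_in_signed_compositions)
  then have "[] \<in> base_lists id [] (signed_orbits n id)"
    by (simp add: base_lists_def signed_orbits_def Omega_def)
  then show ?case using id_in_signed_perms by blast
next
  case (Cons p \<gamma>)
  obtain k e where p: "p = (k, e)" by force
  with Cons.prems have k: "0 < k" "k \<le> n" and \<gamma>: "\<gamma> \<in> signed_compositions (n - k)"
    by (auto simp: Cons_in_signed_compositions)
  define m where "m = n - k"
  have mn: "m < n" "n = m + k" using k by (auto simp: m_def)
  obtain v b where v: "v \<in> signed_perms m" and b: "b \<in> base_lists v \<gamma> (signed_orbits m v)"
    using Cons.IH[OF \<gamma>] by (auto simp: m_def)
  define w where "w = v \<circ> block_cycle m n e"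
  define a where "a = int m + 1"
  have w: "w \<in> signed_perms n"
    unfolding w_def using mn(1)
    by (intro comp_in_signed_perms signed_perms_mono[OF v] block_cycle_in_signed_perms) auto
  have w_old: "w x = v x" if "x \<in> Omega m" for x
  proof -
    have "block_cycle m n e x = x" using that mn(1) by (auto simp: block_cycle_def mem_Omega_iff)
    then show ?thesis by (simp add: w_def)
  qed
  have pow_old: "(w ^^ j) x = (v ^^ j) x" if "x \<in> Omega m" for x j
    by (induction j) (simp_all add: w_old funpow_mem_Omega_iff[OF v] that)
  have orbit_old: "signed_orbit w x = signed_orbit v x" "point_type w x = point_type v x" if "x \<in> Omega m" for x
    by (simp_all only: signed_orbit_def point_type_def pow_old[OF that])
  have w_new: "w x = x + 1" if "int m < x" "x < int n" for x
  proof -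
    have "x + 1 \<notin> Omega m" using that by (simp add: mem_Omega_iff)
    then show ?thesis
      using that permutes_not_in[OF signed_perms_permutes[OF v]] by (simp add: w_def block_cycle_def)
  qed
  have w_last: "w (int n) = sign_int e * a"
  proof -
    have "sign_int e * a \<notin> Omega m" by (cases e) (auto simp: mem_Omega_iff a_def sign_int_def)
    then show ?thesis
      using permutes_not_in[OF signed_perms_permutes[OF v]] by (simp add: w_def block_cycle_def a_def)
  qed
  have pow_new: "(w ^^ j) a = a + int j" if "j < k" for j
    using that
  proof (induction j)
    case (Suc j)
    then show ?case using w_new[of "a + int j"] mn by (simp add: a_def)
  qed simp
  have type_new: "point_type w a = (k, e)"
  proof (rule point_type_eqI[OF _ k(1)])
    show "a \<noteq> 0" by (simp add: a_def)
    obtain j where j: "k = Suc j" using k(1) gr0_implies_Suc by blast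
    then have "(w ^^ k) a = w (a + int j)" using pow_new[of j] by simp
    also have "a + int j = int n" using mn j by (simp add: a_def)
    finally show "(w ^^ k) a = sign_int e * a" by (simp add: w_last)
    show "(w ^^ j) a \<noteq> a \<and> (w ^^ j) a \<noteq> - a" if "0 < j" "j < k" for j
      using that pow_new[of j] by (simp add: a_def)
  qed
  have orbit_new: "signed_orbit w a = Omega n - Omega m"
  proof (intro equalityI subsetI)
    fix x assume "x \<in> signed_orbit w a"
    then obtain j s where x: "x = s * (w ^^ j) a" "j < k" "s = 1 \<or> s = - 1"
      unfolding signed_orbit_eq_image[OF w type_new] by auto
    then have "\<bar>x\<bar> = a + int j" using pow_new[of j] by (auto simp: a_def)
    with x(2) mn show "x \<in> Omega n - Omega m" by (auto simp: mem_Omega_iff a_def)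
  next
    fix x assume "x \<in> Omega n - Omega m"
    then have x: "int m < \<bar>x\<bar>" "\<bar>x\<bar> \<le> int n" by (auto simp: mem_Omega_iff)
    define j where "j = nat (\<bar>x\<bar> - a)"
    have "j < k" "\<bar>x\<bar> = a + int j" using x mn by (auto simp: j_def a_def)
    then have "x = (w ^^ j) a \<or> x = - (w ^^ j) a" using pow_new[of j] by auto
    then show "x \<in> signed_orbit w a" unfolding signed_orbit_def by blast
  qed
  have a: "a \<in> Omega n" "a \<notin> Omega m" using mn k by (auto simp: mem_Omega_iff a_def)
  have Omega: "Omega n = Omega m \<union> signed_orbit w a"
    unfolding orbit_new using mn by (auto simp: mem_Omega_iff)
  have "signed_orbit w ` signed_orbit w a = {signed_orbit w a}"
    using signed_orbit_eqI[OF w a(1)] self_in_signed_orbit[of a w] by blast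
  moreover have "signed_orbit w ` Omega m = signed_orbits m v"
    unfolding signed_orbits_def by (rule image_cong) (simp_all add: orbit_old)
  moreover have "signed_orbits n w = signed_orbit w ` Omega m \<union> signed_orbit w ` signed_orbit w a"
    unfolding signed_orbits_def by (subst Omega) (rule image_Un)
  ultimately have orbits: "signed_orbits n w = insert (signed_orbit w a) (signed_orbits m v)"
    by simp
  have fresh: "signed_orbit w a \<notin> signed_orbits m v"
    using signed_orbitsD(1)[OF v _ self_in_signed_orbit[of a w]] a(2) by blast
  have b': "distinct (map (signed_orbit v) b)" "set (map (signed_orbit v) b) = signed_orbits m v"
    "map (point_type v) b = \<gamma>"
    using b unfolding base_lists_def by blast+
  have b_Omega: "x \<in> Omega m" if "x \<in> set b" for x
  proof -
    have "signed_orbit v x \<in> signed_orbits m v" using b'(2) that by auto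
    then show ?thesis by (rule signed_orbitsD(1)[OF v _ self_in_signed_orbit])
  qed
  have map: "map (signed_orbit w) b = map (signed_orbit v) b" "map (point_type w) b = map (point_type v) b"
    using b_Omega orbit_old by auto
  have "distinct (map (signed_orbit w) (a # b))"
    unfolding list.map map distinct.simps b'(2) using fresh b'(1) by blast
  moreover have "set (map (signed_orbit w) (a # b)) = signed_orbits n w"
    unfolding list.map map list.set b'(2) orbits ..
  moreover have "map (point_type w) (a # b) = p # \<gamma>"
    unfolding list.map map b'(3) type_new p ..
  ultimately have "a # b \<in> base_lists w (p # \<gamma>) (signed_orbits n w)"
    unfolding base_lists_def by blast
  then show ?case using w by blast
qed

section \<open>Order of the group, class functions and cycle types\<close>

lemma card_signed_perms: "card (signed_perms n) = 2 ^ n * fact n"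
proof -
  \<comment> \<open>\<open>p\<close> permutes the absolute values, and \<open>A\<close> is the set
    of positive letters that are sent to negative ones.\<close>
  define \<psi> :: "(nat \<Rightarrow> nat) \<times> nat set \<Rightarrow> int \<Rightarrow> int" where
    "\<psi> = (\<lambda>(p, A) x. if x \<in> Omega n
       then (if nat \<bar>x\<bar> \<in> A then - sgn x else sgn x) * int (p (nat \<bar>x\<bar>)) else x)"
  let ?P = "{p. p permutes {1..n}} \<times> Pow {1..n}"
  have abs_mem: "nat \<bar>x\<bar> \<in> {1..n}" if "x \<in> Omega n" for x
    using that by (auto simp: mem_Omega_iff)
  have abs_\<psi>: "\<bar>\<psi> (p, A) x\<bar> = int (p (nat \<bar>x\<bar>))" if "x \<in> Omega n" for p A x
    using that by (auto simp: \<psi>_def abs_mult mem_Omega_iff)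
  have bij: "bij_betw \<psi> ?P (signed_perms n)"
  proof (rule bij_betw_imageI)
    show "inj_on \<psi> ?P"
    proof (rule inj_onI, clarify)
      fix p A q B assume p: "p permutes {1..n}" "A \<subseteq> {1..n}" and q: "q permutes {1..n}" "B \<subseteq> {1..n}"
        and eq: "\<psi> (p, A) = \<psi> (q, B)"
      have *: "p i = q i \<and> (i \<in> A \<longleftrightarrow> i \<in> B)" if i: "i \<in> {1..n}" for i
      proof -
        have iO: "int i \<in> Omega n" using i by (simp add: mem_Omega_iff)
        have "p i = q i" using abs_\<psi>[OF iO, of p A] abs_\<psi>[OF iO, of q B] eq by simp
        moreover have "p i \<noteq> 0" using permutes_in_image[OF p(1), of i] i by auto
        ultimately show ?thesis
          using fun_cong[OF eq, of "int i"] iO i by (auto simp: \<psi>_def split: if_splits)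
      qed
      have "p = q"
      proof
        show "p i = q i" for i
          using * permutes_not_in[OF p(1), of i] permutes_not_in[OF q(1), of i] by (cases "i \<in> {1..n}") auto
      qed
      moreover have "A = B" using * p(2) q(2) by blast
      ultimately show "p = q \<and> A = B" by blast
    qed
    show "\<psi> ` ?P = signed_perms n"
    proof (intro equalityI subsetI)
      fix w assume "w \<in> \<psi> ` ?P"
      then obtain p A where w: "w = \<psi> (p, A)" and p: "p permutes {1..n}" by auto
      show "w \<in> signed_perms n"
      proof (rule signed_permsI)
        have maps: "w x \<in> Omega n" if "x \<in> Omega n" for x
        proof -
          have "p (nat \<bar>x\<bar>) \<in> {1..n}" using permutes_in_image[OF p] abs_mem[OF that] by blast
          then have "\<bar>w x\<bar> \<le> int n" "\<bar>w x\<bar> \<noteq> 0" unfolding w abs_\<psi>[OF that] by auto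
          then show ?thesis by (simp add: mem_Omega_iff)
        qed
        have "inj_on w (Omega n)"
        proof (rule inj_onI)
          fix x y assume xy: "x \<in> Omega n" "y \<in> Omega n" and eq: "w x = w y"
          have "p (nat \<bar>x\<bar>) = p (nat \<bar>y\<bar>)"
            using abs_\<psi>[OF xy(1), of p A] abs_\<psi>[OF xy(2), of p A] eq unfolding w by simp
          then have abs: "\<bar>x\<bar> = \<bar>y\<bar>" using permutes_inj[OF p] by (auto dest: injD)
          moreover have "p (nat \<bar>x\<bar>) \<noteq> 0" using permutes_in_image[OF p] abs_mem[OF xy(1)] by (metis atLeastAtMost_iff not_one_le_zero)
          ultimately have "sgn x = sgn y"
            using eq xy unfolding w by (auto simp: \<psi>_def split: if_splits)
          with abs show "x = y" by (metis abs_mult_sgn mult.commute)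
        qed
        moreover have "w ` Omega n \<subseteq> Omega n" using maps by blast
        ultimately have "bij_betw w (Omega n) (Omega n)" by (simp add: bij_betw_def endo_inj_surj)
        then show "w permutes Omega n" by (rule bij_imp_permutes) (simp add: w \<psi>_def)
        show "w (- x) = - w x" for x by (simp add: w \<psi>_def)
      qed
    next
      fix w assume w: "w \<in> signed_perms n"
      define p where "p = (\<lambda>i. if i \<in> {1..n} then nat \<bar>w (int i)\<bar> else i)"
      define A where "A = {i \<in> {1..n}. w (int i) < 0}"
      have w_mem: "w (int i) \<in> Omega n" if "i \<in> {1..n}" for i
        using that permutes_in_image[OF signed_perms_permutes[OF w], of "int i"] by (simp add: mem_Omega_iff)
      have "inj_on p {1..n}"
      proof (rule inj_onI)
        fix i j assume ij: "i \<in> {1..n}" "j \<in> {1..n}" "p i = p j"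
        then have "\<bar>w (int i)\<bar> = \<bar>w (int j)\<bar>" by (simp add: p_def)
        then have "w (int i) = w (int j) \<or> w (int i) = w (- int j)"
          using signed_perms_uminus[OF w, of "int j"] by (auto simp: abs_eq_iff)
        then have "int i = int j \<or> int i = - int j" by (simp only: signed_perms_eq_iff[OF w])
        then show "i = j" using ij by auto
      qed
      moreover have "p ` {1..n} \<subseteq> {1..n}"
        using w_mem by (fastforce simp: p_def mem_Omega_iff)
      ultimately have "bij_betw p {1..n} {1..n}" by (simp add: bij_betw_def endo_inj_surj)
      then have p: "p permutes {1..n}" by (rule bij_imp_permutes) (auto simp: p_def)
      have "\<psi> (p, A) x = w x" for x
      proof (cases "x \<in> Omega n")
        case True
        note i = abs_mem[OF True]
        have "\<psi> (p, A) x = sgn x * w \<bar>x\<bar>"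
          using True i by (auto simp: \<psi>_def p_def A_def)
        also have "\<dots> = w x"
          using True signed_perms_uminus[OF w, of x] by (cases "0 < x") (auto simp: mem_Omega_iff)
        finally show ?thesis .
      next
        case False
        then show ?thesis using permutes_not_in[OF signed_perms_permutes[OF w]] by (simp add: \<psi>_def)
      qed
      then have "\<psi> (p, A) = w" by (rule ext)
      moreover have "(p, A) \<in> ?P" using p by (auto simp: A_def)
      ultimately show "w \<in> \<psi> ` ?P" by blast
    qed
  qed
  have "card (signed_perms n) = card ?P" using bij_betw_same_card[OF bij] by simp
  also have "\<dots> = fact n * 2 ^ n"
    by (simp add: card_cartesian_product card_permutations[of _ n] card_Pow)
  finally show ?thesis by (simp add: mult.commute)
qed

lemma trace_mat_commute:
  assumes "A \<in> carrier_mat d d" and "B \<in> carrier_mat d d"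
  shows "trace_mat (A * B) = trace_mat (B * A)"
proof -
  have "trace_mat (A * B) = (\<Sum>i<d. \<Sum>j<d. A $$ (i, j) * B $$ (j, i))"
    using assms by (auto simp: trace_mat_def scalar_prod_def lessThan_atLeast0 intro!: sum.cong)
  also have "\<dots> = (\<Sum>j<d. \<Sum>i<d. B $$ (j, i) * A $$ (i, j))"
    by (subst sum.swap) (simp add: mult.commute)
  also have "\<dots> = trace_mat (B * A)"
    using assms by (auto simp: trace_mat_def scalar_prod_def lessThan_atLeast0 intro!: sum.cong)
  finally show ?thesis .
qed

lemma character_conjugate:
  assumes "is_character n \<chi>" and u: "u \<in> signed_perms n" and w: "w \<in> signed_perms n"
  shows "\<chi> (u \<circ> w \<circ> inv_into UNIV u) = \<chi> w"
proof -
  obtain d \<rho> where \<rho>: "is_representation n d \<rho>" and \<chi>: "\<forall>w\<in>signed_perms n. \<chi> w = trace_mat (\<rho> w)"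
    using assms(1) unfolding is_character_def by blast
  let ?v = "inv_into UNIV u"
  have v: "?v \<in> signed_perms n" by (rule inv_in_signed_perms[OF u])
  have mult: "\<rho> (x \<circ> y) = \<rho> x * \<rho> y" if "x \<in> signed_perms n" "y \<in> signed_perms n" for x y
    using \<rho> that unfolding is_representation_def by blast
  have carrier: "\<rho> x \<in> carrier_mat d d" if "x \<in> signed_perms n" for x
    using \<rho> that unfolding is_representation_def by blast
  have uw: "u \<circ> w \<in> signed_perms n" by (rule comp_in_signed_perms[OF u w])
  have "?v \<circ> (u \<circ> w) = w"
    using permutes_inverses(2)[OF signed_perms_permutes[OF u]] by (simp add: fun_eq_iff)
  have "\<chi> (u \<circ> w \<circ> ?v) = trace_mat (\<rho> (u \<circ> w) * \<rho> ?v)"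
    using \<chi> comp_in_signed_perms[OF uw v] mult[OF uw v] by simp
  also have "\<dots> = trace_mat (\<rho> ?v * \<rho> (u \<circ> w))"
    by (rule trace_mat_commute[OF carrier[OF uw] carrier[OF v]])
  also have "\<dots> = trace_mat (\<rho> w)"
    using mult[OF v uw] \<open>?v \<circ> (u \<circ> w) = w\<close> by simp
  finally show ?thesis using \<chi> w by simp
qed

lemma mset_eq_image_mset_list:
  assumes "mset ys = image_mset f M"
  shows "\<exists>xs. mset xs = M \<and> map f xs = ys"
  using assms
proof (induction ys arbitrary: M)
  case (Cons y ys)
  then have "y \<in># image_mset f M" by (metis list.set_intros(1) set_mset_mset)
  then obtain x where x: "x \<in># M" "f x = y" by auto
  then obtain N where N: "M = add_mset x N" by (meson multi_member_split)
  with Cons.prems x have "mset ys = image_mset f N" by simp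
  from Cons.IH[OF this] obtain xs where "mset xs = N" "map f xs = ys" by blast
  with x N show ?case by (intro exI[of _ "x # xs"]) simp
qed simp

text \<open>Base points can be picked on the orbits at will, so a base list exists as soon as the
  orbits can be ordered such that their types read \<gamma>; this depends only on the multiset of
  orbit types.\<close>

lemma base_lists_nonempty_iff:
  assumes w: "w \<in> signed_perms n"
  shows "base_lists w \<gamma> (signed_orbits n w) \<noteq> {} \<longleftrightarrow> signed_cycle_type n w = bipartition_of \<gamma>"
proof -
  have "signed_cycle_type n w = bipartition_of \<gamma> \<longleftrightarrow>
      image_mset (orbit_type w) (mset_set (signed_orbits n w)) = mset \<gamma>"
    by (simp add: signed_cycle_type_eq[OF w] bipartition_of_eq split_by_sign_inject)
  also have "\<dots> \<longleftrightarrow> base_lists w \<gamma> (signed_orbits n w) \<noteq> {}"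
  proof
    assume "image_mset (orbit_type w) (mset_set (signed_orbits n w)) = mset \<gamma>"
    from mset_eq_image_mset_list[OF this[symmetric]]
    obtain ds where ds: "mset ds = mset_set (signed_orbits n w)" "map (orbit_type w) ds = \<gamma>" by blast
    have set_ds: "set ds = signed_orbits n w"
      using arg_cong[OF ds(1), of set_mset] by simp
    have "distinct ds"
      by (simp add: distinct_count_atmost_1 ds(1) set_ds)
    define b where "b = map (\<lambda>d. SOME x. x \<in> d) ds"
    have pick: "(SOME x. x \<in> d) \<in> d" if "d \<in> set ds" for d
      using that signed_orbits_nonempty unfolding set_ds by (metis someI)
    have "map (signed_orbit w) b = ds"
      unfolding b_def map_map
    proof (rule map_idI)
      fix d assume d: "d \<in> set ds"
      show "(signed_orbit w \<circ> (\<lambda>d. SOME x. x \<in> d)) d = d"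
        unfolding o_apply by (rule signed_orbitsD(2)[OF w d[unfolded set_ds] pick[OF d], symmetric])
    qed
    moreover have "map (point_type w) b = map (orbit_type w) ds"
      by (simp add: b_def orbit_type_def)
    ultimately have "b \<in> base_lists w \<gamma> (signed_orbits n w)"
      using \<open>distinct ds\<close> set_ds ds(2) unfolding base_lists_def by (simp del: set_map)
    then show "base_lists w \<gamma> (signed_orbits n w) \<noteq> {}" by blast
  next
    assume "base_lists w \<gamma> (signed_orbits n w) \<noteq> {}"
    then obtain b where b: "distinct (map (signed_orbit w) b)"
      "set (map (signed_orbit w) b) = signed_orbits n w" "map (point_type w) b = \<gamma>"
      unfolding base_lists_def by blast
    have "mset_set (signed_orbits n w) = mset (map (signed_orbit w) b)"
      using mset_set_set[OF b(1)] b(2) by simp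
    then have "image_mset (orbit_type w) (mset_set (signed_orbits n w)) =
        mset (map (\<lambda>x. orbit_type w (signed_orbit w x)) b)"
      by (simp add: multiset.map_comp o_def)
    also have "map (\<lambda>x. orbit_type w (signed_orbit w x)) b = map (point_type w) b"
    proof (rule map_cong[OF refl])
      fix x assume "x \<in> set b"
      then have "signed_orbit w x \<in> signed_orbits n w" using b(2) by auto
      then show "orbit_type w (signed_orbit w x) = point_type w x"
        by (rule signed_orbitsD(3)[OF w _ self_in_signed_orbit, symmetric])
    qed
    finally show "image_mset (orbit_type w) (mset_set (signed_orbits n w)) = mset \<gamma>"
      by (simp add: b(3))
  qed
  finally show ?thesis by blast
qed

text \<open>
  Fix one pair of a signed permutation of type \<open>\<gamma>\<close> and a list of base points of its cycles. The
  group acts simply transitively on all such pairs, so that no class sizes need to be computed.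
\<close>

lemma sum_character_weight_functional:
  assumes \<chi>: "is_character n \<chi>" and \<gamma>: "\<gamma> \<in> signed_compositions n"
  shows "(\<Sum>w\<in>signed_perms n. \<chi> w *
      weight_functional \<gamma> (\<lambda>\<tau>. coloring_sum (orbit_type w) \<tau> (signed_orbits n w))) =
    2 ^ n * fact n * value_at n \<chi> \<gamma>"
proof -
  let ?BL = "\<lambda>w. base_lists w \<gamma> (signed_orbits n w)"
  \<comment> \<open>The same choice as in \<open>value_at\<close>, so that the final sum consists of
    copies of \<open>value_at n \<chi> \<gamma>\<close>.\<close>
  define w0 where "w0 = (SOME w. w \<in> signed_perms n \<and> signed_cycle_type n w = bipartition_of \<gamma>)"
  have "\<exists>w. w \<in> signed_perms n \<and> signed_cycle_type n w = bipartition_of \<gamma>"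
    using base_list_exists[OF \<gamma>] base_lists_nonempty_iff by blast
  then have "w0 \<in> signed_perms n \<and> signed_cycle_type n w0 = bipartition_of \<gamma>"
    unfolding w0_def by (rule someI_ex)
  then have w0: "w0 \<in> signed_perms n" and "?BL w0 \<noteq> {}"
    using base_lists_nonempty_iff by blast+
  then obtain b0 where b0: "b0 \<in> ?BL w0" by blast
  have card_BL: "finite (?BL w)"
    "weight_functional \<gamma> (\<lambda>\<tau>. coloring_sum (orbit_type w) \<tau> (signed_orbits n w)) = of_nat (card (?BL w))"
    if "w \<in> signed_perms n" for w
    using weight_functional_eq_card_base_lists[OF that order_refl] \<gamma> by (auto simp: signed_compositions_def)
  let ?c = "\<lambda>u. u \<circ> w0 \<circ> inv_into UNIV u"
  have bij: "bij_betw (\<lambda>u. (?c u, map u b0)) (signed_perms n) (SIGMA w:signed_perms n. ?BL w)"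
  proof (rule bij_betw_imageI)
    show "inj_on (\<lambda>u. (?c u, map u b0)) (signed_perms n)"
      by (rule inj_onI) (blast intro: base_lists_conjugator_unique[OF w0 b0])
    show "(\<lambda>u. (?c u, map u b0)) ` signed_perms n = (SIGMA w:signed_perms n. ?BL w)"
    proof (intro equalityI subsetI)
      fix q assume "q \<in> (\<lambda>u. (?c u, map u b0)) ` signed_perms n"
      then obtain u where u: "u \<in> signed_perms n" "q = (?c u, map u b0)" by blast
      have "?c u \<in> signed_perms n"
        by (intro comp_in_signed_perms u(1) w0 inv_in_signed_perms)
      with base_lists_conjugate[OF u(1) b0] u(2) show "q \<in> (SIGMA w:signed_perms n. ?BL w)" by blast
    next
      fix q assume "q \<in> (SIGMA w:signed_perms n. ?BL w)"
      then obtain w b where q: "q = (w, b)" "w \<in> signed_perms n" "b \<in> ?BL w" by blast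
      from base_lists_conjugator[OF w0 b0 q(2,3)] q(1)
      show "q \<in> (\<lambda>u. (?c u, map u b0)) ` signed_perms n" by blast
    qed
  qed
  have "(\<Sum>w\<in>signed_perms n. \<chi> w *
      weight_functional \<gamma> (\<lambda>\<tau>. coloring_sum (orbit_type w) \<tau> (signed_orbits n w))) =
      (\<Sum>w\<in>signed_perms n. \<Sum>b\<in>?BL w. \<chi> w)"
    by (rule sum.cong) (simp_all add: card_BL(2))
  also have "\<dots> = (\<Sum>q\<in>(SIGMA w:signed_perms n. ?BL w). \<chi> (fst q))"
    using card_BL(1) by (subst sum.Sigma) (auto simp: finite_signed_perms case_prod_unfold)
  also have "\<dots> = (\<Sum>u\<in>signed_perms n. \<chi> (?c u))"
    using sum.reindex_bij_betw[OF bij, of "\<lambda>q. \<chi> (fst q)"] by simp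
  also have "\<dots> = (\<Sum>u\<in>signed_perms n. \<chi> w0)"
    by (rule sum.cong[OF refl]) (rule character_conjugate[OF \<chi> _ w0])
  also have "\<dots> = 2 ^ n * fact n * value_at n \<chi> \<gamma>"
    by (simp add: card_signed_perms value_at_def w0_def)
  finally show ?thesis .
qed

section \<open>Fine sets\<close>

lemma fine_set_iff_ch:
  assumes \<chi>: "is_character n \<chi>" and B: "sDes \<in> B \<rightarrow> signed_sets n"
  shows "fine_set n \<chi> B sDes \<longleftrightarrow> ch n \<chi> = (\<Sum>b\<in>B. F n (sDes b))"
proof -
  define N :: complex where "N = 2 ^ n * fact n"
  have N: "N \<noteq> 0" by (simp add: N_def)
  let ?W = "signed_perms n"
  let ?ind = "\<lambda>b. word_indicator (fst (sDes b)) (sign_vector (sDes b)) 0"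
  \<comment> \<open>\<open>p\<close> and \<open>q\<close> are the coefficients of the two sides at a
    sorted monomial of pattern \<tau>.\<close>
  define p where "p = (\<lambda>\<tau>. \<Sum>w\<in>?W. \<chi> w / N * coloring_sum (orbit_type w) \<tau> (signed_orbits n w))"
  define q where "q = (\<lambda>\<tau>. \<Sum>b\<in>B. ?ind b \<tau>)"
  have const_mult: "mps_const a * mps_const b = (mps_const (a * b) :: (var, complex) mps)" for a b
  proof (rule mps_eqI)
    fix M :: "var multiset"
    have "mps_coeff (mps_const a * mps_const b) M =
        (\<Sum>A | A \<subseteq># M. if A = {#} then a * mps_coeff (mps_const b) M else 0)"
      unfolding times_mps.rep_eq by (rule sum.cong) (auto simp: mps_const.rep_eq)
    then show "mps_coeff (mps_const a * mps_const b :: (var, complex) mps) M = mps_coeff (mps_const (a * b)) M"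
      by (simp add: finite_submultisets mps_const.rep_eq)
  qed
  have "ch n \<chi> = (\<Sum>w\<in>?W. mps_const (\<chi> w / N) * power_sum_prod (orbit_type w) (signed_orbits n w))"
    unfolding ch_def sum_distrib_left
  proof (rule sum.cong[OF refl])
    fix w assume w: "w \<in> ?W"
    have "mps_const (1 / (2 ^ n * fact n)) * (case signed_cycle_type n w of (\<alpha>, \<beta>) \<Rightarrow>
          mps_const (\<chi> w) * power_sum_part Plus \<alpha> * power_sum_part Minus \<beta>) =
        mps_const (1 / N) * mps_const (\<chi> w) *
          (case signed_cycle_type n w of (\<alpha>, \<beta>) \<Rightarrow> power_sum_part Plus \<alpha> * power_sum_part Minus \<beta>)"
      by (simp add: case_prod_unfold N_def mult.assoc)
    also have "\<dots> = mps_const (\<chi> w / N) * power_sum_prod (orbit_type w) (signed_orbits n w)"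
      unfolding power_sum_parts_of_signed_cycle_type[OF w] const_mult by simp
    finally show "mps_const (1 / (2 ^ n * fact n)) * (case signed_cycle_type n w of (\<alpha>, \<beta>) \<Rightarrow>
          mps_const (\<chi> w) * power_sum_part Plus \<alpha> * power_sum_part Minus \<beta>) =
        mps_const (\<chi> w / N) * power_sum_prod (orbit_type w) (signed_orbits n w)" .
  qed
  then have "ch n \<chi> = (\<Sum>b\<in>B. F n (sDes b)) \<longleftrightarrow> (\<forall>\<tau>\<in>signed_compositions n. p \<tau> = q \<tau>)"
    unfolding p_def q_def
    using power_sums_eq_sum_F_iff[of ?W "signed_orbits n" orbit_type n sDes B "\<lambda>w. \<chi> w / N"]
    by (simp add: finite_signed_perms orbit_type_pos sum_orbit_type B)
  also have "\<dots> \<longleftrightarrow> (\<forall>\<gamma>\<in>signed_compositions n. weight_functional \<gamma> p = weight_functional \<gamma> q)"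
  proof
    assume "\<forall>\<tau>\<in>signed_compositions n. p \<tau> = q \<tau>"
    then show "\<forall>\<gamma>\<in>signed_compositions n. weight_functional \<gamma> p = weight_functional \<gamma> q"
      using weight_functional_cong by blast
  next
    assume "\<forall>\<gamma>\<in>signed_compositions n. weight_functional \<gamma> p = weight_functional \<gamma> q"
    then have "weight_functional \<gamma> (\<lambda>\<tau>. p \<tau> - q \<tau>) = 0" if "\<gamma> \<in> signed_compositions n" for \<gamma>
      using that by (simp add: weight_functional_diff)
    then show "\<forall>\<tau>\<in>signed_compositions n. p \<tau> = q \<tau>"
      using weight_functional_separates[of n "\<lambda>\<tau>. p \<tau> - q \<tau>"] by auto
  qed
  also have "\<dots> \<longleftrightarrow> fine_set n \<chi> B sDes"
    unfolding fine_set_def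
  proof (rule ball_cong[OF refl])
    fix \<gamma> assume \<gamma>: "\<gamma> \<in> signed_compositions n"
    have "weight_functional \<gamma> p = (\<Sum>w\<in>?W. \<chi> w *
        weight_functional \<gamma> (\<lambda>\<tau>. coloring_sum (orbit_type w) \<tau> (signed_orbits n w))) / N"
      unfolding p_def weight_functional_sum by (simp add: sum_divide_distrib)
    \<comment> \<open>\<open>N\<close> is the order of the group, hence the number of pairs of a
      signed permutation and a base list; it cancels the normalisation of \<open>ch\<close>.\<close>
    also have "\<dots> = value_at n \<chi> \<gamma>"
      unfolding sum_character_weight_functional[OF \<chi> \<gamma>] N_def[symmetric] using N by simp
    finally have "weight_functional \<gamma> p = value_at n \<chi> \<gamma>" .
    moreover have "weight_functional \<gamma> q = (\<Sum>b\<in>B. of_int (wt \<gamma> (sDes b)))"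
      unfolding q_def weight_functional_sum1
      using B by (intro sum.cong refl weight_functional_eq_wt[OF \<gamma>]) auto
    ultimately show "weight_functional \<gamma> p = weight_functional \<gamma> q \<longleftrightarrow>
        value_at n \<chi> \<gamma> = (\<Sum>b\<in>B. of_int (wt \<gamma> (sDes b)))" by simp
  qed
  finally show ?thesis by blast
qed

section \<open>Uniqueness of the distribution\<close>

lemma finite_signed_sets: "finite (signed_sets n)"
proof (rule finite_subset)
  show "signed_sets n \<subseteq> (SIGMA S:Pow {1..n}. S \<rightarrow>\<^sub>E UNIV)"
    by (auto simp: signed_sets_def)
  show "finite (SIGMA S:Pow {1..n}. S \<rightarrow>\<^sub>E (UNIV :: sign set))"
    by (intro finite_SigmaI finite_PiE) (auto intro: finite_subset)
qed

lemma signed_set_eqI: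
  assumes "\<sigma> \<in> signed_sets n" and "\<tau> \<in> signed_sets n" and "fst \<sigma> = fst \<tau>"
    and "\<forall>j\<in>{1..n}. sign_vector \<sigma> j = sign_vector \<tau> j"
  shows "\<sigma> = \<tau>"
proof -
  obtain S \<epsilon> \<delta> where eq: "\<sigma> = (S, \<epsilon>)" "\<tau> = (S, \<delta>)"
    using assms(3) by (cases \<sigma>; cases \<tau>) auto
  with assms have S: "S \<subseteq> {1..n}" "\<epsilon> \<in> S \<rightarrow>\<^sub>E UNIV" "\<delta> \<in> S \<rightarrow>\<^sub>E UNIV"
    by (auto simp: signed_sets_def)
  have "\<epsilon> s = \<delta> s" if "s \<in> S" for s
    using that S(1) assms(4) wDes_alt(3)[OF assms(1), of s] wDes_alt(3)[OF assms(2), of s] by (auto simp: eq)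
  then have "\<epsilon> = \<delta>" using S by (intro PiE_ext) auto
  then show ?thesis by (simp add: eq)
qed

text \<open>The monomial belongs to the word with the signs of \<tau> whose letters change exactly
  after the elements of \<open>fst \<tau>\<close> below \<open>n\<close>. The series of \<sigma>
  contains it iff the signs agree and \<sigma> demands no change elsewhere.\<close>

lemma coeff_F_at_signed_set:
  assumes "\<tau> \<in> signed_sets n"
  shows "\<exists>M. \<forall>\<sigma>\<in>signed_sets n. mps_coeff (F n \<sigma>) M =
    (if (\<forall>j\<in>{1..n}. sign_vector \<tau> j = sign_vector \<sigma> j) \<and> fst \<sigma> \<subseteq> fst \<tau> then 1 else 0)"
proof (intro exI ballI)
  \<comment> \<open>The indices start at 1, as \<open>F\<close> requires, and grow by one right
    after each element of the set.\<close>
  define c where "c = (\<lambda>j. 1 + card {s \<in> fst \<tau>. s < j})"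
  define v where "v = (\<lambda>j. signed_var (sign_vector \<tau> j) (c j))"
  have S: "fst \<tau> \<subseteq> {1..n}" using assms by (auto simp: signed_sets_def)
  then have fin: "finite (fst \<tau>)" using finite_subset by auto
  have in_S: "c j < c (j + 1)" if "j \<in> fst \<tau>" for j
    unfolding c_def using fin that by (intro add_strict_left_mono psubset_card_mono) (auto simp: psubset_eq)
  have notin_S: "v j = v (j + 1)" if "j \<in> {1..<n}" "j \<notin> fst \<tau>" for j
  proof -
    have "{s \<in> fst \<tau>. s < j} = {s \<in> fst \<tau>. s < j + 1}" using that(2) by (auto simp: less_Suc_eq)
    then show ?thesis using wDes_alt(2)[OF assms that] by (simp add: v_def c_def)
  qed
  have rise: "v j \<noteq> v (j + 1) \<longleftrightarrow> j \<in> fst \<tau>" if "j \<in> {1..<n}" for j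
    using notin_S[OF that] in_S[of j] by (auto simp: v_def)
  have incr: "\<forall>j\<in>{1..<n}. var_rank (v j) \<le> var_rank (v (j + 1))"
  proof
    fix j assume j: "j \<in> {1..<n}"
    show "var_rank (v j) \<le> var_rank (v (j + 1))"
    proof (cases "j \<in> fst \<tau>")
      case True
      then have "var_index (v j) < var_index (v (j + 1))" using in_S by (simp add: v_def)
      then show ?thesis using var_index_less_imp_rank_less less_imp_le by blast
    next
      case False
      then show ?thesis using notin_S[OF j] by simp
    qed
  qed
  fix \<sigma> assume \<sigma>: "\<sigma> \<in> signed_sets n"
  have sub: "fst \<sigma> \<subseteq> {1..n}" "n \<in> fst \<tau>" using \<sigma> assms by (auto simp: signed_sets_def)
  have "(\<forall>j\<in>fst \<sigma> \<inter> {1..<n}. v j \<noteq> v (j + 1)) \<longleftrightarrow> fst \<sigma> \<inter> {1..<n} \<subseteq> fst \<tau>"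
    using rise by blast
  also have "\<dots> \<longleftrightarrow> fst \<sigma> \<subseteq> fst \<tau>"
  proof
    assume h: "fst \<sigma> \<inter> {1..<n} \<subseteq> fst \<tau>"
    show "fst \<sigma> \<subseteq> fst \<tau>"
    proof
      fix x assume x: "x \<in> fst \<sigma>"
      show "x \<in> fst \<tau>"
      proof (cases "x = n")
        case False
        then have "x \<in> {1..<n}" using x sub(1) by fastforce
        then show ?thesis using h x by blast
      qed (simp add: sub(2))
    qed
  qed blast
  finally have strict: "(\<forall>j\<in>fst \<sigma> \<inter> {1..<n}. v j \<noteq> v (j + 1)) \<longleftrightarrow> fst \<sigma> \<subseteq> fst \<tau>" .
  have index: "\<forall>j\<in>{1..n}. 1 \<le> var_index (v j)" by (simp add: v_def c_def)
  show "mps_coeff (F n \<sigma>) (image_mset v (mset_set {1..n})) =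
    (if (\<forall>j\<in>{1..n}. sign_vector \<tau> j = sign_vector \<sigma> j) \<and> fst \<sigma> \<subseteq> fst \<tau> then 1 else 0)"
    unfolding coeff_F_word[OF \<sigma> index incr] strict by (simp add: v_def)
qed

text \<open>The coefficient at the monomial of \<sigma> counts the entries whose sign vector agrees
  with that of \<sigma> and whose set is contained in \<open>fst \<sigma>\<close>. Induction on the
  size of the set cancels all of them but those equal to \<sigma>.\<close>

lemma sum_F_determines_distribution:
  assumes "finite B" "sDes \<in> B \<rightarrow> signed_sets n"
    and "finite B'" "sDes' \<in> B' \<rightarrow> signed_sets n"
    and eq: "(\<Sum>b\<in>B. F n (sDes b)) = (\<Sum>b\<in>B'. F n (sDes' b))"
    and "\<sigma> \<in> signed_sets n"
  shows "card {b \<in> B. sDes b = \<sigma>} = card {b \<in> B'. sDes' b = \<sigma>}"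
  using assms(6)
proof (induction "card (fst \<sigma>)" arbitrary: \<sigma> rule: less_induct)
  case less
  define R where "R = {\<rho> \<in> signed_sets n. (\<forall>j\<in>{1..n}. sign_vector \<sigma> j = sign_vector \<rho> j) \<and> fst \<rho> \<subseteq> fst \<sigma>}"
  obtain M where M: "\<forall>\<rho>\<in>signed_sets n. mps_coeff (F n \<rho>) M =
      (if (\<forall>j\<in>{1..n}. sign_vector \<sigma> j = sign_vector \<rho> j) \<and> fst \<rho> \<subseteq> fst \<sigma> then 1 else 0)"
    using coeff_F_at_signed_set[OF less.prems] by blast
  have finR: "finite R" using finite_signed_sets by (simp add: R_def)
  \<comment> \<open>The index type is generic because \<open>B\<close> and \<open>B'\<close> may
    have different element types.\<close>
  have count: "mps_coeff (\<Sum>b\<in>C. F n (s b)) M = of_nat (\<Sum>\<rho>\<in>R. card {b \<in> C. s b = \<rho>})"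
    if C: "finite C" "s \<in> C \<rightarrow> signed_sets n" for C :: "'x set" and s
  proof -
    have "mps_coeff (\<Sum>b\<in>C. F n (s b)) M = (\<Sum>b\<in>C. mps_coeff (F n (s b)) M)"
      using C(1) by (induction C rule: finite_induct) (auto simp: zero_mps.rep_eq plus_mps.rep_eq)
    also have "\<dots> = (\<Sum>b\<in>C. if s b \<in> R then 1 else 0)"
    proof (rule sum.cong[OF refl])
      fix b assume "b \<in> C"
      then have "s b \<in> signed_sets n" using C(2) by blast
      with M show "mps_coeff (F n (s b)) M = (if s b \<in> R then 1 else 0)" by (simp add: R_def)
    qed
    also have "\<dots> = of_nat (card {b \<in> C. s b \<in> R})"
      using C(1) by (simp add: sum.If_cases Int_def)
    also have "card {b \<in> C. s b \<in> R} = (\<Sum>\<rho>\<in>R. card {b \<in> C. s b = \<rho>})"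
    proof -
      have "card {b \<in> C. s b \<in> R} = (\<Sum>\<rho>\<in>R. \<Sum>b | b \<in> {b \<in> C. s b \<in> R} \<and> s b = \<rho>. 1)"
        using C(1) finR by (subst sum.group) auto
      also have "\<dots> = (\<Sum>\<rho>\<in>R. card {b \<in> C. s b = \<rho>})"
        by (intro sum.cong refl) (auto intro!: arg_cong[where f = card])
      finally show ?thesis .
    qed
    finally show ?thesis .
  qed
  have "(of_nat (\<Sum>\<rho>\<in>R. card {b \<in> B. sDes b = \<rho>}) :: complex) = of_nat (\<Sum>\<rho>\<in>R. card {b \<in> B'. sDes' b = \<rho>})"
    using count[OF assms(1,2)] count[OF assms(3,4)] eq by simp
  then have "(\<Sum>\<rho>\<in>R. card {b \<in> B. sDes b = \<rho>}) = (\<Sum>\<rho>\<in>R. card {b \<in> B'. sDes' b = \<rho>})"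
    by (simp only: of_nat_eq_iff)
  moreover have "\<sigma> \<in> R" using less.prems by (simp add: R_def)
  moreover have "(\<Sum>\<rho>\<in>R - {\<sigma>}. card {b \<in> B. sDes b = \<rho>}) = (\<Sum>\<rho>\<in>R - {\<sigma>}. card {b \<in> B'. sDes' b = \<rho>})"
  proof (rule sum.cong[OF refl])
    fix \<rho> assume \<rho>: "\<rho> \<in> R - {\<sigma>}"
    then have \<rho>': "\<rho> \<in> signed_sets n" "fst \<rho> \<subseteq> fst \<sigma>" "\<forall>j\<in>{1..n}. sign_vector \<rho> j = sign_vector \<sigma> j" "\<rho> \<noteq> \<sigma>"
      by (auto simp: R_def)
    \<comment> \<open>Within \<open>R\<close> the sign vector is fixed, so a different signed set
      has a different and hence strictly smaller underlying set.\<close>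
    have "fst \<rho> \<noteq> fst \<sigma>" using signed_set_eqI[OF \<rho>'(1) less.prems _ \<rho>'(3)] \<rho>'(4) by blast
    moreover have "finite (fst \<sigma>)" using less.prems finite_subset[of "fst \<sigma>" "{1..n}"] by (auto simp: signed_sets_def)
    ultimately have "card (fst \<rho>) < card (fst \<sigma>)" using \<rho>'(2) by (intro psubset_card_mono) auto
    from less.hyps[OF this \<rho>'(1)] show "card {b \<in> B. sDes b = \<rho>} = card {b \<in> B'. sDes' b = \<rho>}" .
  qed
  ultimately show ?case
    using sum.remove[OF finR \<open>\<sigma> \<in> R\<close>, of "\<lambda>\<rho>. card {b \<in> B. sDes b = \<rho>}"]
      sum.remove[OF finR \<open>\<sigma> \<in> R\<close>, of "\<lambda>\<rho>. card {b \<in> B'. sDes' b = \<rho>}"] by simp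
qed

theorem theorem3p6:
  fixes n :: nat
    and \<chi> :: "(int \<Rightarrow> int) \<Rightarrow> complex"
    and B :: "'b set"
    and sDes :: "'b \<Rightarrow> signed_set"
  assumes "is_character n \<chi>"
    and "finite B"
    and "sDes \<in> B \<rightarrow> signed_sets n"
  shows "(fine_set n \<chi> B sDes \<longleftrightarrow> ch n \<chi> = (\<Sum>b\<in>B. F n (sDes b))) \<and>
    (\<forall>(B' :: 'c set) sDes'.
       finite B' \<and> sDes' \<in> B' \<rightarrow> signed_sets n \<and>
       fine_set n \<chi> B sDes \<and> fine_set n \<chi> B' sDes' \<longrightarrow>
       (\<forall>\<sigma>\<in>signed_sets n. card {b \<in> B. sDes b = \<sigma>} = card {b \<in> B'. sDes' b = \<sigma>}))"
proof (intro conjI allI impI ballI)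
  show "fine_set n \<chi> B sDes \<longleftrightarrow> ch n \<chi> = (\<Sum>b\<in>B. F n (sDes b))"
    by (rule fine_set_iff_ch[OF assms(1,3)])
  fix B' :: "'c set" and sDes' \<sigma>
  assume "finite B' \<and> sDes' \<in> B' \<rightarrow> signed_sets n \<and> fine_set n \<chi> B sDes \<and> fine_set n \<chi> B' sDes'"
    and \<sigma>: "\<sigma> \<in> signed_sets n"
  then have B': "finite B'" "sDes' \<in> B' \<rightarrow> signed_sets n"
    and fine: "fine_set n \<chi> B sDes" "fine_set n \<chi> B' sDes'" by auto
  have "(\<Sum>b\<in>B. F n (sDes b)) = (\<Sum>b\<in>B'. F n (sDes' b))"
    using fine fine_set_iff_ch[OF assms(1,3)] fine_set_iff_ch[OF assms(1) B'(2)] by simp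
  then show "card {b \<in> B. sDes b = \<sigma>} = card {b \<in> B'. sDes' b = \<sigma>}"
    by (rule sum_F_determines_distribution[OF assms(2,3) B' _ \<sigma>])
qed

end
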